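(* Let $1<p<\infty$, let $\Theta\subset\mathbf{R}^{1+1}$ be a bounded nonempty open set and let $\xi_0=(0,0)\in\partial\Theta$. Assume that there is an open cone $C\subset\mathbf{R}^{1+1}\setminus\Theta$ with $\xi_0$ as vertex, and a point $(x_C,t_C)\in C$ with $t_C\le0$. Then $\xi_0$ is regular with respect to $\Theta$.
   Context: Here the space dimension is $n=1$. Points of $\mathbf{R}^{1+1}$ are written $(x,t)$, with $x\in\mathbf{R}$ the space variable and $t\in\mathbf{R}$ the time variable. An open cone with vertex at the origin is an open set $C$ with $sz\in C$ for all $z\in C$ and $s>0$. In general dimension $n$, $\nabla$ and $\operatorname{div}$ are taken with respect to $x\in\mathbf{R}^n$ only. The equation considered is $\partial_t u=\Delta_p u:=\operatorname{div}(|\nabla u|^{p-2}\nabla u)$. For an open set $U\subset\mathbf{R}^n$ and $t_1<t_2$ let $U_{t_1,t_2}=U\times(t_1,t_2)$; $D'\Subset D$ means that $\overline{D'}$ is a compact subset of $D$. A function $u$ on $\Theta$ is \emph{$p$-parabolic} if it is a continuous weak solution, i.e. $u$ is continuous and, whenever $U_{t_1,t_2}\Subset\Theta$, one has $u\in L^p(t_1,t_2;W^{1,p}(U))$, $t\mapsto\int_U|u(x,t)|^2\,dx$ is continuous on $[t_1,t_2]$, and $\int_{t_1}^{t_2}\int_U|\nabla u|^{p-2}\nabla u\cdot\nabla\varphi\,dx\,dt-\int_{t_1}^{t_2}\int_U u\,\partial_t\varphi\,dx\,dt=0$ for all $\varphi\in C_0^\infty(U_{t_1,t_2})$. A space-time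 box is $Q_{t_1,t_2}$ with $Q=(a_1,b_1)\times\cdots\times(a_n,b_n)$; its parabolic boundary is $\partial_pQ_{t_1,t_2}=(\overline{Q}\times\{t_1\})\cup(\partial Q\times(t_1,t_2])$. A function $u:\Theta\to(-\infty,\infty]$ is \emph{$p$-superparabolic} if (i) $u$ is lower semicontinuous; (ii) $u$ is finite in a dense subset of $\Theta$; (iii) for each space-time box $Q_{t_1,t_2}\Subset\Theta$: if $h$ is $p$-parabolic in $Q_{t_1,t_2}$, continuous on $\overline{Q}_{t_1,t_2}$ and $h\le u$ on $\partial_pQ_{t_1,t_2}$, then $h\le u$ in $Q_{t_1,t_2}$. For a bounded function $f:\partial\Theta\to\mathbf{R}$, the upper class $\mathcal{U}_f$ is the set of all $p$-superparabolic functions $u$ on $\Theta$ which are bounded below and satisfy $\liminf_{\Theta\ni\eta\to\xi}u(\eta)\ge f(\xi)$ for all $\xi\in\partial\Theta$. The upper Perron solution is $\overline{H}f(\xi)=\inf_{u\in\mathcal{U}_f}u(\xi)$, $\xi\in\Theta$. A point $\xi_0\in\partial\Theta$ is \emph{regular} with respect to $\Theta$ if $\lim_{\Theta\ni\xi\to\xi_0}\overline{H}f(\xi)=f(\xi_0)$ for every continuous $f:\partial\Theta\to\mathbf{R}$. *)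

theory Defs
  imports "HOL-Analysis.Analysis"
begin

text \<open>
  Points of \<open>\<real>\<^sup>n\<^sup>+\<^sup>1\<close> are pairs \<open>(x, t)\<close> of type \<open>'a \<times> real\<close>, where the Euclidean space \<open>'a\<close>
  is the space variable; \<open>n = 1\<close> is \<open>'a = real\<close>. A function on a set \<open>S\<close> is a total
  function all of whose relevant properties only depend on its values on \<open>S\<close>.
\<close>

subsection \<open>Gradients and test functions\<close>

definition grad :: "('a::real_inner \<Rightarrow> real) \<Rightarrow> 'a \<Rightarrow> 'a" where
  "grad f x = (THE D. GDERIV f x :> D)"

definition space_grad :: "('a::real_inner \<times> real \<Rightarrow> real) \<Rightarrow> 'a \<times> real \<Rightarrow> 'a" where
  "space_grad f z = grad (\<lambda>x. f (x, snd z)) (fst z)"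

definition time_deriv :: "('a \<times> real \<Rightarrow> real) \<Rightarrow> 'a \<times> real \<Rightarrow> real" where
  "time_deriv f z = deriv (\<lambda>t. f (fst z, t)) (snd z)"

primrec C_k :: "nat \<Rightarrow> ('a::euclidean_space \<Rightarrow> real) \<Rightarrow> bool" where
  "C_k 0 f \<longleftrightarrow> continuous_on UNIV f"
| "C_k (Suc k) f \<longleftrightarrow>
     (\<exists>G. (\<forall>x. GDERIV f x :> G x) \<and> (\<forall>b\<in>Basis. C_k k (\<lambda>x. G x \<bullet> b)))"

text \<open>\<open>C\<^sub>0\<^sup>\<infinity>(S)\<close>, with the functions extended by zero to the whole space.\<close>

definition test_functions :: "'a::euclidean_space set \<Rightarrow> ('a \<Rightarrow> real) set" where
  "test_functions S =
     {\<phi>. (\<forall>k. C_k k \<phi>) \<and> compact (closure {x. \<phi> x \<noteq> 0}) \<and> closure {x. \<phi> x \<noteq> 0} \<subseteq> S}"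

subsection \<open>Lebesgue and Sobolev spaces\<close>

definition Lp_on :: "real \<Rightarrow> 'b::euclidean_space set \<Rightarrow> ('b \<Rightarrow> 'c::euclidean_space) \<Rightarrow> bool" where
  "Lp_on p S f \<longleftrightarrow>
     set_borel_measurable lborel S f \<and> set_integrable lborel S (\<lambda>x. norm (f x) powr p)"

text \<open>\<open>v \<in> W\<^sup>1\<^sup>,\<^sup>p(U)\<close> with weak gradient \<open>g\<close>.\<close>

definition W1p_on :: "real \<Rightarrow> 'a::euclidean_space set \<Rightarrow> ('a \<Rightarrow> real) \<Rightarrow> ('a \<Rightarrow> 'a) \<Rightarrow> bool" where
  "W1p_on p U v g \<longleftrightarrow>
     Lp_on p U v \<and> Lp_on p U g \<and>
     (\<forall>\<phi>\<in>test_functions U.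
        (LINT x:U|lborel. v x *\<^sub>R grad \<phi> x) = - (LINT x:U|lborel. \<phi> x *\<^sub>R g x))"

text \<open>
  \<open>u \<in> L\<^sup>p(t\<^sub>1, t\<^sub>2; W\<^sup>1\<^sup>,\<^sup>p(U))\<close> with weak spatial gradient \<open>g\<close>: almost every time slice belongs
  to \<open>W\<^sup>1\<^sup>,\<^sup>p(U)\<close>, and the \<open>p\<close>-th power of the \<open>W\<^sup>1\<^sup>,\<^sup>p(U)\<close>-norm is integrable in time.
\<close>

definition Lp_W1p ::
  "real \<Rightarrow> 'a::euclidean_space set \<Rightarrow> real \<Rightarrow> real \<Rightarrow> ('a \<times> real \<Rightarrow> real) \<Rightarrow> ('a \<times> real \<Rightarrow> 'a) \<Rightarrow> bool"
  where
  "Lp_W1p p U t1 t2 u g \<longleftrightarrow>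
     Lp_on p (U \<times> {t1<..<t2}) u \<and> Lp_on p (U \<times> {t1<..<t2}) g \<and>
     (AE t in lborel. t \<in> {t1<..<t2} \<longrightarrow> W1p_on p U (\<lambda>x. u (x, t)) (\<lambda>x. g (x, t)))"

subsection \<open>Parabolic and superparabolic functions\<close>

definition compactly_in :: "'a::topological_space set \<Rightarrow> 'a set \<Rightarrow> bool" where
  "compactly_in D' D \<longleftrightarrow> compact (closure D') \<and> closure D' \<subseteq> D"

text \<open>
  Since \<open>0 powr a = 0\<close> for every \<open>a\<close>, the integrand \<open>\<bar>\<nabla>u\<bar>\<^sup>p\<^sup>-\<^sup>2\<nabla>u\<close> vanishes where \<open>\<nabla>u = 0\<close>, as usual,
  also for \<open>p \<le> 2\<close>.
\<close>

definition p_parabolic ::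
  "real \<Rightarrow> ('a::euclidean_space \<times> real) set \<Rightarrow> ('a \<times> real \<Rightarrow> real) \<Rightarrow> bool" where
  "p_parabolic p \<Theta> u \<longleftrightarrow>
     continuous_on \<Theta> u \<and>
     (\<forall>U t1 t2. open U \<and> t1 < t2 \<and> compactly_in (U \<times> {t1<..<t2}) \<Theta> \<longrightarrow>
        continuous_on {t1..t2} (\<lambda>t. LINT x:U|lborel. \<bar>u (x, t)\<bar>\<^sup>2) \<and>
        (\<exists>g. Lp_W1p p U t1 t2 u g \<and>
           (\<forall>\<phi>\<in>test_functions (U \<times> {t1<..<t2}).
              (LINT z:U \<times> {t1<..<t2}|lborel.
                 (norm (g z) powr (p - 2) *\<^sub>R g z) \<bullet> space_grad \<phi> z)
              - (LINT z:U \<times> {t1<..<t2}|lborel. u z * time_deriv \<phi> z) = 0)))"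

definition parabolic_boundary ::
  "'a::euclidean_space set \<Rightarrow> real \<Rightarrow> real \<Rightarrow> ('a \<times> real) set" where
  "parabolic_boundary Q t1 t2 = closure Q \<times> {t1} \<union> frontier Q \<times> {t1<..t2}"

text \<open>Lower semicontinuity is expressed with \<^const>\<open>Liminf\<close> over punctured neighbourhoods.\<close>

definition p_superparabolic ::
  "real \<Rightarrow> ('a::euclidean_space \<times> real) set \<Rightarrow> ('a \<times> real \<Rightarrow> ereal) \<Rightarrow> bool" where
  "p_superparabolic p \<Theta> u \<longleftrightarrow>
     (\<forall>z\<in>\<Theta>. u z \<noteq> -\<infinity>) \<and>
     (\<forall>z\<in>\<Theta>. u z \<le> Liminf (at z within \<Theta>) u) \<and>
     \<Theta> \<subseteq> closure {z\<in>\<Theta>. u z \<noteq> \<infinity>} \<and>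
     (\<forall>a b t1 t2 h.
        box a b \<noteq> {} \<and> t1 < t2 \<and> compactly_in (box a b \<times> {t1<..<t2}) \<Theta> \<and>
        p_parabolic p (box a b \<times> {t1<..<t2}) h \<and>
        continuous_on (closure (box a b \<times> {t1<..<t2})) h \<and>
        (\<forall>z\<in>parabolic_boundary (box a b) t1 t2. ereal (h z) \<le> u z) \<longrightarrow>
        (\<forall>z\<in>box a b \<times> {t1<..<t2}. ereal (h z) \<le> u z))"

subsection \<open>Perron solutions and regular boundary points\<close>

definition upper_class ::
  "real \<Rightarrow> ('a::euclidean_space \<times> real) set \<Rightarrow> ('a \<times> real \<Rightarrow> real) \<Rightarrow> ('a \<times> real \<Rightarrow> ereal) set" where
  "upper_class p \<Theta> f =
     {u. p_superparabolic p \<Theta> u \<and>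
         (\<exists>m::real. \<forall>z\<in>\<Theta>. ereal m \<le> u z) \<and>
         (\<forall>\<xi>\<in>frontier \<Theta>. ereal (f \<xi>) \<le> Liminf (at \<xi> within \<Theta>) u)}"

definition upper_perron ::
  "real \<Rightarrow> ('a::euclidean_space \<times> real) set \<Rightarrow> ('a \<times> real \<Rightarrow> real) \<Rightarrow> 'a \<times> real \<Rightarrow> ereal" where
  "upper_perron p \<Theta> f \<xi> = (INF u\<in>upper_class p \<Theta> f. u \<xi>)"

text \<open>For bounded \<open>\<Theta>\<close> every continuous \<open>f\<close> on \<open>frontier \<Theta>\<close> is bounded.\<close>

definition regular_point ::
  "real \<Rightarrow> ('a::euclidean_space \<times> real) set \<Rightarrow> 'a \<times> real \<Rightarrow> bool" where
  "regular_point p \<Theta> \<xi>0 \<longleftrightarrow>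
     \<xi>0 \<in> frontier \<Theta> \<and>
     (\<forall>f. continuous_on (frontier \<Theta>) f \<longrightarrow>
        ((upper_perron p \<Theta> f) \<longlongrightarrow> ereal (f \<xi>0)) (at \<xi>0 within \<Theta>))"

text \<open>Unlike for the library's \<^const>\<open>cone\<close>, the vertex \<open>0\<close> need not belong to the set.\<close>

definition open_cone :: "'a::real_normed_vector set \<Rightarrow> bool" where
  "open_cone C \<longleftrightarrow> open C \<and> (\<forall>z\<in>C. \<forall>s>0. s *\<^sub>R z \<in> C)"

end

theory Submission
  imports Defs "HOL-Computational_Algebra.Polynomial"
begin

text \<open>
  For \<open>n = 1\<close> the functions \<open>a t + \<psi> x\<close> with \<open>\<bar>\<psi>'\<bar>\<^sup>p\<^sup>-\<^sup>2 \<psi>' = a x + b\<close> are exact solutions on the whole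
  plane, and they suffice both as barriers and as comparison functions.

  A weak solution \<open>h\<close> on a rectangle that lies below an exact solution \<open>H\<close> on the parabolic boundary
  lies below it inside: test the equation with the square of the positive part of \<open>h - H - \<eta>\<close>, using
  backward averages of the flux in time. Conversely, a superparabolic function lies above an exact
  solution as soon as it does so on the boundary of a bounded open set; a minimum of the difference is
  excluded by comparing with another exact solution in a small box.

  An open cone that meets \<open>t \<le> 0\<close> also meets \<open>t < 0\<close>, so \<open>\<Theta>\<close> omits a ray
  \<open>x = - k t\<close>, \<open>t \<le> 0\<close>. The ray separates the past of \<open>\<Theta>\<close> into two sectors, and in each of them some exact
  solution is nonnegative, vanishes at the vertex and is large away from it. At \<open>t = 0\<close> a
  superparabolic function may jump up, so for positive times one can switch to an exact solution
  \<open>\<epsilon> + A t + \<psi> x\<close> with \<open>A\<close> large. The resulting barrier bounds the upper Perron solution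
  from above and, subtracted from a constant, from below.
\<close>

subsection \<open>Smooth cut-off functions\<close>

text \<open>A weak solution has no time derivative to pair with a function of the solution. What
  survives is an identity: the flux integrated over a time interval is absolutely continuous in
  \<open>x\<close>, with the increment of \<open>h\<close> as derivative. Pairing it with a test
  function at the end of the interval sets the flux at earlier times against a gradient at a later
  one, so monotonicity of the flux helps only in the limit of short intervals.

  The term \<open>- \<alpha> * t\<close> that makes the past barriers positive is harmful for
  \<open>t > 0\<close>, and there the ray separates nothing: \<Theta> may surround the vertex in the
  future. So one function serves both sides at positive times. It has to lie above the past barriers
  at time \<open>0\<close>; these rise with positive slope on either side of the vertex, whereas a
  profile with flux \<open>A * x\<close> is flat there. Hence the lift by \<epsilon>.

  The glued barrier satisfies no equation of its own. Both bounds for the Perron solution come from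
  chains of comparisons with single exact solutions, each supplying boundary values for the
  next.\<close>

definition smooth_real :: "(real \<Rightarrow> real) \<Rightarrow> bool" where
  "smooth_real f \<longleftrightarrow>
     (\<exists>F. F 0 = f \<and> (\<forall>n x. (F n has_real_derivative F (Suc n) x) (at x)))"

lemma smooth_real_antiderivative:
  assumes "smooth_real f" and "\<And>x. (g has_real_derivative f x) (at x)"
  shows "smooth_real g"
proof -
  obtain F where F: "F 0 = f" "\<And>n x. (F n has_real_derivative F (Suc n) x) (at x)"
    using assms(1) unfolding smooth_real_def by blast
  show ?thesis
    unfolding smooth_real_def
  proof (intro exI[of _ "case_nat g F"] conjI allI)
    show "((case n of 0 \<Rightarrow> g | Suc m \<Rightarrow> F m) has_real_derivative
        (case Suc n of 0 \<Rightarrow> g | Suc m \<Rightarrow> F m) x) (at x)" for n x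
      using F assms(2) by (cases n) auto
  qed auto
qed

lemma smooth_real_derivative:
  assumes "smooth_real f"
  obtains f' where "smooth_real f'" and "\<And>x. (f has_real_derivative f' x) (at x)"
proof -
  obtain F where F: "F 0 = f" "\<And>n x. (F n has_real_derivative F (Suc n) x) (at x)"
    using assms unfolding smooth_real_def by blast
  have "smooth_real (F 1)"
    unfolding smooth_real_def using F by (intro exI[of _ "\<lambda>n. F (Suc n)"]) auto
  moreover have "(f has_real_derivative F 1 x) (at x)" for x
    using F(1) F(2)[of 0 x] by simp
  ultimately show ?thesis using that by blast
qed

lemma smooth_real_affine:
  assumes "smooth_real f"
  shows "smooth_real (\<lambda>x. f (a * x + b))"
proof -
  obtain F where F: "F 0 = f" "\<And>n x. (F n has_real_derivative F (Suc n) x) (at x)"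
    using assms unfolding smooth_real_def by blast
  show ?thesis
    unfolding smooth_real_def
  proof (intro exI[of _ "\<lambda>n x. a ^ n * F n (a * x + b)"] conjI allI)
    fix n x
    have "((\<lambda>x. F n (a * x + b)) has_real_derivative F (Suc n) (a * x + b) * a) (at x)"
      by (rule DERIV_chain2[OF F(2)]) (auto intro!: derivative_eq_intros)
    from DERIV_cmult[OF this, of "a ^ n"]
    show "((\<lambda>x. a ^ n * F n (a * x + b)) has_real_derivative
        a ^ Suc n * F (Suc n) (a * x + b)) (at x)"
      by (simp add: mult_ac)
  qed (simp add: F)
qed

lemma smooth_real_diff:
  assumes "smooth_real f" "smooth_real g"
  shows "smooth_real (\<lambda>x. f x - g x)"
proof -
  obtain F G where "F 0 = f" "\<And>n x. (F n has_real_derivative F (Suc n) x) (at x)"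
    "G 0 = g" "\<And>n x. (G n has_real_derivative G (Suc n) x) (at x)"
    using assms unfolding smooth_real_def by metis
  then show ?thesis
    unfolding smooth_real_def
    by (intro exI[of _ "\<lambda>n x. F n x - G n x"]) (auto intro!: derivative_eq_intros)
qed

lemma smooth_real_cmult:
  assumes "smooth_real f"
  shows "smooth_real (\<lambda>x. c * f x)"
proof -
  obtain F where "F 0 = f" "\<And>n x. (F n has_real_derivative F (Suc n) x) (at x)"
    using assms unfolding smooth_real_def by metis
  then show ?thesis
    unfolding smooth_real_def
    by (intro exI[of _ "\<lambda>n x. c * F n x"]) (auto intro!: derivative_eq_intros)
qed

text \<open>Choose a derivative within the class and iterate. In this form no closed formula for
  higher derivatives is ever required.\<close>

lemma smooth_real_coinduct:
  assumes "f \<in> S" and "\<And>f. f \<in> S \<Longrightarrow> \<exists>f'\<in>S. \<forall>x. (f has_real_derivative f' x) (at x)"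
  shows "smooth_real f"
proof -
  obtain D where D: "\<And>f. f \<in> S \<Longrightarrow> D f \<in> S \<and> (\<forall>x. (f has_real_derivative D f x) (at x))"
    using assms(2) by metis
  have "(D ^^ n) f \<in> S" for n
    by (induction n) (use assms(1) D in auto)
  then show ?thesis
    unfolding smooth_real_def using D by (intro exI[of _ "\<lambda>n. (D ^^ n) f"]) auto
qed

text \<open>By the Leibniz rule the finite linear combinations of products of higher derivatives of
  \<open>f\<close> and \<open>g\<close> form a class closed under differentiation.\<close>

lemma smooth_real_mult:
  assumes "smooth_real f" "smooth_real g"
  shows "smooth_real (\<lambda>x. f x * g x)"
proof -
  obtain F G where F: "F 0 = f" "\<And>n x. (F n has_real_derivative F (Suc n) x) (at x)"
    and G: "G 0 = g" "\<And>n x. (G n has_real_derivative G (Suc n) x) (at x)"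
    using assms unfolding smooth_real_def by metis
  define S where "S = {\<lambda>x. \<Sum>i<n. c i * F (k i) x * G (l i) x |(n::nat) (c::nat \<Rightarrow> real) k l. True}"
  show ?thesis
  proof (rule smooth_real_coinduct)
    show "(\<lambda>x. f x * g x) \<in> S"
      unfolding S_def using F(1) G(1)
      by (auto intro!: exI[of _ "1::nat"] exI[of _ "\<lambda>_. 1::real"] exI[of _ "\<lambda>_. 0::nat"])
    fix h assume "h \<in> S"
    then obtain n :: nat and c k l where h: "h = (\<lambda>x. \<Sum>i<n. c i * F (k i) x * G (l i) x)"
      unfolding S_def mem_Collect_eq by (elim exE conjE) (rule that)
    \<comment> \<open>Each summand \<open>i\<close> produces two: index \<open>2 * i\<close>
      differentiates the \<open>G\<close> factor and index \<open>2 * i + 1\<close> the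
      \<open>F\<close> factor.\<close>
    define c' k' l' where "c' = (\<lambda>i. c (i div 2))"
      and "k' = (\<lambda>i. k (i div 2) + i mod 2)" and "l' = (\<lambda>i. l (i div 2) + (1 - i mod 2))"
    define h' where "h' = (\<lambda>x. \<Sum>i<2*n. c' i * F (k' i) x * G (l' i) x)"
    have "(\<Sum>i<2*n. c' i * F (k' i) x * G (l' i) x) =
        (\<Sum>i<n. c i * (F (Suc (k i)) x * G (l i) x + F (k i) x * G (Suc (l i)) x))" for x
    proof (induction n)
      case (Suc n)
      have "{..<2 * Suc n} = insert (2*n) (insert (2*n+1) {..<2*n})" by auto
      moreover have "Suc (n * 2) mod 2 = Suc 0" by presburger
      ultimately show ?case
        using Suc by (simp add: c'_def k'_def l'_def algebra_simps)
    qed auto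
    then have "(h has_real_derivative h' x) (at x)" for x
      unfolding h h'_def
      by (auto intro!: derivative_eq_intros DERIV_sum F(2) G(2) sum.cong simp: algebra_simps)
    moreover have "h' \<in> S" unfolding S_def h'_def by blast
    ultimately show "\<exists>f'\<in>S. \<forall>x. (h has_real_derivative f' x) (at x)" by blast
  qed
qed

text \<open>For \<open>P = 1\<close> this is the classical flat function. The polynomial factor in
  \<open>1 / x\<close> makes the family closed under differentiation.\<close>

definition exp_inverse_poly :: "real poly \<Rightarrow> real \<Rightarrow> real" where
  "exp_inverse_poly P x = (if x > 0 then poly P (1 / x) * exp (- 1 / x) else 0)"

lemma tendsto_poly_div_exp: "((\<lambda>x. poly P x / exp x) \<longlongrightarrow> (0::real)) at_top"
proof -
  have "((\<lambda>x. \<Sum>i\<le>degree P. coeff P i * (x ^ i / exp x)) \<longlongrightarrow> (\<Sum>i\<le>degree P. coeff P i * 0)) at_top"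
    by (intro tendsto_sum tendsto_mult_left tendsto_power_div_exp_0)
  then show ?thesis
    by (simp add: poly_altdef sum_divide_distrib)
qed

lemma exp_inverse_poly_tendsto_0: "(exp_inverse_poly P \<longlongrightarrow> 0) (at 0)"
proof -
  have "((\<lambda>x. poly P (inverse x) / exp (inverse x)) \<longlongrightarrow> (0::real)) (at_right 0)"
    by (rule filterlim_compose[OF tendsto_poly_div_exp filterlim_inverse_at_top_right])
  then have "(exp_inverse_poly P \<longlongrightarrow> 0) (at_right 0)"
    by (rule Lim_transform_eventually)
      (auto simp: eventually_at_filter exp_inverse_poly_def exp_minus field_simps)
  moreover have "(exp_inverse_poly P \<longlongrightarrow> 0) (at_left 0)"
    by (rule tendsto_eventually) (auto simp: eventually_at_filter exp_inverse_poly_def)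
  ultimately show ?thesis by (simp add: filterlim_split_at)
qed

text \<open>Put \<open>y = 1 / x\<close>: the derivative of \<open>poly P y * exp (- y)\<close> in
  \<open>y\<close> is \<open>- (P - P') * exp (- y)\<close>, and \<open>dy/dx = - y^2\<close>
  accounts for the factor \<open>[:0, 0, 1:]\<close>.\<close>

lemma DERIV_exp_inverse_poly:
  "(exp_inverse_poly P has_real_derivative
     exp_inverse_poly ((P - pderiv P) * [:0, 0, 1:]) x) (at x)"
proof -
  consider "x > 0" | "x < 0" | "x = 0" by linarith
  then show ?thesis
  proof cases
    case 1
    have "((\<lambda>x. poly P (1 / x) * exp (- 1 / x)) has_real_derivative
        exp_inverse_poly ((P - pderiv P) * [:0, 0, 1:]) x) (at x)"
      using 1 by (auto intro!: derivative_eq_intros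
          simp: exp_inverse_poly_def field_simps power2_eq_square)
    then show ?thesis
      by (rule has_field_derivative_transform_within_open[where S = "{0<..}"])
        (use 1 in \<open>auto simp: exp_inverse_poly_def\<close>)
  next
    case 2
    have "((\<lambda>x. 0) has_real_derivative exp_inverse_poly ((P - pderiv P) * [:0, 0, 1:]) x) (at x)"
      using 2 by (simp add: exp_inverse_poly_def)
    then show ?thesis
      by (rule has_field_derivative_transform_within_open[where S = "{..<0}"])
        (use 2 in \<open>auto simp: exp_inverse_poly_def\<close>)
  next
    case 3
    \<comment> \<open>At \<open>0\<close> the difference quotient is again a member of the family,
      with polynomial \<open>pCons 0 P\<close>, and so tends to \<open>0\<close>.\<close>
    have "((\<lambda>h. (exp_inverse_poly P (0 + h) - exp_inverse_poly P 0) / h) \<longlongrightarrow> 0) (at 0)"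
      by (rule Lim_transform_eventually[OF exp_inverse_poly_tendsto_0[of "pCons 0 P"]])
        (auto simp: eventually_at_filter exp_inverse_poly_def)
    then show ?thesis
      unfolding DERIV_def using 3 by (simp add: exp_inverse_poly_def)
  qed
qed

lemma smooth_real_exp_inverse_poly: "smooth_real (exp_inverse_poly P)"
  by (rule smooth_real_coinduct[of _ "range exp_inverse_poly"])
    (auto intro: DERIV_exp_inverse_poly)

lemma antiderivative_exists:
  fixes f :: "real \<Rightarrow> real"
  assumes "continuous_on UNIV f"
  obtains F where "\<And>x. (F has_real_derivative f x) (at x)"
  using einterval_antiderivative[of "-\<infinity>" \<infinity> f] assms
  by (auto simp: has_real_derivative_iff_has_vector_derivative continuous_on_eq_continuous_at)

lemma smooth_real_continuous: "smooth_real f \<Longrightarrow> continuous_on S f"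
  by (metis DERIV_isCont continuous_at_imp_continuous_on smooth_real_derivative)

text \<open>The step is the normalised primitive of a smooth function that is positive exactly on
  \<open>(0, 1)\<close>.\<close>

lemma smooth_step_exists:
  obtains s where "smooth_real s" "\<And>x. x \<le> 0 \<Longrightarrow> s x = 0" "\<And>x. x \<ge> 1 \<Longrightarrow> s x = 1"
    "\<And>x. 0 \<le> s x" "\<And>x. s x \<le> (1::real)"
proof -
  define kap where "kap x = exp_inverse_poly 1 x * exp_inverse_poly 1 (1 - x)" for x
  have sm: "smooth_real kap"
    unfolding kap_def
    using smooth_real_mult[OF smooth_real_exp_inverse_poly[of 1] smooth_real_affine[OF smooth_real_exp_inverse_poly[of 1], of "-1" 1]]
    by simp
  obtain F where F: "\<And>x. (F has_real_derivative kap x) (at x)"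
    using antiderivative_exists smooth_real_continuous[OF sm] by blast
  have nn: "kap x \<ge> 0" for x by (simp add: kap_def exp_inverse_poly_def)
  have mono: "F x \<le> F y" if "x \<le> y" for x y
    by (rule DERIV_nonneg_imp_nondecreasing[OF that]) (use F nn in blast)
  have lt: "F 0 < F 1"
  proof -
    \<comment> \<open>The criterion asks for a positive derivative on a closed interval, and
      \<open>kap\<close> vanishes at \<open>0\<close> and \<open>1\<close>.\<close>
    have "F (1/4) < F (3/4)"
      by (rule DERIV_pos_imp_increasing)
        (auto intro!: exI[of _ "kap _"] F simp: kap_def exp_inverse_poly_def)
    then show ?thesis using mono[of 0 "1/4"] mono[of "3/4" 1] by simp
  qed
  have left: "F x = F 0" if "x \<le> 0" for x
  proof (rule antisym)
    show "F 0 \<le> F x"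
      by (rule DERIV_nonpos_imp_nonincreasing[OF that])
        (use F in \<open>fastforce simp: kap_def exp_inverse_poly_def\<close>)
  qed (rule mono[OF that])
  have right: "F x = F 1" if "x \<ge> 1" for x
  proof (rule antisym)
    show "F x \<le> F 1"
      by (rule DERIV_nonpos_imp_nonincreasing[OF that])
        (use F in \<open>fastforce simp: kap_def exp_inverse_poly_def\<close>)
  qed (rule mono[OF that])
  define s where "s x = 1 / (F 1 - F 0) * (F x - F 0)" for x
  have "smooth_real (\<lambda>x. F x - F 0)"
    by (rule smooth_real_antiderivative[OF sm]) (auto intro!: derivative_eq_intros F)
  then have "smooth_real s" unfolding s_def by (rule smooth_real_cmult)
  moreover have "s x = 0" if "x \<le> 0" for x using left[OF that] by (simp add: s_def)
  moreover have "s x = 1" if "x \<ge> 1" for x using right[OF that] lt by (simp add: s_def)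
  moreover have "0 \<le> s x" for x
    using left[of x] mono[of 0 x] lt by (cases "x \<le> 0") (auto simp: s_def)
  moreover have "s x \<le> 1" for x
    using right[of x] mono[of x 1] lt by (cases "x \<ge> 1") (auto simp: s_def field_simps)
  ultimately show ?thesis by (rule that)
qed

section \<open>Bumps, smooth ramps and the test functions built from them\<close>

text \<open>These are the test functions of the interval \<open>(c1, c2)\<close>. The case
  \<open>b < a\<close> is not excluded; then \<open>X\<close> is zero.\<close>

definition bumps :: "real \<Rightarrow> real \<Rightarrow> (real \<Rightarrow> real) set" where
  "bumps c1 c2 = {X. smooth_real X \<and> (\<exists>a b. c1 < a \<and> b < c2 \<and> (\<forall>x. X x \<noteq> 0 \<longrightarrow> a \<le> x \<and> x \<le> b))}"

text \<open>As \<delta> tends to \<open>0\<close>, the derivative of the ramp tends to the indicator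
  of \<open>[0, l]\<close>. The ramp is constant beyond \<open>l + \<delta>\<close>, so the
  difference of two translates has compact support and may be used as a test function.\<close>

lemma smooth_ramp_exists:
  assumes "0 < l" "0 < \<delta>"
  obtains J J' c where "smooth_real J" "\<And>x. (J has_real_derivative J' x) (at x)"
    "\<And>x. x \<le> 0 \<Longrightarrow> J x = 0" "\<And>x. x \<ge> l + \<delta> \<Longrightarrow> J x = c"
    "\<And>x. 0 \<le> J' x" "\<And>x. J' x \<le> 1" "continuous_on UNIV J'"
    "\<And>x. \<delta> \<le> x \<Longrightarrow> x \<le> l \<Longrightarrow> J' x = 1" "\<And>x. x \<le> 0 \<or> x \<ge> l + \<delta> \<Longrightarrow> J' x = (0::real)"
proof -
  obtain s where s: "smooth_real s" "\<And>x. x \<le> 0 \<Longrightarrow> s x = 0" "\<And>x. x \<ge> 1 \<Longrightarrow> s x = 1"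
    "\<And>x. 0 \<le> s x" "\<And>x. s x \<le> (1::real)" by (rule smooth_step_exists) (rule that)
  define J' where "J' x = s (x / \<delta>) * s ((l + \<delta> - x) / \<delta>)" for x
  have "J' = (\<lambda>x. s (1/\<delta> * x + 0) * s (-1/\<delta> * x + (l + \<delta>) / \<delta>))"
    by (simp add: J'_def fun_eq_iff diff_divide_distrib)
  then have sm: "smooth_real J'"
    by (simp only:) (intro smooth_real_mult smooth_real_affine s(1))
  obtain F where F: "\<And>x. (F has_real_derivative J' x) (at x)"
    using antiderivative_exists smooth_real_continuous[OF sm] by blast
  define J where "J x = F x - F 0" for x
  have D: "(J has_real_derivative J' x) (at x)" for x
    unfolding J_def by (auto intro!: derivative_eq_intros F)
  have z: "J' x = 0" if "x \<le> 0 \<or> x \<ge> l + \<delta>" for x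
    using that assms s(2)[of "x / \<delta>"] s(2)[of "(l + \<delta> - x) / \<delta>"]
    by (auto simp: J'_def divide_nonpos_pos)
  have 1: "J' x = 1" if "\<delta> \<le> x" "x \<le> l" for x
    using that assms by (simp add: J'_def field_simps s(3))
  have const: "J x = J y" if "x \<le> y" "\<And>u. x \<le> u \<Longrightarrow> u \<le> y \<Longrightarrow> J' u = 0" for x y
  proof (rule antisym)
    show "J x \<le> J y"
      by (rule DERIV_nonneg_imp_nondecreasing[OF that(1)]) (use D that in force)
    show "J y \<le> J x"
      by (rule DERIV_nonpos_imp_nonincreasing[OF that(1)]) (use D that in force)
  qed
  show ?thesis
  proof (rule that[of J J' "J (l + \<delta>)"])
    show "smooth_real J" by (rule smooth_real_antiderivative[OF sm D])
    show "J x = 0" if "x \<le> 0" for x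
      using const[OF that] z by (auto simp: J_def)
    show "J x = J (l + \<delta>)" if "x \<ge> l + \<delta>" for x
      using const[OF that] z by auto
    show "J' x \<le> 1" for x unfolding J'_def using s(4,5) by (simp add: mult_le_one)
  qed (use D z 1 s(4) smooth_real_continuous[OF sm] in \<open>auto simp: J'_def\<close>)
qed

lemma C_k_smooth_real:
  assumes "smooth_real f"
  shows "C_k k f"
  using assms
proof (induction k arbitrary: f)
  case 0
  then show ?case by (simp add: smooth_real_continuous)
next
  case (Suc k)
  obtain f' where f': "smooth_real f'" "\<And>x. (f has_real_derivative f' x) (at x)"
    by (rule smooth_real_derivative[OF Suc.prems]) (rule that)
  have "GDERIV f x :> f' x" for x
    using f'(2)[of x] by (simp add: gderiv_def has_field_derivative_def mult.commute[of "f' x"] mult_commute_abs)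
  then show ?case
    using Suc.IH[OF f'(1)] by auto
qed

lemma GDERIV_tensor:
  fixes f g :: "real \<Rightarrow> real"
  assumes "(f has_real_derivative f') (at (fst z))" "(g has_real_derivative g') (at (snd z))"
  shows "GDERIV (\<lambda>z. f (fst z) * g (snd z)) z :> (f' * g (snd z), f (fst z) * g')"
proof -
  have 1: "((\<lambda>z. f (fst z)) has_derivative (\<lambda>h. f' * fst h)) (at z)"
    using has_derivative_compose[OF has_derivative_fst[OF has_derivative_ident] assms(1)[unfolded has_field_derivative_def]]
    by simp
  have 2: "((\<lambda>z. g (snd z)) has_derivative (\<lambda>h. g' * snd h)) (at z)"
    using has_derivative_compose[OF has_derivative_snd[OF has_derivative_ident] assms(2)[unfolded has_field_derivative_def]]
    by simp
  show ?thesis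
    unfolding gderiv_def
    by (rule has_derivative_eq_rhs[OF has_derivative_mult[OF 1 2]])
      (auto simp: inner_prod_def algebra_simps)
qed

lemma C_k_tensor:
  assumes "smooth_real f" "smooth_real g"
  shows "C_k k (\<lambda>z. f (fst z) * g (snd z))"
  using assms
proof (induction k arbitrary: f g)
  case 0
  then show ?case
    by (auto intro!: continuous_intros
        continuous_on_compose2[OF smooth_real_continuous[of f UNIV]] continuous_on_compose2[OF smooth_real_continuous[of g UNIV]])
next
  case (Suc k)
  obtain f' where f': "smooth_real f'" "\<And>x. (f has_real_derivative f' x) (at x)"
    by (rule smooth_real_derivative[OF Suc.prems(1)]) (rule that)
  obtain g' where g': "smooth_real g'" "\<And>x. (g has_real_derivative g' x) (at x)"
    by (rule smooth_real_derivative[OF Suc.prems(2)]) (rule that)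
  show ?case
    using GDERIV_tensor[OF f'(2) g'(2)] Suc.IH[OF f'(1) Suc.prems(2)] Suc.IH[OF Suc.prems(1) g'(1)]
    by (auto simp: Basis_prod_def intro!: exI[of _ "\<lambda>z. (f' (fst z) * g (snd z), f (fst z) * g' (snd z))"])
qed

lemma bumps_test_functions:
  assumes "X \<in> bumps c1 c2"
  shows "X \<in> test_functions {c1<..<c2}"
proof -
  obtain a b where X: "smooth_real X" "c1 < a" "b < c2" "\<And>x. X x \<noteq> 0 \<Longrightarrow> a \<le> x \<and> x \<le> b"
    using assms unfolding bumps_def by blast
  have *: "closure {x. X x \<noteq> 0} \<subseteq> {a..b}"
    by (rule closure_minimal) (use X in auto)
  then have "compact (closure {x. X x \<noteq> 0})"
    by (meson bounded_closed_interval bounded_subset closed_closure compact_eq_bounded_closed)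
  then show ?thesis
    using * X C_k_smooth_real[OF X(1)] unfolding test_functions_def by fastforce
qed

text \<open>The weak equation is only ever tested with such products; they suffice to follow the
  integrals of \<open>h\<close> against functions of \<open>x\<close> in time.\<close>

lemma bumps_tensor_test_functions:
  assumes "X \<in> bumps c1 c2" "Y \<in> bumps s1 s2"
  shows "(\<lambda>z. X (fst z) * Y (snd z)) \<in> test_functions ({c1<..<c2} \<times> {s1<..<s2})"
proof -
  obtain a b where X: "smooth_real X" "c1 < a" "b < c2" "\<And>x. X x \<noteq> 0 \<Longrightarrow> a \<le> x \<and> x \<le> b"
    using assms unfolding bumps_def by blast
  obtain a' b' where Y: "smooth_real Y" "s1 < a'" "b' < s2" "\<And>x. Y x \<noteq> 0 \<Longrightarrow> a' \<le> x \<and> x \<le> b'"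
    using assms unfolding bumps_def by blast
  let ?S = "{z. X (fst z) * Y (snd z) \<noteq> 0}"
  have *: "closure ?S \<subseteq> {a..b} \<times> {a'..b'}"
    by (rule closure_minimal) (use X Y in \<open>auto intro!: closed_Times\<close>)
  moreover have "compact ({a..b} \<times> {a'..b'})" by (simp add: compact_Times)
  ultimately have "compact (closure ?S)"
    using closed_Int_compact[OF closed_closure, of "{a..b} \<times> {a'..b'}" ?S] by (simp add: inf.absorb1)
  then show ?thesis
    using * X Y C_k_tensor[OF X(1) Y(1)] unfolding test_functions_def by fastforce
qed

subsection \<open>Primitives of integrable functions and du Bois-Reymond's lemma\<close>

text \<open>Functions on an interval are extended by zero beforehand, so their primitive in this
  sense vanishes to the left of the interval.\<close>

definition prim :: "(real \<Rightarrow> real) \<Rightarrow> real \<Rightarrow> real" where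
  "prim f x = (LINT y:{..<x}|lborel. f y)"

lemma set_integral_Ico_eq_Icc:
  fixes f :: "real \<Rightarrow> real"
  assumes [measurable]: "f \<in> borel_measurable borel"
  shows "(LINT y:{a..<b}|lborel. f y) = (LINT y:{a..b}|lborel. f y)"
  unfolding set_lebesgue_integral_def
proof (rule integral_cong_AE)
  have "AE y in lborel. y \<noteq> b" by (rule AE_lborel_singleton)
  then show "AE y in lborel. indicator {a..<b} y *\<^sub>R f y = indicator {a..b} y *\<^sub>R f y"
    by eventually_elim (auto simp: indicator_def)
qed auto

lemma set_integrable_lborel:
  fixes f :: "real \<Rightarrow> real"
  assumes "integrable lborel f" "A \<in> sets borel"
  shows "set_integrable lborel A f"
  unfolding set_integrable_def using assms by (intro integrable_mult_indicator) auto

lemma integrable_tensor: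
  fixes f g :: "real \<Rightarrow> real"
  assumes "integrable lborel f" "integrable lborel g"
  shows "integrable (lborel \<Otimes>\<^sub>M lborel) (\<lambda>z. f (fst z) * g (snd z))"
proof (rule lborel_pair.Fubini_integrable)
  have [measurable]: "f \<in> borel_measurable borel" "g \<in> borel_measurable borel"
    using assms by auto
  show "(\<lambda>z. f (fst z) * g (snd z)) \<in> borel_measurable (lborel \<Otimes>\<^sub>M lborel)"
    by measurable
  show "integrable lborel (\<lambda>x. LINT y|lborel. norm (f (fst (x, y)) * g (snd (x, y))))"
    using assms by (simp add: abs_mult)
  show "AE x in lborel. integrable lborel (\<lambda>y. f (fst (x, y)) * g (snd (x, y)))"
    using assms by simp
qed

lemma prim_measurable [measurable]:
  assumes [measurable]: "f \<in> borel_measurable borel"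
  shows "prim f \<in> borel_measurable borel"
proof -
  have "(\<lambda>x. LINT y|lborel. indicator {z. fst z > snd z} (x, y) *\<^sub>R f y) \<in> borel_measurable lborel"
    by measurable
  moreover have "indicator {z. fst z > snd z} (x, y) = (indicator {..<x} y :: real)" for x y :: real
    by (auto simp: indicator_def)
  ultimately show ?thesis by (simp add: prim_def[abs_def] set_lebesgue_integral_def)
qed

lemma abs_prim_le:
  assumes "integrable lborel f"
  shows "\<bar>prim f x\<bar> \<le> (LINT y|lborel. \<bar>f y\<bar>)"
proof -
  have "\<bar>prim f x\<bar> \<le> (LINT y|lborel. \<bar>indicator {..<x} y * f y\<bar>)"
    unfolding prim_def set_lebesgue_integral_def by (simp add: integral_abs_bound)
  also have "\<dots> \<le> (LINT y|lborel. \<bar>f y\<bar>)"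
    using assms integrable_mult_indicator[of "{..<x}" lborel "f"]
    by (intro integral_mono integrable_abs) (auto simp: indicator_def)
  finally show ?thesis .
qed

lemma prim_diff:
  assumes "integrable lborel f" "x \<le> y"
  shows "prim f y - prim f x = (LINT s:{x..<y}|lborel. f s)"
proof -
  have "{..<y} = {..<x} \<union> {x..<y}" using assms by auto
  then have "prim f y = prim f x + (LINT s:{x..<y}|lborel. f s)"
    unfolding prim_def \<open>{..<y} = {..<x} \<union> {x..<y}\<close>
    by (intro set_integral_Un) (auto intro!: set_integrable_lborel assms)
  then show ?thesis by simp
qed

lemma continuous_prim:
  assumes f: "integrable lborel f"
  shows "continuous_on S (prim f)"
proof -
  have "(\<lambda>n. prim f (X n)) \<longlonglongrightarrow> prim f x" if "X \<longlonglongrightarrow> x" for X x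
    unfolding prim_def set_lebesgue_integral_def
  proof (rule integral_dominated_convergence[where w = "\<lambda>y. \<bar>f y\<bar>"])
    have "AE y in lborel. y \<noteq> x" by (rule AE_lborel_singleton)
    then show "AE y in lborel. (\<lambda>n. indicator {..<X n} y *\<^sub>R f y) \<longlonglongrightarrow> indicator {..<x} y *\<^sub>R f y"
    proof eventually_elim
      case (elim y)
      have "eventually (\<lambda>n. indicator {..<x} y = (indicator {..<X n} y :: real)) sequentially"
      proof (cases "y < x")
        case True
        then have "eventually (\<lambda>n. y < X n) sequentially"
          using order_tendstoD(1)[OF that] by blast
        then show ?thesis by eventually_elim (use True in auto)
      next
        case False
        then have "eventually (\<lambda>n. X n < y) sequentially"
          using order_tendstoD(2)[OF that] elim by simp
        then show ?thesis by eventually_elim (use False in auto)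
      qed
      then show ?case
        by (intro tendsto_scaleR tendsto_const tendsto_eventually) (auto elim: eventually_mono)
    qed
  qed (use f in \<open>auto simp: indicator_def\<close>)
  then show ?thesis
    by (auto intro!: continuous_at_imp_continuous_on simp: continuous_at_sequentially o_def)
qed

text \<open>Only Fubini's theorem enters: the integral of the product of \<open>f\<close> and
  \<open>g\<close> in separate variables is split along the diagonal of the plane, which meets every
  line in a single point. \<open>L\<close> and \<open>R\<close> are the two halves.\<close>

lemma integral_by_parts_prim:
  assumes f: "integrable lborel f" and g: "integrable lborel g"
  shows "(LINT x|lborel. prim f x * g x) + (LINT x|lborel. f x * prim g x)
    = (LINT x|lborel. f x) * (LINT x|lborel. g x)"
proof -
  have [measurable]: "f \<in> borel_measurable borel" "g \<in> borel_measurable borel"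
    using f g by auto
  define L where "L z = (if snd z < fst z then g (fst z) * f (snd z) else (0::real))" for z
  define R where "R z = (if snd z < fst z then f (fst z) * g (snd z) else (0::real))" for z
  have gf: "integrable (lborel \<Otimes>\<^sub>M lborel) (\<lambda>z. g (fst z) * f (snd z))"
    by (rule integrable_tensor[OF g f])
  have fg: "integrable (lborel \<Otimes>\<^sub>M lborel) (\<lambda>z. f (fst z) * g (snd z))"
    by (rule integrable_tensor[OF f g])
  have L: "integrable (lborel \<Otimes>\<^sub>M lborel) L"
    by (rule Bochner_Integration.integrable_bound[OF gf]) (auto simp: L_def[abs_def])
  have R: "integrable (lborel \<Otimes>\<^sub>M lborel) R"
    by (rule Bochner_Integration.integrable_bound[OF fg]) (auto simp: R_def[abs_def])
  have 1: "(LINT y|lborel. L (x, y)) = prim f x * g x" for x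
  proof -
    have "(LINT y|lborel. L (x, y)) = (LINT y|lborel. g x * (indicator {..<x} y * f y))"
      by (intro Bochner_Integration.integral_cong) (auto simp: L_def)
    then show ?thesis by (simp add: prim_def set_lebesgue_integral_def mult.commute)
  qed
  have 2: "(LINT y|lborel. R (x, y)) = f x * prim g x" for x
  proof -
    have "(LINT y|lborel. R (x, y)) = (LINT y|lborel. f x * (indicator {..<x} y * g y))"
      by (intro Bochner_Integration.integral_cong) (auto simp: R_def)
    then show ?thesis by (simp add: prim_def set_lebesgue_integral_def)
  qed
  have swap: "(LINT x|lborel. LINT y|lborel. L (x, y)) = (LINT y|lborel. LINT x|lborel. L (x, y))"
    using lborel_pair.Fubini_integral[of "\<lambda>x y. L (x, y)"] L by simp
  have sum: "(LINT x|lborel. L (x, y)) + (LINT x|lborel. R (y, x)) = f y * (LINT x|lborel. g x)" for y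
  proof -
    have [measurable]: "(\<lambda>x. L (x, y)) \<in> borel_measurable borel" "(\<lambda>x. R (y, x)) \<in> borel_measurable borel"
      unfolding L_def R_def fst_conv snd_conv by measurable
    have i: "integrable lborel (\<lambda>x. L (x, y))"
      by (rule Bochner_Integration.integrable_bound[of _ "\<lambda>x. g x * f y"]) (simp_all add: g, simp add: L_def)
    have j: "integrable lborel (\<lambda>x. R (y, x))"
      by (rule Bochner_Integration.integrable_bound[of _ "\<lambda>x. f y * g x"]) (simp_all add: g, simp add: R_def)
    have "(LINT x|lborel. L (x, y)) + (LINT x|lborel. R (y, x)) = (LINT x|lborel. L (x, y) + R (y, x))"
      using i j by simp
    also have "\<dots> = (LINT x|lborel. f y * g x)"
    proof (rule integral_cong_AE)
      have "AE x in lborel. x \<noteq> y" by (rule AE_lborel_singleton)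
      then show "AE x in lborel. L (x, y) + R (y, x) = f y * g x"
        by eventually_elim (auto simp: L_def R_def)
    qed (use i j in auto)
    finally show ?thesis by simp
  qed
  have intL: "integrable lborel (\<lambda>y. LINT x|lborel. L (x, y))"
    using lborel_pair.integrable_snd[of "\<lambda>x y. L (x, y)"] L by simp
  have intR: "integrable lborel (\<lambda>y. LINT x|lborel. R (y, x))"
    using lborel_pair.integrable_fst[of "\<lambda>x y. R (x, y)"] R by simp
  have "(LINT x|lborel. prim f x * g x) + (LINT x|lborel. f x * prim g x) =
      (LINT y|lborel. LINT x|lborel. L (x, y)) + (LINT y|lborel. LINT x|lborel. R (y, x))"
    using swap by (simp add: 1 2)
  also have "\<dots> = (LINT y|lborel. f y * (LINT x|lborel. g x))"
    using intL intR by (simp add: sum flip: Bochner_Integration.integral_add)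
  finally show ?thesis by simp
qed

text \<open>This is the differentiation theorem for right averages, applied to the reflection of
  \<open>f\<close>. Left averages are the ones that occur later, as backward averages in
  time.\<close>

lemma AE_left_average_tendsto:
  fixes f :: "real \<Rightarrow> real"
  assumes "integrable lborel f"
  shows "AE x in lborel. ((\<lambda>h. (LINT y:{x-h..x}|lborel. f y) / h) \<longlongrightarrow> f x) (at_right 0)"
proof -
  define g where "g y = f (- y)" for y
  have "integrable lborel g"
    using lborel_integrable_real_affine[OF assms, of "-1" 0] by (simp add: g_def[abs_def])
  then have "g integrable_on UNIV" by (rule integrable_on_lborel)
  then have "g integrable_on cbox a b" for a b
    using integrable_on_subcbox by blast
  then obtain N where N: "negligible N" "\<And>x e. x \<notin> N \<Longrightarrow> 0 < e \<Longrightarrow>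
      \<exists>d>0. \<forall>h. 0 < h \<and> h < d \<longrightarrow> norm (integral (cbox x (x + h *\<^sub>R One)) g /\<^sub>R h ^ DIM(real) - g x) < e"
    by (rule integrable_ccontinuous_explicit) (rule that)
  have "AE x in lborel. x \<notin> N"
    using N(1) by (metis (no_types) AE_completion_iff AE_not_in negligible_iff_null_sets)
  \<comment> \<open>The exceptional set is covered by a Borel null set, whose reflection is then
    null as well.\<close>
  then obtain M where M: "{x \<in> space lborel. \<not> x \<notin> N} \<subseteq> M" "emeasure lborel M = 0" "M \<in> sets lborel"
    by (rule AE_E)
  have "AE x in lborel. x \<notin> M"
    using M by (intro AE_not_in) auto
  then have "AE x in lborel. 0 + (-1) * x \<notin> M"
    by (rule AE_borel_affine[rotated 2]) (use M in auto)
  then show ?thesis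
  proof eventually_elim
    case (elim x)
    then have x: "- x \<notin> N" using M(1) by auto
    have eq: "(LINT y:{x-h..x}|lborel. f y) = integral {- x..- x + h} g" for h
    proof -
      have "(LINT y:{x-h..x}|lborel. f y) = integral {x-h..x} f"
        using assms by (intro set_borel_integral_eq_integral set_integrable_lborel) auto
      also have "\<dots> = integral {- x..- x + h} g"
        unfolding g_def using Henstock_Kurzweil_Integration.integral_reflect_real[of x "x - h" f] by (simp add: algebra_simps)
      finally show ?thesis .
    qed
    show ?case
      unfolding tendsto_iff dist_real_def
    proof (intro allI impI)
      fix e :: real assume "0 < e"
      from N(2)[OF x this] obtain d where d: "d > 0"
        "\<And>h. 0 < h \<Longrightarrow> h < d \<Longrightarrow> \<bar>integral {- x..- x + h} g / h - f x\<bar> < e"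
        by (auto simp: g_def divide_inverse_commute)
      then show "\<forall>\<^sub>F h in at_right 0. \<bar>(LINT y:{x-h..x}|lborel. f y) / h - f x\<bar> < e"
        unfolding eq eventually_at_right_field by (intro exI[of _ d]) auto
    qed
  qed
qed

lemma bump_integrals:
  assumes "X \<in> bumps c1 c2" "\<And>x. (X has_real_derivative X' x) (at x)" "continuous_on UNIV X'"
  shows "integrable lborel X'" "prim X' = X" "integrable lborel X" "(LINT x|lborel. X' x) = 0"
    "\<And>x. X x \<noteq> 0 \<or> X' x \<noteq> 0 \<Longrightarrow> c1 < x \<and> x < c2"
proof -
  obtain a b where X: "smooth_real X" "c1 < a" "b < c2" "\<And>x. X x \<noteq> 0 \<Longrightarrow> a \<le> x \<and> x \<le> b"
    using assms(1) unfolding bumps_def by blast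
  have out: "X' x = 0" if "x < a \<or> b < x" for x
  proof -
    have "((\<lambda>x. 0) has_real_derivative X' x) (at x)"
      by (rule has_field_derivative_transform_within_open[OF assms(2), of "{..<a} \<union> {b<..}"])
        (use that X(4) in \<open>auto, force+\<close>)
    then show ?thesis using DERIV_unique DERIV_const by blast
  qed
  have supp: "X' = (\<lambda>x. indicator {a..b} x *\<^sub>R X' x)" "X = (\<lambda>x. indicator {a..b} x *\<^sub>R X x)"
    using out X(4) by (force simp: fun_eq_iff indicator_def not_le)+
  have cX: "continuous_on {a..b} X" using smooth_real_continuous[OF X(1)] .
  show i: "integrable lborel X'"
    using borel_integrable_atLeastAtMost'[of a b X'] continuous_on_subset[OF assms(3)] supp(1)
    unfolding set_integrable_def by simp
  show "integrable lborel X"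
    using borel_integrable_atLeastAtMost'[OF cX] supp(2)
    unfolding set_integrable_def by simp
  have int: "(LINT x:{c..d}|lborel. X' x) = X d - X c" if "c \<le> d" for c d
    using integral_FTC_Icc[OF that, of X X'] assms(2) continuous_on_subset[OF assms(3)]
    by (simp add: has_real_derivative_iff_has_vector_derivative[symmetric] has_field_derivative_at_within set_lebesgue_integral_def)
  \<comment> \<open>Since \<open>a \<le> b\<close> is not known, minimum and maximum are taken to
    enclose the support in every case.\<close>
  define m where "m = min a b - 1"
  show "prim X' = X"
  proof
    fix x
    define y where "y = min m (x - 1)"
    have "prim X' x = (LINT s:{y..x}|lborel. X' s)"
      unfolding prim_def set_lebesgue_integral_def
    proof (rule integral_cong_AE)
      have "AE s in lborel. s \<noteq> x" by (rule AE_lborel_singleton)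
      then show "AE s in lborel. indicator {..<x} s *\<^sub>R X' s = indicator {y..x} s *\<^sub>R X' s"
        by eventually_elim (use out in \<open>force simp: indicator_def y_def m_def\<close>)
    qed (use i in auto)
    also have "\<dots> = X x"
    proof -
      have "y < a" "y \<le> x" by (auto simp: y_def m_def)
      then show ?thesis using int[of y x] X(4)[of y] by auto
    qed
    finally show "prim X' x = X x" .
  qed
  have "(LINT x|lborel. X' x) = (LINT s:{m..max a b + 1}|lborel. X' s)"
    unfolding set_lebesgue_integral_def
    by (intro Bochner_Integration.integral_cong) (use out in \<open>force simp: indicator_def m_def\<close>)+
  also have "\<dots> = 0"
  proof -
    have "m < a" "b < max a b + 1" "m \<le> max a b + 1" by (auto simp: m_def)
    then show ?thesis using int[of m "max a b + 1"] X(4)[of m] X(4)[of "max a b + 1"] by fastforce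
  qed
  finally show "(LINT x|lborel. X' x) = 0" .
  show "\<And>x. X x \<noteq> 0 \<or> X' x \<noteq> 0 \<Longrightarrow> c1 < x \<and> x < c2"
    using X out by (meson le_less_trans less_le_trans not_le)
qed

lemma integrable_bounded_mult:
  fixes f g :: "'a \<Rightarrow> real"
  assumes "integrable M f" "g \<in> borel_measurable M" "\<And>x. \<bar>g x\<bar> \<le> B"
  shows "integrable M (\<lambda>x. g x * f x)" "integrable M (\<lambda>x. f x * g x)"
proof -
  show "integrable M (\<lambda>x. g x * f x)"
  proof (rule Bochner_Integration.integrable_bound[of _ "\<lambda>x. B * f x"])
    show "AE x in M. norm (g x * f x) \<le> norm (B * f x)"
      using assms(3) by (auto simp: abs_mult intro!: mult_right_mono order_trans[OF assms(3)])
  qed (use assms in auto)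
  then show "integrable M (\<lambda>x. f x * g x)" by (simp add: mult.commute)
qed

text \<open>Du Bois-Reymond's lemma. Differences of translated smooth ramps show that the averages of
  \<open>v - prim w\<close> over intervals of equal length agree; Lebesgue differentiation does the rest.\<close>

lemma du_Bois_Reymond:
  assumes v: "integrable lborel v" and w: "integrable lborel w" and "c1 < c2"
    and weak: "\<And>X X'. X \<in> bumps c1 c2 \<Longrightarrow> (\<And>x. (X has_real_derivative X' x) (at x)) \<Longrightarrow>
      continuous_on UNIV X' \<Longrightarrow> (LINT x|lborel. v x * X' x) = - (LINT x|lborel. w x * X x)"
  shows "\<exists>C. AE x in lborel. x \<in> {c1<..<c2} \<longrightarrow> v x = C + prim w x"
proof -
  have [measurable]: "v \<in> borel_measurable borel" "w \<in> borel_measurable borel"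
    using v w by auto
  \<comment> \<open>Subtracting \<open>prim w\<close> makes the equation homogeneous; it remains to
    see that \<open>z\<close> is almost everywhere constant on the interval.\<close>
  define z where "z x = indicator {c1<..<c2} x * (v x - prim w x)" for x
  have I: "integrable lborel (indicator {c1<..<c2} :: real \<Rightarrow> real)"
    by (rule integrable_real_indicator) (use \<open>c1 < c2\<close> in auto)
  have "integrable lborel (\<lambda>x. prim w x * indicator {c1<..<c2} x)"
    by (rule integrable_bounded_mult[OF I]) (auto intro: abs_prim_le w)
  moreover have "integrable lborel (\<lambda>x. indicator {c1<..<c2} x * v x)"
    by (rule integrable_bounded_mult[OF v, where B = 1]) (auto simp: indicator_def)
  ultimately have z: "integrable lborel z"
    unfolding z_def[abs_def] right_diff_distrib by (simp add: mult.commute)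
  have weak0: "(LINT x|lborel. z x * X' x) = 0"
    if X: "X \<in> bumps c1 c2" "\<And>x. (X has_real_derivative X' x) (at x)" "continuous_on UNIV X'"
      "\<And>x. \<bar>X' x\<bar> \<le> B" for X X' B
  proof -
    note b = bump_integrals[OF X(1-3)]
    have [measurable]: "X' \<in> borel_measurable borel" using b(1) by auto
    have "(LINT x|lborel. z x * X' x) = (LINT x|lborel. v x * X' x - prim w x * X' x)"
      by (intro Bochner_Integration.integral_cong) (use b(5) in \<open>auto simp: z_def indicator_def algebra_simps\<close>)
    also have "\<dots> = (LINT x|lborel. v x * X' x) - (LINT x|lborel. prim w x * X' x)"
      by (intro Bochner_Integration.integral_diff integrable_bounded_mult(2)[OF v] integrable_bounded_mult(1)[OF b(1)])
        (auto intro: X(4) abs_prim_le w)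
    also have "(LINT x|lborel. prim w x * X' x) = - (LINT x|lborel. w x * X x)"
      using integral_by_parts_prim[OF w b(1)] by (simp add: b(2,4))
    finally show ?thesis using weak[OF X(1-3)] by simp
  qed
  have shift: "(LINT x:{\<alpha>..\<alpha>+l}|lborel. z x) = (LINT x:{\<alpha>'..\<alpha>'+l}|lborel. z x)"
    if l: "0 < l" "c1 < \<alpha>" "\<alpha> + l < c2" "c1 < \<alpha>'" "\<alpha>' + l < c2" for \<alpha> \<alpha>' l
  proof -
    \<comment> \<open>Half of the room to the right of the two intervals: ramps of length
      \<open>l + \<delta> n\<close> still end before \<open>c2\<close>.\<close>
    define \<delta>0 where "\<delta>0 = min (c2 - \<alpha> - l) (c2 - \<alpha>' - l) / 2"
    define \<delta> where "\<delta> n = \<delta>0 / real (Suc n)" for n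
    have \<delta>0: "\<delta>0 > 0" using l by (simp add: \<delta>0_def)
    have \<delta>: "\<delta> n > 0" "\<delta> n \<le> \<delta>0" for n using \<delta>0 by (auto simp: \<delta>_def field_simps)
    have "\<exists>J J' c. smooth_real J \<and> (\<forall>x. (J has_real_derivative J' x) (at x)) \<and>
      (\<forall>x\<le>0. J x = 0) \<and> (\<forall>x\<ge>l + \<delta> n. J x = c) \<and> (\<forall>x. 0 \<le> J' x \<and> J' x \<le> 1) \<and> continuous_on UNIV J' \<and>
      (\<forall>x. \<delta> n \<le> x \<and> x \<le> l \<longrightarrow> J' x = 1) \<and> (\<forall>x. x \<le> 0 \<or> x \<ge> l + \<delta> n \<longrightarrow> J' x = 0)" for n
      by (rule smooth_ramp_exists[OF l(1) \<delta>(1)[of n]]) blast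
    then obtain J J' c where J: "\<And>n. smooth_real (J n)" "\<And>n x. (J n has_real_derivative J' n x) (at x)"
      "\<And>n x. x \<le> 0 \<Longrightarrow> J n x = 0" "\<And>n x. x \<ge> l + \<delta> n \<Longrightarrow> J n x = c n"
      "\<And>n x. 0 \<le> J' n x" "\<And>n x. J' n x \<le> 1" "\<And>n. continuous_on UNIV (J' n)"
      "\<And>n x. \<delta> n \<le> x \<Longrightarrow> x \<le> l \<Longrightarrow> J' n x = 1" "\<And>n x. x \<le> 0 \<or> x \<ge> l + \<delta> n \<Longrightarrow> J' n x = 0"
      by metis
    have [measurable]: "J' n \<in> borel_measurable borel" for n
      using borel_measurable_continuous_onI[OF J(7)] .
    have J'1: "\<bar>J' n x\<bar> \<le> 1" for n x using J(5,6)[of n x] by simp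
    have int: "integrable lborel (\<lambda>x. z x * J' n (x - a))" for n a
      by (rule integrable_bounded_mult(2)[OF z]) (auto intro: J'1)
    have zero: "(LINT x|lborel. z x * J' n (x - \<alpha>)) = (LINT x|lborel. z x * J' n (x - \<alpha>'))" for n
    proof -
      have "(LINT x|lborel. z x * (J' n (x - \<alpha>) - J' n (x - \<alpha>'))) = 0"
      proof (rule weak0)
        show "(\<lambda>x. J n (x - \<alpha>) - J n (x - \<alpha>')) \<in> bumps c1 c2"
          unfolding bumps_def mem_Collect_eq
        proof (intro conjI exI allI impI)
          show "smooth_real (\<lambda>x. J n (x - \<alpha>) - J n (x - \<alpha>'))"
            using smooth_real_diff[OF smooth_real_affine[OF J(1)[of n], of 1 "-\<alpha>"] smooth_real_affine[OF J(1)[of n], of 1 "-\<alpha>'"]]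
            by simp
          show "c1 < min \<alpha> \<alpha>'" "max \<alpha> \<alpha>' + l + \<delta> n < c2"
            using l \<delta>(2)[of n] \<delta>0 by (auto simp: \<delta>0_def)
          fix x assume x: "J n (x - \<alpha>) - J n (x - \<alpha>') \<noteq> 0"
          show "min \<alpha> \<alpha>' \<le> x" using J(3)[of "x - \<alpha>" n] J(3)[of "x - \<alpha>'" n] x by (cases "x < min \<alpha> \<alpha>'") auto
          show "x \<le> max \<alpha> \<alpha>' + l + \<delta> n"
            using J(4)[of n "x - \<alpha>"] J(4)[of n "x - \<alpha>'"] x by (cases "x > max \<alpha> \<alpha>' + l + \<delta> n") auto
        qed
        show "((\<lambda>x. J n (x - \<alpha>) - J n (x - \<alpha>')) has_real_derivative J' n (x - \<alpha>) - J' n (x - \<alpha>')) (at x)" for x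
          by (auto intro!: derivative_eq_intros DERIV_chain2[OF J(2)])
        show "continuous_on UNIV (\<lambda>x. J' n (x - \<alpha>) - J' n (x - \<alpha>'))"
          by (auto intro!: continuous_intros continuous_on_compose2[OF J(7)])
        show "\<bar>J' n (x - \<alpha>) - J' n (x - \<alpha>')\<bar> \<le> 2" for x
          using J'1[of n "x - \<alpha>"] J'1[of n "x - \<alpha>'"] by linarith
      qed
      then show ?thesis using int by (simp add: right_diff_distrib)
    qed
    have lim: "(\<lambda>n. LINT x|lborel. z x * J' n (x - a)) \<longlonglongrightarrow> (LINT x:{a..a+l}|lborel. z x)" for a
      unfolding set_lebesgue_integral_def
    proof (rule integral_dominated_convergence[where w = "\<lambda>x. \<bar>z x\<bar>"])
      have "AE x in lborel. x \<noteq> a" by (rule AE_lborel_singleton)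
      then show "AE x in lborel. (\<lambda>n. z x * J' n (x - a)) \<longlonglongrightarrow> indicator {a..a+l} x *\<^sub>R z x"
      proof eventually_elim
        case (elim x)
        have \<delta>lim: "\<delta> \<longlonglongrightarrow> 0"
          unfolding \<delta>_def using LIMSEQ_inverse_real_of_nat[THEN tendsto_mult_right_zero, of \<delta>0] by (simp add: divide_inverse)
        have "eventually (\<lambda>n. J' n (x - a) = indicator {a..a+l} x) sequentially"
        proof -
          consider "x < a" | "a < x" "x \<le> a + l" | "a + l < x" using elim by fastforce
          then show ?thesis
          proof cases
            case 1 then show ?thesis using J(9) by simp
          next
            case 2
            then have "eventually (\<lambda>n. \<delta> n < x - a) sequentially"
              using order_tendstoD(2)[OF \<delta>lim] by simp
            then show ?thesis by eventually_elim (use 2 J(8) in auto)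
          next
            case 3
            then have "eventually (\<lambda>n. \<delta> n < x - a - l) sequentially"
              using order_tendstoD(2)[OF \<delta>lim] by simp
            then show ?thesis by eventually_elim (use 3 J(9) in auto)
          qed
        qed
        then have "(\<lambda>n. z x * J' n (x - a)) \<longlonglongrightarrow> z x * indicator {a..a+l} x"
          by (intro tendsto_mult_left tendsto_eventually)
        then show ?case by (simp add: mult.commute)
      qed
      show "AE x in lborel. norm (z x * J' n (x - a)) \<le> \<bar>z x\<bar>" for n
        using J'1 by (auto simp: abs_mult mult_left_le)
    qed (use z in auto)
    show ?thesis
      using LIMSEQ_unique[OF lim[of \<alpha>]] lim[of \<alpha>'] zero by simp
  qed
  \<comment> \<open>Any point at which the left averages converge supplies the constant. There is
    one because a null set cannot contain an interval.\<close>
  have "\<exists>x0\<in>{c1<..<c2}. ((\<lambda>h. (LINT y:{x0-h..x0}|lborel. z y) / h) \<longlongrightarrow> z x0) (at_right 0)"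
  proof (rule ccontr)
    assume "\<not> ?thesis"
    with AE_left_average_tendsto[OF z] have "AE x in lborel. x \<notin> {c1<..<c2}"
      by (auto elim!: eventually_mono)
    then have "emeasure lborel {c1<..<c2} = 0"
      using AE_iff_null_sets[of "{c1<..<c2}" lborel] by auto
    then show False using \<open>c1 < c2\<close> by simp
  qed
  then obtain x0 where x0: "x0 \<in> {c1<..<c2}"
    "((\<lambda>h. (LINT y:{x0-h..x0}|lborel. z y) / h) \<longlongrightarrow> z x0) (at_right 0)" by blast
  have "AE x in lborel. x \<in> {c1<..<c2} \<longrightarrow> v x = z x0 + prim w x"
    using AE_left_average_tendsto[OF z]
  proof eventually_elim
    case (elim x)
    show ?case
    proof
      assume x: "x \<in> {c1<..<c2}"
      have "eventually (\<lambda>h. (LINT y:{x0-h..x0}|lborel. z y) / h = (LINT y:{x-h..x}|lborel. z y) / h) (at_right 0)"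
        unfolding eventually_at_right_field
      proof (intro exI[of _ "min (x0 - c1) (x - c1)"] conjI allI impI)
        show "0 < min (x0 - c1) (x - c1)" using x x0 by simp
        fix h :: real assume "0 < h" "h < min (x0 - c1) (x - c1)"
        then show "(LINT y:{x0-h..x0}|lborel. z y) / h = (LINT y:{x-h..x}|lborel. z y) / h"
          using shift[of h "x0 - h" "x - h"] x x0 by simp
      qed
      then have "((\<lambda>h. (LINT y:{x-h..x}|lborel. z y) / h) \<longlongrightarrow> z x0) (at_right 0)"
        by (rule Lim_transform_eventually[OF x0(2)])
      from tendsto_unique[OF _ this elim] have "z x = z x0" by simp
      then show "v x = z x0 + prim w x" using x by (simp add: z_def)
    qed
  qed
  then show ?thesis by blast
qed

section \<open>The chain rule for absolutely continuous functions\<close>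

text \<open>Cut the interval into equal pieces shorter than \<delta> and add up. Domination is
  assumed at small scales, where uniform continuity will supply it.\<close>

lemma locally_dominated_increment:
  fixes R V :: "real \<Rightarrow> real"
  assumes "a \<le> b" "0 < \<delta>"
    and "\<And>x y. a \<le> x \<Longrightarrow> x \<le> y \<Longrightarrow> y \<le> b \<Longrightarrow> y - x < \<delta> \<Longrightarrow> \<bar>R y - R x\<bar> \<le> V y - V x"
  shows "\<bar>R b - R a\<bar> \<le> V b - V a"
proof -
  obtain N :: nat where N: "(b - a) / \<delta> < real N" using reals_Archimedean2 by blast
  have "0 \<le> (b - a) / \<delta>" using assms by simp
  then have "N > 0" using N by (metis less_le_trans not_le of_nat_0_less_iff order_le_less_trans)
  define x where "x i = a + real i * ((b - a) / real N)" for i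
  have "i \<le> N \<Longrightarrow> \<bar>R (x i) - R a\<bar> \<le> V (x i) - V a" for i
  proof (induction i)
    case (Suc i)
    have "x (Suc i) \<le> x N"
      unfolding x_def using Suc.prems assms \<open>N > 0\<close> by (intro add_left_mono mult_right_mono) auto
    then have "x (Suc i) \<le> b" using \<open>N > 0\<close> by (simp add: x_def)
    moreover have "x (Suc i) - x i < \<delta>"
    proof -
      have "(b - a) / real N < \<delta>" using N \<open>N > 0\<close> assms(2) by (simp add: pos_divide_less_eq mult.commute)
      moreover have "x (Suc i) - x i = (b - a) / real N"
        unfolding x_def of_nat_Suc by (rule trans[of _ "(1 + real i) * ((b - a) / real N) - real i * ((b - a) / real N)"])
          (simp, simp only: left_diff_distrib[symmetric], simp)
      ultimately show ?thesis by simp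
    qed
    moreover have "a \<le> x i" "x i \<le> x (Suc i)"
    proof -
      have "0 \<le> (b - a) / real N" using assms(1) by simp
      then show "a \<le> x i" "x i \<le> x (Suc i)"
        unfolding x_def using mult_nonneg_nonneg[of "real i" "(b - a) / real N"]
          mult_right_mono[of "real i" "real (Suc i)" "(b - a) / real N"] by linarith+
    qed
    ultimately have "\<bar>R (x (Suc i)) - R (x i)\<bar> \<le> V (x (Suc i)) - V (x i)"
      by (intro assms)
    then show ?case using Suc by simp
  qed (simp add: x_def)
  from this[of N] show ?thesis using \<open>N > 0\<close> by (simp add: x_def)
qed

lemma integral_mult_bound:
  fixes f g :: "real \<Rightarrow> real"
  assumes "integrable lborel f" "A \<in> sets borel" "integrable lborel (\<lambda>s. g s * f s)"
    "\<And>s. s \<in> A \<Longrightarrow> \<bar>g s\<bar> \<le> w"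
  shows "\<bar>LINT s:A|lborel. g s * f s\<bar> \<le> w * (LINT s:A|lborel. \<bar>f s\<bar>)"
proof -
  have "\<bar>LINT s:A|lborel. g s * f s\<bar> \<le> (LINT s:A|lborel. \<bar>g s * f s\<bar>)"
    using set_integral_norm_bound[OF set_integrable_lborel[OF assms(3,2)]] by simp
  also have "\<dots> \<le> (LINT s:A|lborel. w * \<bar>f s\<bar>)"
    by (rule set_integral_mono)
      (use assms integrable_abs[OF assms(3)] in
        \<open>auto intro!: set_integrable_lborel mult_right_mono simp: abs_mult\<close>)
  finally show ?thesis by simp
qed

text \<open>The proof does not differentiate \<open>d\<close>. Let \<open>R\<close> be the
  difference of \<open>\<beta> (d x)\<close> and the primitive of the expected derivative. By the
  mean value theorem for \<beta> and uniform continuity, its increments over short intervals are at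
  most \<open>e\<close> times those of the primitive of \<open>\<bar>G\<bar>\<close>. Adding up and
  letting \<open>e\<close> tend to \<open>0\<close> gives \<open>R b = R a\<close>.\<close>

lemma chain_rule_prim:
  fixes d :: "real \<Rightarrow> real"
  assumes G: "integrable lborel G" and d: "\<And>x. x \<in> {a..b} \<Longrightarrow> d x = C + prim G x"
    and \<beta>: "\<And>y. (\<beta> has_real_derivative \<beta>' y) (at y)" "continuous_on UNIV \<beta>'" and "a \<le> b"
  shows "integrable lborel (\<lambda>s. indicator {a..b} s * \<beta>' (d s) * G s)"
    and "\<beta> (d b) - \<beta> (d a) = (LINT s:{a..<b}|lborel. \<beta>' (d s) * G s)"
proof -
  have cd: "continuous_on {a..b} d"
    by (subst continuous_on_cong[OF refl d]) (auto intro!: continuous_intros continuous_prim G)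
  define B where "B = \<bar>C\<bar> + (LINT y|lborel. \<bar>G y\<bar>)"
  have dB: "\<bar>d x\<bar> \<le> B" if "x \<in> {a..b}" for x
    using abs_prim_le[OF G, of x] d[OF that] by (simp add: B_def)
  have c\<beta>: "continuous_on {-B..B} \<beta>'" using \<beta>(2) continuous_on_subset by blast
  have "bounded (\<beta>' ` {-B..B})" by (intro compact_imp_bounded compact_continuous_image c\<beta>) auto
  then obtain K where K: "\<And>y. y \<in> {-B..B} \<Longrightarrow> \<bar>\<beta>' y\<bar> \<le> K"
    unfolding bounded_iff real_norm_def by blast
  have "(\<lambda>s. indicator {a..b} s *\<^sub>R \<beta>' (d s)) \<in> borel_measurable borel"
    by (rule borel_measurable_continuous_on_indicator)
      (auto intro!: continuous_on_compose2[OF \<beta>(2) cd])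
  then have mg: "(\<lambda>s. indicator {a..b} s * \<beta>' (d s)) \<in> borel_measurable lborel" by simp
  have bg: "\<bar>indicator {a..b} s * \<beta>' (d s)\<bar> \<le> max K 0" for s
    using K[of "d s"] dB[of s] by (auto simp: indicator_def abs_le_iff split: if_splits)
  show H: "integrable lborel (\<lambda>s. indicator {a..b} s * \<beta>' (d s) * G s)"
    by (rule integrable_bounded_mult(1)[OF G mg bg])
  define H where "H s = indicator {a..b} s * \<beta>' (d s) * G s" for s
  define R where "R x = \<beta> (d x) - prim H x" for x
  define V where "V = prim (\<lambda>s. \<bar>G s\<bar>)"
  have iH: "integrable lborel H" using H by (simp add: H_def[abs_def])
  have le: "\<bar>R b - R a\<bar> \<le> e * (V b - V a)" if e: "e > 0" for e
  proof -
    have "uniformly_continuous_on {-B..B} \<beta>'"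
      by (rule compact_uniformly_continuous[OF c\<beta>]) auto
    then obtain r where r: "r > 0" "\<And>y y'. y' \<in> {-B..B} \<Longrightarrow> y \<in> {-B..B} \<Longrightarrow> \<bar>y - y'\<bar> < r \<Longrightarrow> \<bar>\<beta>' y - \<beta>' y'\<bar> < e"
      unfolding uniformly_continuous_on_def dist_real_def using e by blast
    have "uniformly_continuous_on {a..b} d"
      by (rule compact_uniformly_continuous[OF cd]) auto
    \<comment> \<open>The intermediate point \<xi> is within \<open>\<bar>d y - d x\<bar>\<close> of
      \<open>d x\<close>, and \<open>d s\<close> is within \<open>r / 2\<close> of
      \<open>d x\<close>; so \<xi> and \<open>d s\<close> are within \<open>r\<close> of each
      other.\<close>
    then obtain \<delta> where \<delta>: "\<delta> > 0" "\<And>y y'. y' \<in> {a..b} \<Longrightarrow> y \<in> {a..b} \<Longrightarrow> \<bar>y - y'\<bar> < \<delta> \<Longrightarrow> \<bar>d y - d y'\<bar> < r / 2"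
      unfolding uniformly_continuous_on_def dist_real_def using half_gt_zero[OF r(1)] by blast
    have "\<bar>R b - R a\<bar> \<le> e * V b - e * V a"
    proof (rule locally_dominated_increment[OF \<open>a \<le> b\<close> \<delta>(1)])
      fix x y assume xy: "a \<le> x" "x \<le> y" "y \<le> b" "y - x < \<delta>"
      obtain \<xi> where \<xi>: "\<beta> (d y) - \<beta> (d x) = (d y - d x) * \<beta>' \<xi>" "\<bar>\<xi> - d x\<bar> \<le> \<bar>d y - d x\<bar>" "\<xi> \<in> {-B..B}"
      proof -
        consider "d x = d y" | "d x < d y" | "d y < d x" by linarith
        then show ?thesis
        proof cases
          case 1
          then show ?thesis using dB[of x] xy by (intro that[of "d x"]) (auto simp: abs_le_iff)
        next
          case 2
          obtain z where "d x < z" "z < d y" "\<beta> (d y) - \<beta> (d x) = (d y - d x) * \<beta>' z"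
            using MVT2[OF 2 \<beta>(1)] by blast
          then show ?thesis using dB[of x] dB[of y] xy by (intro that[of z]) (auto simp: abs_le_iff)
        next
          case 3
          obtain z where "d y < z" "z < d x" "\<beta> (d x) - \<beta> (d y) = (d x - d y) * \<beta>' z"
            using MVT2[OF 3 \<beta>(1)] by blast
          then show ?thesis using dB[of x] dB[of y] xy
            by (intro that[of z]) (auto simp: abs_le_iff algebra_simps)
        qed
      qed
      have dd: "d y - d x = (LINT s:{x..<y}|lborel. G s)"
        using prim_diff[OF G xy(2)] d[of x] d[of y] xy by simp
      have "prim H y - prim H x = (LINT s:{x..<y}|lborel. H s)"
        by (rule prim_diff[OF iH xy(2)])
      then have "R y - R x = \<beta>' \<xi> * (LINT s:{x..<y}|lborel. G s) - (LINT s:{x..<y}|lborel. H s)"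
        using \<xi>(1) by (simp add: R_def dd mult.commute)
      also have "\<dots> = (LINT s:{x..<y}|lborel. \<beta>' \<xi> * G s) - (LINT s:{x..<y}|lborel. H s)"
        by simp
      also have "\<dots> = (LINT s:{x..<y}|lborel. \<beta>' \<xi> * G s - H s)"
        by (rule set_integral_diff(2)[symmetric]) (auto intro!: set_integrable_lborel iH G)
      also have "\<dots> = (LINT s:{x..<y}|lborel. (\<beta>' \<xi> - indicator {a..b} s * \<beta>' (d s)) * G s)"
        by (simp add: H_def algebra_simps)
      finally have "\<bar>R y - R x\<bar> = \<bar>LINT s:{x..<y}|lborel. (\<beta>' \<xi> - indicator {a..b} s * \<beta>' (d s)) * G s\<bar>"
        by simp
      also have "\<dots> \<le> e * (LINT s:{x..<y}|lborel. \<bar>G s\<bar>)"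
      proof (rule integral_mult_bound[OF G])
        show "integrable lborel (\<lambda>s. (\<beta>' \<xi> - indicator {a..b} s * \<beta>' (d s)) * G s)"
          using H G by (simp add: left_diff_distrib)
        fix s assume s: "s \<in> {x..<y}"
        have "\<bar>d y - d x\<bar> < r / 2" "\<bar>d x - d s\<bar> < r / 2"
          using xy s by (intro \<delta>(2); simp)+
        then have "\<bar>\<xi> - d s\<bar> < r" using \<xi>(2) by linarith
        then have "\<bar>\<beta>' \<xi> - \<beta>' (d s)\<bar> < e"
          using xy s dB[of s] \<xi>(3) by (intro r(2)) (auto simp: abs_le_iff)
        then show "\<bar>\<beta>' \<xi> - indicator {a..b} s * \<beta>' (d s)\<bar> \<le> e"
          using s xy by simp
      qed auto
      also have "\<dots> = e * V y - e * V x"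
        unfolding V_def using prim_diff[OF integrable_abs[OF G] xy(2)] by (simp flip: right_diff_distrib)
      finally show "\<bar>R y - R x\<bar> \<le> e * V y - e * V x" .
    qed
    then show ?thesis by (simp add: right_diff_distrib)
  qed
  have "R b = R a"
  proof (rule ccontr)
    assume "R b \<noteq> R a"
    then have p: "\<bar>R b - R a\<bar> > 0" by simp
    have V: "V b - V a > 0" using le[of 1] p by simp
    have "\<bar>R b - R a\<bar> / (2 * v) * v = \<bar>R b - R a\<bar> / 2" if "v > 0" for v :: real
      using that by (simp add: field_simps)
    \<comment> \<open>With this \<open>e\<close> the bound equals half of
      \<open>\<bar>R b - R a\<bar>\<close>.\<close>
    from this[OF V] le[of "\<bar>R b - R a\<bar> / (2 * (V b - V a))"] p V show False by simp
  qed
  then have "\<beta> (d b) - \<beta> (d a) = (LINT s:{a..<b}|lborel. H s)"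
    using prim_diff[OF iH \<open>a \<le> b\<close>] by (simp add: R_def)
  also have "\<dots> = (LINT s:{a..<b}|lborel. \<beta>' (d s) * G s)"
    unfolding set_lebesgue_integral_def
    by (intro Bochner_Integration.integral_cong) (auto simp: H_def indicator_def)
  finally show "\<beta> (d b) - \<beta> (d a) = (LINT s:{a..<b}|lborel. \<beta>' (d s) * G s)" .
qed

subsection \<open>The flux and averages in time\<close>

text \<open>The inverse function of \<open>flux p\<close>: the slope whose flux is
  \<open>y\<close>.\<close>

definition sgn_root :: "real \<Rightarrow> real \<Rightarrow> real" where
  "sgn_root p y = sgn y * \<bar>y\<bar> powr (1 / (p - 1))"

definition flux :: "real \<Rightarrow> real \<Rightarrow> real" where
  "flux p q = \<bar>q\<bar> powr (p - 2) * q"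

lemma flux_eq: "flux p q = sgn q * \<bar>q\<bar> powr (p - 1)"
proof -
  have "\<bar>q\<bar> * \<bar>q\<bar> powr (p - 2) = \<bar>q\<bar> powr (p - 1)"
    by (subst powr_mult_base) auto
  then have "sgn q * (\<bar>q\<bar> * \<bar>q\<bar> powr (p - 2)) = sgn q * \<bar>q\<bar> powr (p - 1)" by simp
  moreover have "sgn q * (\<bar>q\<bar> * \<bar>q\<bar> powr (p - 2)) = flux p q"
    by (simp add: flux_def mult.assoc[symmetric] sgn_mult_abs)
  ultimately show ?thesis by simp
qed

lemma abs_flux: "\<bar>flux p q\<bar> = \<bar>q\<bar> powr (p - 1)"
  by (cases "q = 0") (auto simp: flux_eq abs_mult abs_sgn_eq)

lemma flux_0 [simp]: "flux p 0 = 0"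
  by (simp add: flux_def)

lemma flux_measurable [measurable]: "flux p \<in> borel_measurable borel"
  unfolding flux_def[abs_def] by measurable

lemma flux_mono:
  assumes "1 < p" "q \<le> r"
  shows "flux p q \<le> flux p r"
proof -
  consider "0 \<le> q" | "q < 0" "0 \<le> r" | "r < 0" by linarith
  then show ?thesis
  proof cases
    case 1
    then show ?thesis using assms by (auto simp: flux_eq sgn_if powr_mono2)
  next
    case 2
    then show ?thesis by (auto simp: flux_eq sgn_if) (smt (verit) powr_ge_zero)
  next
    case 3
    then show ?thesis using assms by (auto simp: flux_eq sgn_if powr_mono2)
  qed
qed

lemma flux_monotone:
  assumes "1 < p"
  shows "0 \<le> (flux p q - flux p r) * (q - r)"
  using flux_mono[OF assms, of q r] flux_mono[OF assms, of r q]
  by (cases "q \<le> r") (auto simp: mult_nonpos_nonpos)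

lemma flux_sgn_root:
  assumes "1 < p"
  shows "flux p (sgn_root p y) = y"
proof (cases "y = 0")
  case False
  have "\<bar>sgn_root p y\<bar> = \<bar>y\<bar> powr (1 / (p - 1))"
    using False by (simp add: sgn_root_def abs_mult abs_sgn_eq)
  moreover have "sgn (sgn_root p y) = sgn y"
    using False by (simp add: sgn_root_def sgn_mult)
  ultimately show ?thesis
    using assms by (simp add: flux_eq powr_powr sgn_mult_abs)
qed (simp add: sgn_root_def)

lemma abs_sgn_root: "\<bar>sgn_root p y\<bar> = \<bar>y\<bar> powr (1 / (p - 1))"
  by (cases "y = 0") (auto simp: sgn_root_def abs_mult abs_sgn_eq)

lemma sgn_root_strict_mono:
  assumes "1 < p" "y < z"
  shows "sgn_root p y < sgn_root p z"
  using flux_mono[OF assms(1), of "sgn_root p z" "sgn_root p y"] flux_sgn_root[OF assms(1)] assms(2)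
  by (metis linorder_not_le)

section \<open>Pairing averaged fluxes with a gradient at a fixed time\<close>

text \<open>A crude form of Young's inequality: all three bases are replaced by the largest one, and
  \<open>4\<close> is the product of two doublings. Later \<open>m\<close> bounds the slope of the
  exact solution.\<close>

lemma powr_sum_mult_bound:
  fixes u w m :: real
  assumes "1 < p" "0 \<le> u" "0 \<le> w" "0 \<le> m"
  shows "(u powr (p - 1) + m powr (p - 1)) * (w + m) \<le> 4 * (u powr p + w powr p + m powr p)"
proof -
  define M where "M = max u (max w m)"
  have M: "u \<le> M" "w \<le> M" "m \<le> M" "0 \<le> M" using assms by (auto simp: M_def)
  have "(u powr (p - 1) + m powr (p - 1)) * (w + m) \<le> (M powr (p - 1) + M powr (p - 1)) * (M + M)"
    using M assms by (intro mult_mono add_mono powr_mono2) auto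
  also have "\<dots> = 4 * (M * M powr (p - 1))" by simp
  also have "M * M powr (p - 1) = M powr p"
    using M by (simp add: powr_mult_base)
  also have "M powr p \<le> u powr p + w powr p + m powr p"
    using powr_ge_zero[of u p] powr_ge_zero[of w p] powr_ge_zero[of m p] by (auto simp: M_def max_def)
  finally show ?thesis by simp
qed

text \<open>Fatou's lemma applies after adding the dominating functions, whose integrals do not depend on
  \<open>n\<close> because averaging in time preserves the integral over the whole plane.\<close>

lemma average_pairing_limit:
  fixes A B Z N :: "real \<times> real \<Rightarrow> real"
  assumes [measurable]: "Z \<in> borel_measurable (lborel \<Otimes>\<^sub>M lborel)"
    and A: "integrable (lborel \<Otimes>\<^sub>M lborel) A" "\<And>z. 0 \<le> A z"
    and N: "integrable (lborel \<Otimes>\<^sub>M lborel) N" "\<And>z. 0 \<le> N z"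
    and B: "integrable (lborel \<Otimes>\<^sub>M lborel) B"
    and bound: "\<And>x \<sigma> t. \<bar>B (x, \<sigma>) * Z (x, t)\<bar> \<le> c * (A (x, \<sigma>) + A (x, t) + N (x, t))"
    and c: "0 \<le> c"
    and nonneg: "\<And>z. 0 \<le> B z * Z z"
    and \<epsilon>: "\<epsilon> \<longlonglongrightarrow> 0" "\<And>n. 0 < \<epsilon> n"
    and \<kappa>: "0 < \<kappa>"
  defines "b \<equiv> \<lambda>n z. (LINT \<sigma>:{snd z - \<epsilon> n..snd z}|lborel. B (fst z, \<sigma>)) / \<epsilon> n"
  shows "integrable (lborel \<Otimes>\<^sub>M lborel) (\<lambda>z. b m z * Z z)"
    and "\<exists>n. (LINT z|(lborel \<Otimes>\<^sub>M lborel). b n z * Z z) > - \<kappa>"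
proof -
  let ?P = "lborel \<Otimes>\<^sub>M lborel :: (real \<times> real) measure"
  have [measurable]: "A \<in> borel_measurable ?P" "B \<in> borel_measurable ?P" "N \<in> borel_measurable ?P"
    using A B N by auto
  define a where "a n z = (LINT \<sigma>:{snd z - \<epsilon> n..snd z}|lborel. A (fst z, \<sigma>)) / \<epsilon> n" for n z
  have ind: "indicator {snd z - \<epsilon> n..snd z} \<sigma> = (if snd z - \<epsilon> n \<le> \<sigma> \<and> \<sigma> \<le> snd z then 1 else (0::real))" for z n \<sigma>
    by (auto simp: indicator_def)
  have meas: "(\<lambda>z. (LINT \<sigma>:{snd z - \<epsilon> n..snd z}|lborel. F (fst z, \<sigma>)) / \<epsilon> n) \<in> borel_measurable ?P"
    if [measurable]: "F \<in> borel_measurable ?P" for F :: "real \<times> real \<Rightarrow> real" and n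
    unfolding set_lebesgue_integral_def ind by measurable
  have [measurable]: "a n \<in> borel_measurable ?P" "b n \<in> borel_measurable ?P" for n
    using meas[of A n] meas[of B n] unfolding a_def[abs_def] b_def by auto
  have a0: "0 \<le> a n z" for n z
    unfolding a_def set_lebesgue_integral_def using \<epsilon>(2)[of n] A(2)
    by (intro divide_nonneg_pos integral_nonneg_AE) auto
  have secA: "AE x in lborel. integrable lborel (\<lambda>t. A (x, t))"
    and secB: "AE x in lborel. integrable lborel (\<lambda>t. B (x, t))"
    using lborel_pair.AE_integrable_fst'[OF A(1)] lborel_pair.AE_integrable_fst'[OF B] by auto
  \<comment> \<open>By Tonelli's theorem each \<sigma> contributes for the times in
    \<open>[\<sigma>, \<sigma> + \<epsilon> n]\<close>, whose length cancels the division by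
    \<open>\<epsilon> n\<close>.\<close>
  have nn_a: "(\<integral>\<^sup>+z. ennreal (a n z) \<partial>?P) = (\<integral>\<^sup>+z. ennreal (A z) \<partial>?P)" for n
  proof -
    have "(\<integral>\<^sup>+z. ennreal (a n z) \<partial>?P) = (\<integral>\<^sup>+x. \<integral>\<^sup>+t. ennreal (a n (x, t)) \<partial>lborel \<partial>lborel)"
      by (rule lborel.nn_integral_fst[symmetric]) measurable
    also have "\<dots> = (\<integral>\<^sup>+x. \<integral>\<^sup>+t. ennreal (A (x, t)) \<partial>lborel \<partial>lborel)"
    proof (rule nn_integral_cong_AE)
      show "AE x in lborel. (\<integral>\<^sup>+t. ennreal (a n (x, t)) \<partial>lborel) = (\<integral>\<^sup>+t. ennreal (A (x, t)) \<partial>lborel)"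
        using secA
      proof eventually_elim
        case (elim x)
        have "ennreal (a n (x, t)) = (\<integral>\<^sup>+\<sigma>. indicator {t - \<epsilon> n..t} \<sigma> * (ennreal (A (x, \<sigma>)) / ennreal (\<epsilon> n)) \<partial>lborel)" for t
        proof -
          have "ennreal (LINT \<sigma>:{t - \<epsilon> n..t}|lborel. A (x, \<sigma>) / \<epsilon> n) = (\<integral>\<^sup>+\<sigma>. ennreal (indicator {t - \<epsilon> n..t} \<sigma> * (A (x, \<sigma>) / \<epsilon> n)) \<partial>lborel)"
            unfolding set_lebesgue_integral_def real_scaleR_def using A(2) \<epsilon>(2)[of n] elim
            by (intro nn_integral_eq_integral[symmetric] integrable_bounded_mult(1)[where B = 1])
              (auto simp: indicator_def)
          also have "\<dots> = (\<integral>\<^sup>+\<sigma>. indicator {t - \<epsilon> n..t} \<sigma> * (ennreal (A (x, \<sigma>)) / ennreal (\<epsilon> n)) \<partial>lborel)"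
            using A(2) \<epsilon>(2)[of n] by (intro nn_integral_cong) (auto simp: indicator_def divide_ennreal)
          finally show ?thesis by (simp add: a_def)
        qed
        then have "(\<integral>\<^sup>+t. ennreal (a n (x, t)) \<partial>lborel) =
            (\<integral>\<^sup>+t. \<integral>\<^sup>+\<sigma>. indicator {t - \<epsilon> n..t} \<sigma> * (ennreal (A (x, \<sigma>)) / ennreal (\<epsilon> n)) \<partial>lborel \<partial>lborel)"
          by simp
        also have "\<dots> = (\<integral>\<^sup>+\<sigma>. \<integral>\<^sup>+t. indicator {t - \<epsilon> n..t} \<sigma> * (ennreal (A (x, \<sigma>)) / ennreal (\<epsilon> n)) \<partial>lborel \<partial>lborel)"
        proof (rule lborel_pair.Fubini')
          have "(\<lambda>(\<sigma>, t). indicator {z. snd z - \<epsilon> n \<le> fst z \<and> fst z \<le> snd z} (\<sigma>, t) * (ennreal (A (x, \<sigma>)) / ennreal (\<epsilon> n))) \<in> borel_measurable (lborel \<Otimes>\<^sub>M lborel)"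
            by measurable
          also have "(\<lambda>(\<sigma>, t). indicator {z. snd z - \<epsilon> n \<le> fst z \<and> fst z \<le> snd z} (\<sigma>, t) * (ennreal (A (x, \<sigma>)) / ennreal (\<epsilon> n)))
            = (\<lambda>(\<sigma>, t). indicator {t - \<epsilon> n..t} \<sigma> * (ennreal (A (x, \<sigma>)) / ennreal (\<epsilon> n)))"
            by (auto simp: fun_eq_iff indicator_def)
          finally show "(\<lambda>(\<sigma>, t). indicator {t - \<epsilon> n..t} \<sigma> * (ennreal (A (x, \<sigma>)) / ennreal (\<epsilon> n))) \<in> borel_measurable (lborel \<Otimes>\<^sub>M lborel)" .
        qed
        also have "\<dots> = (\<integral>\<^sup>+\<sigma>. ennreal (A (x, \<sigma>)) \<partial>lborel)"
        proof (rule nn_integral_cong)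
          fix \<sigma> :: real
          have "(\<integral>\<^sup>+t. indicator {t - \<epsilon> n..t} \<sigma> * (ennreal (A (x, \<sigma>)) / ennreal (\<epsilon> n)) \<partial>lborel)
            = (\<integral>\<^sup>+t. (ennreal (A (x, \<sigma>)) / ennreal (\<epsilon> n)) * indicator {\<sigma>..\<sigma> + \<epsilon> n} t \<partial>lborel)"
            by (intro nn_integral_cong) (auto simp: indicator_def)
          also have "\<dots> = (ennreal (A (x, \<sigma>)) / ennreal (\<epsilon> n)) * ennreal (\<epsilon> n)"
            using \<epsilon>(2)[of n] by (subst nn_integral_cmult_indicator) auto
          also have "\<dots> = ennreal (A (x, \<sigma>))"
            using \<epsilon>(2)[of n] A(2) by (simp add: divide_ennreal ennreal_mult[symmetric])
          finally show "(\<integral>\<^sup>+t. indicator {t - \<epsilon> n..t} \<sigma> * (ennreal (A (x, \<sigma>)) / ennreal (\<epsilon> n)) \<partial>lborel) = ennreal (A (x, \<sigma>))" .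
        qed
        finally show ?case .
      qed
    qed
    also have "\<dots> = (\<integral>\<^sup>+z. ennreal (A z) \<partial>?P)"
      by (rule lborel.nn_integral_fst) measurable
    finally show ?thesis .
  qed
  have int_a: "integrable ?P (a n)" for n
    using nn_a[of n] A a0[of n] by (auto simp: integrable_iff_bounded)
  have a_eq: "(LINT z|?P. a n z) = (LINT z|?P. A z)" for n
    using nn_a[of n] a0[of n] A by (simp add: integral_eq_nn_integral)
  define D where "D n z = c * (a n z + A z + N z)" for n z
  have int_D: "integrable ?P (D n)" for n
    unfolding D_def[abs_def] using int_a A N by auto
  have D_eq: "(LINT z|?P. D n z) = c * (2 * (LINT z|?P. A z) + (LINT z|?P. N z))" for n
    unfolding D_def using int_a A N by (simp add: a_eq)
  \<comment> \<open>The assumed bound for one pair of times, averaged over the earlier time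
    \<sigma>.\<close>
  have AEbound: "AE z in ?P. \<bar>b n z * Z z\<bar> \<le> D n z" for n
  proof (rule lborel_pair.AE_pair_measure)
    show "{z \<in> space ?P. \<bar>b n z * Z z\<bar> \<le> D n z} \<in> sets ?P"
      unfolding D_def by measurable
    show "AE x in lborel. AE t in lborel. \<bar>b n (x, t) * Z (x, t)\<bar> \<le> D n (x, t)"
      using secA secB
    proof eventually_elim
      case (elim x)
      have "\<bar>b n (x, t) * Z (x, t)\<bar> \<le> D n (x, t)" for t
      proof -
        have iA: "set_integrable lborel {t - \<epsilon> n..t} (\<lambda>\<sigma>. A (x, \<sigma>))"
          and iB: "set_integrable lborel {t - \<epsilon> n..t} (\<lambda>\<sigma>. B (x, \<sigma>))"
          using elim by (auto intro: set_integrable_lborel)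
        have ic: "set_integrable lborel {t - \<epsilon> n..t} (\<lambda>\<sigma>. A (x, t) + N (x, t))"
          unfolding set_integrable_def using \<epsilon>(2)[of n]
          by (intro integrable_scaleR_left integrable_real_indicator) auto
        have "\<epsilon> n * \<bar>b n (x, t) * Z (x, t)\<bar> = \<bar>LINT \<sigma>:{t - \<epsilon> n..t}|lborel. B (x, \<sigma>) * Z (x, t)\<bar>"
          using \<epsilon>(2)[of n] by (simp add: b_def abs_mult)
        also have "\<dots> \<le> (LINT \<sigma>:{t - \<epsilon> n..t}|lborel. \<bar>B (x, \<sigma>) * Z (x, t)\<bar>)"
          using set_integral_norm_bound[of lborel "{t - \<epsilon> n..t}" "\<lambda>\<sigma>. B (x, \<sigma>) * Z (x, t)"] iB by simp
        also have "\<dots> \<le> (LINT \<sigma>:{t - \<epsilon> n..t}|lborel. c * (A (x, \<sigma>) + (A (x, t) + N (x, t))))"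
        proof (rule set_integral_mono)
          show "set_integrable lborel {t - \<epsilon> n..t} (\<lambda>\<sigma>. \<bar>B (x, \<sigma>) * Z (x, t)\<bar>)"
            using iB by (intro set_integrable_abs set_integrable_mult_left) auto
          show "set_integrable lborel {t - \<epsilon> n..t} (\<lambda>\<sigma>. c * (A (x, \<sigma>) + (A (x, t) + N (x, t))))"
            by (rule set_integrable_mult_right[OF set_integral_add(1)[OF iA ic]])
        qed (use bound in \<open>auto simp: add.assoc\<close>)
        also have "\<dots> = c * (\<epsilon> n * a n (x, t) + \<epsilon> n * (A (x, t) + N (x, t)))"
          using \<epsilon>(2)[of n] set_integral_add(2)[OF iA ic] by (simp add: a_def set_integral_const)
        also have "\<dots> = \<epsilon> n * D n (x, t)"
          by (simp add: D_def algebra_simps)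
        finally show ?thesis using \<epsilon>(2)[of n] by simp
      qed
      then show ?case by simp
    qed
  qed
  have int_f: "integrable ?P (\<lambda>z. b n z * Z z)" for n
    by (rule Bochner_Integration.integrable_bound[OF int_D[of n]]) (use AEbound[of n] in \<open>auto elim!: eventually_mono\<close>)
  then show "integrable ?P (\<lambda>z. b m z * Z z)" .
  show "\<exists>n. (LINT z|?P. b n z * Z z) > - \<kappa>"
  proof (rule ccontr)
    assume "\<not> ?thesis"
    then have le: "(LINT z|?P. b n z * Z z) \<le> - \<kappa>" for n by (auto simp: not_less)
    \<comment> \<open>The common integral of all dominating functions \<open>D n\<close>, and also
      the integral of their pointwise limit.\<close>
    define I where "I = c * (2 * (LINT z|?P. A z) + (LINT z|?P. N z))"
    define u where "u n z = ennreal (b n z * Z z + D n z)" for n z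
    have [measurable]: "u n \<in> borel_measurable ?P" for n
      unfolding u_def[abs_def] D_def by measurable
    have un: "(\<integral>\<^sup>+z. u n z \<partial>?P) \<le> ennreal (I - \<kappa>)" for n
    proof -
      have "(\<integral>\<^sup>+z. u n z \<partial>?P) = ennreal (LINT z|?P. b n z * Z z + D n z)"
        unfolding u_def
        by (rule nn_integral_eq_integral) (use int_f int_D AEbound[of n] in \<open>auto elim!: eventually_mono\<close>)
      also have "(LINT z|?P. b n z * Z z + D n z) = (LINT z|?P. b n z * Z z) + I"
        using int_f int_D by (simp add: D_eq I_def)
      finally show ?thesis using le[of n] by (auto intro: ennreal_leI)
    qed
    have "ennreal I = (\<integral>\<^sup>+z. ennreal (c * (2 * A z + N z)) \<partial>?P)"
      unfolding I_def using A N c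
      by (subst nn_integral_eq_integral) (auto intro!: mult_nonneg_nonneg add_nonneg_nonneg)
    also have "\<dots> = (\<integral>\<^sup>+x. \<integral>\<^sup>+t. ennreal (c * (2 * A (x, t) + N (x, t))) \<partial>lborel \<partial>lborel)"
      by (rule lborel.nn_integral_fst[symmetric]) measurable
    also have "\<dots> \<le> (\<integral>\<^sup>+x. \<integral>\<^sup>+t. liminf (\<lambda>n. u n (x, t)) \<partial>lborel \<partial>lborel)"
    proof (rule nn_integral_mono_AE)
      show "AE x in lborel. (\<integral>\<^sup>+t. ennreal (c * (2 * A (x, t) + N (x, t))) \<partial>lborel) \<le> (\<integral>\<^sup>+t. liminf (\<lambda>n. u n (x, t)) \<partial>lborel)"
        using secA secB
      proof eventually_elim
        case (elim x)
        show ?case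
        proof (rule nn_integral_mono_AE)
          show "AE t in lborel. ennreal (c * (2 * A (x, t) + N (x, t))) \<le> liminf (\<lambda>n. u n (x, t))"
            using AE_left_average_tendsto[OF elim(1)] AE_left_average_tendsto[OF elim(2)]
          proof eventually_elim
            case (elim t)
            have f: "filterlim \<epsilon> (at_right 0) sequentially"
              using \<epsilon>(1) less_imp_neq[OF \<epsilon>(2)]
              by (auto simp: filterlim_at \<epsilon>(2) intro!: always_eventually)
            have "(\<lambda>n. a n (x, t)) \<longlonglongrightarrow> A (x, t)" "(\<lambda>n. b n (x, t)) \<longlonglongrightarrow> B (x, t)"
              using filterlim_compose[OF elim(1) f] filterlim_compose[OF elim(2) f]
              by (auto simp: a_def b_def)
            then have "(\<lambda>n. u n (x, t)) \<longlonglongrightarrow> ennreal (B (x, t) * Z (x, t) + c * (A (x, t) + A (x, t) + N (x, t)))"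
              unfolding u_def D_def by (intro tendsto_intros tendsto_ennrealI)
            then have "liminf (\<lambda>n. u n (x, t)) = ennreal (B (x, t) * Z (x, t) + c * (A (x, t) + A (x, t) + N (x, t)))"
              by (rule lim_imp_Liminf[rotated]) simp
            then show ?case using nonneg[of "(x, t)"] by (auto intro: ennreal_leI)
          qed
        qed
      qed
    qed
    also have "\<dots> = (\<integral>\<^sup>+z. liminf (\<lambda>n. u n z) \<partial>?P)"
      by (rule lborel.nn_integral_fst) measurable
    also have "\<dots> \<le> liminf (\<lambda>n. \<integral>\<^sup>+z. u n z \<partial>?P)"
      by (rule nn_integral_liminf) measurable
    also have "\<dots> \<le> liminf (\<lambda>n::nat. ennreal (I - \<kappa>))"
      by (intro Liminf_mono always_eventually allI un)
    also have "\<dots> = ennreal (I - \<kappa>)" by (rule Liminf_const) simp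
    finally have "ennreal I \<le> ennreal (I - \<kappa>)" .
    moreover have "0 \<le> I" unfolding I_def using A N c by (intro mult_nonneg_nonneg add_nonneg_nonneg) auto
    \<comment> \<open>\<open>ennreal\<close> sends negative numbers to \<open>0\<close>. If
      \<open>I - \<kappa>\<close> were negative, the inequality just obtained would be consistent
      with \<open>I = 0\<close>.\<close>
    moreover have "0 \<le> I - \<kappa>"
    proof -
      have "\<bar>LINT z|?P. b 0 z * Z z\<bar> \<le> (LINT z|?P. D 0 z)"
        using integral_abs_bound[of ?P "\<lambda>z. b 0 z * Z z"] integral_mono_AE[OF integrable_abs[OF int_f] int_D AEbound[of 0]]
        by linarith
      then show ?thesis using le[of 0] by (simp add: D_eq I_def)
    qed
    ultimately show False using \<kappa> by (simp add: ennreal_le_iff)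
  qed
qed

subsection \<open>Weak solutions on a rectangle\<close>

lemma AE_eq_imp_eq_on_interval:
  fixes f g :: "real \<Rightarrow> real"
  assumes "a < b" "continuous_on {a..b} f" "continuous_on {a..b} g"
    and ae: "AE x in lborel. x \<in> {a<..<b} \<longrightarrow> f x = g x"
    and x: "x \<in> {a..b}"
  shows "f x = g x"
proof (rule ccontr)
  assume "f x \<noteq> g x"
  define e where "e = \<bar>f x - g x\<bar>"
  have "continuous_on {a..b} (\<lambda>x. f x - g x)" by (intro continuous_intros assms)
  moreover have "e > 0" using \<open>f x \<noteq> g x\<close> by (simp add: e_def)
  ultimately obtain r where r: "r > 0" "\<And>y. y \<in> {a..b} \<Longrightarrow> \<bar>y - x\<bar> < r \<Longrightarrow> \<bar>(f y - g y) - (f x - g x)\<bar> < e"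
    using x unfolding continuous_on_iff dist_real_def by blast
  define l where "l = max a (x - r)"
  define u where "u = min b (x + r)"
  have "l < u" using assms(1) x r(1) by (auto simp: l_def u_def)
  have "AE y in lborel. y \<notin> {l<..<u}"
    using ae
  proof eventually_elim
    case (elim y)
    show ?case
    proof
      assume y: "y \<in> {l<..<u}"
      then have "y \<in> {a<..<b}" "\<bar>y - x\<bar> < r" by (auto simp: l_def u_def abs_less_iff)
      then show False using elim r(2)[of y] by (auto simp: e_def)
    qed
  qed
  then have "emeasure lborel {l<..<u} = 0"
    using AE_iff_null_sets[of "{l<..<u}" lborel] by auto
  then show False using \<open>l < u\<close> by simp
qed

lemma grad_real_eq:
  assumes "(f has_real_derivative f') (at x)"
  shows "grad f x = f'"
  unfolding grad_def
proof (rule the_equality)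
  show "GDERIV f x :> f'"
    using assms by (simp add: gderiv_def has_field_derivative_def mult_commute_abs)
  fix D assume "GDERIV f x :> D"
  then have "(f has_real_derivative D) (at x)"
    by (simp add: gderiv_def has_field_derivative_def mult_commute_abs)
  then show "D = f'" using assms DERIV_unique by blast
qed

lemma smooth_real_measurable: "smooth_real f \<Longrightarrow> f \<in> borel_measurable borel"
  by (intro borel_measurable_continuous_onI smooth_real_continuous)

lemma bumpsE:
  assumes "X \<in> bumps c1 c2"
  obtains X' B where "smooth_real X'" "\<And>x. (X has_real_derivative X' x) (at x)"
    "\<And>x. \<bar>X x\<bar> \<le> B" "\<And>x. \<bar>X' x\<bar> \<le> B"
proof -
  obtain a b where X: "smooth_real X" "c1 < a" "b < c2" "\<And>x. X x \<noteq> 0 \<Longrightarrow> a \<le> x \<and> x \<le> b"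
    using assms unfolding bumps_def by blast
  obtain X' where X': "smooth_real X'" "\<And>x. (X has_real_derivative X' x) (at x)"
    by (rule smooth_real_derivative[OF X(1)]) (rule that)
  have supp: "x \<in> {c1..c2}" if "X x \<noteq> 0 \<or> X' x \<noteq> 0" for x
    using bump_integrals(5)[OF assms X'(2) smooth_real_continuous[OF X'(1)]] that by fastforce
  have "bounded (X ` {c1..c2})" "bounded (X' ` {c1..c2})"
    by (intro compact_imp_bounded compact_continuous_image smooth_real_continuous X X' compact_Icc)+
  then obtain A B where AB: "\<And>x. x \<in> {c1..c2} \<Longrightarrow> \<bar>X x\<bar> \<le> A" "\<And>x. x \<in> {c1..c2} \<Longrightarrow> \<bar>X' x\<bar> \<le> B"
    unfolding bounded_iff real_norm_def by blast
  have "\<bar>X x\<bar> \<le> max (max A B) 0" for x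
    using supp[of x] AB(1)[of x] by (cases "X x = 0") auto
  moreover have "\<bar>X' x\<bar> \<le> max (max A B) 0" for x
    using supp[of x] AB(2)[of x] by (cases "X' x = 0") auto
  ultimately show ?thesis by (rule that[OF X'])
qed

text \<open>The situation on a rectangle compactly inside the domain of a \<open>p\<close>-parabolic
  function: \<open>h\<close> is continuous up to the boundary and one weak gradient \<open>g\<close>
  has been fixed.\<close>

locale weak_solution_box =
  fixes p c1 c2 s0 s1 :: real and h g :: "real \<times> real \<Rightarrow> real"
  assumes p: "1 < p" and c12: "c1 < c2" and s01: "s0 < s1"
    and h_cont: "continuous_on ({c1..c2} \<times> {s0..s1}) h"
    and Sobolev: "Lp_W1p p {c1<..<c2} s0 s1 h g"
    and weak: "\<And>\<phi>. \<phi> \<in> test_functions ({c1<..<c2} \<times> {s0<..<s1}) \<Longrightarrow>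
      (LINT z:{c1<..<c2} \<times> {s0<..<s1}|lborel. (norm (g z) powr (p - 2) *\<^sub>R g z) \<bullet> space_grad \<phi> z)
      - (LINT z:{c1<..<c2} \<times> {s0<..<s1}|lborel. h z * time_deriv \<phi> z) = 0"
begin

abbreviation "plane \<equiv> lborel \<Otimes>\<^sub>M lborel :: (real \<times> real) measure"
abbreviation "Q \<equiv> {c1<..<c2} \<times> {s0<..<s1}"

text \<open>After extension by zero, integrals, primitives and backward averages can be taken over
  whole lines and over the plane.\<close>

definition "gQ z = indicator Q z * g z"
definition "hQ z = indicator Q z * h z"

lemma sets_Q [measurable]: "Q \<in> sets plane" "Q \<in> sets borel"
proof -
  show "Q \<in> sets borel" by (intro borel_open open_Times) auto
  then show "Q \<in> sets plane" by (simp add: lborel_prod)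
qed

lemma emeasure_Q: "emeasure plane Q < \<infinity>"
  using c12 s01 by (simp add: lborel.emeasure_pair_measure_Times ennreal_mult_less_top)

lemma integrable_Q: "integrable plane (indicator Q :: _ \<Rightarrow> real)"
  using emeasure_Q by (intro integrable_real_indicator) auto

lemma gQ_measurable [measurable]: "gQ \<in> borel_measurable plane"
proof -
  have "set_borel_measurable lborel Q g"
    using Sobolev by (simp add: Lp_W1p_def Lp_on_def)
  then show ?thesis by (simp add: set_borel_measurable_def gQ_def[abs_def] lborel_prod)
qed

lemma integrable_gQ_powr: "integrable plane (\<lambda>z. \<bar>gQ z\<bar> powr p)"
proof -
  have "set_integrable lborel Q (\<lambda>z. norm (g z) powr p)"
    using Sobolev by (simp add: Lp_W1p_def Lp_on_def)
  moreover have "indicator Q z *\<^sub>R norm (g z) powr p = \<bar>gQ z\<bar> powr p" for z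
    by (auto simp: gQ_def indicator_def)
  ultimately show ?thesis by (simp add: set_integrable_def lborel_prod)
qed

text \<open>As \<open>Q\<close> has finite measure, integrability of the power \<open>p\<close> of
  the gradient passes to the power \<open>p - 1\<close>, which is the flux, and on slices to the
  gradient itself.\<close>

lemma powr_le_1_plus:
  fixes u :: real
  assumes "0 \<le> u" "0 \<le> r" "r \<le> p"
  shows "u powr r \<le> 1 + u powr p"
proof (cases "u \<le> 1")
  case True
  then have "u powr r \<le> 1" using powr_mono2[of r u 1] assms by simp
  then show ?thesis using powr_ge_zero[of u p] by linarith
next
  case False
  then have "u powr r \<le> u powr p" using assms by (intro powr_mono) auto
  then show ?thesis by simp
qed

lemma integrable_flux_gQ: "integrable plane (\<lambda>z. flux p (gQ z))"
proof (rule Bochner_Integration.integrable_bound)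
  show "integrable plane (\<lambda>z. indicator Q z + \<bar>gQ z\<bar> powr p)"
    by (intro Bochner_Integration.integrable_add integrable_Q integrable_gQ_powr)
  show "AE z in plane. norm (flux p (gQ z)) \<le> norm (indicator Q z + \<bar>gQ z\<bar> powr p)"
  proof (intro AE_I2)
    fix z
    show "norm (flux p (gQ z)) \<le> norm (indicator Q z + \<bar>gQ z\<bar> powr p)"
      using powr_le_1_plus[of "\<bar>gQ z\<bar>" "p - 1"] p
      by (cases "z \<in> Q") (auto simp: abs_flux gQ_def)
  qed
qed measurable

lemma hQ_bounded: obtains M where "\<And>z. \<bar>hQ z\<bar> \<le> M" "0 \<le> M"
proof -
  have "bounded (h ` ({c1..c2} \<times> {s0..s1}))"
    by (intro compact_imp_bounded compact_continuous_image h_cont compact_Times compact_Icc)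
  then obtain M where M: "\<And>z. z \<in> {c1..c2} \<times> {s0..s1} \<Longrightarrow> \<bar>h z\<bar> \<le> M"
    unfolding bounded_iff real_norm_def by blast
  have "\<bar>hQ z\<bar> \<le> max M 0" for z
    using M[of z] by (cases z) (auto simp: hQ_def indicator_def)
  then show ?thesis using that[of "max M 0"] by simp
qed

lemma hQ_measurable [measurable]: "hQ \<in> borel_measurable plane"
proof -
  have "(\<lambda>z. indicator Q z *\<^sub>R h z) \<in> borel_measurable borel"
    by (rule borel_measurable_continuous_on_indicator)
      (auto intro: continuous_on_subset[OF h_cont] sets_Q)
  then show ?thesis by (simp add: hQ_def[abs_def] lborel_prod)
qed

lemma integrable_hQ: "integrable plane hQ"
proof -
  obtain M where M: "\<And>z. \<bar>hQ z\<bar> \<le> M" "0 \<le> M" by (rule hQ_bounded) (rule that)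
  from integrable_bounded_mult(1)[OF integrable_Q hQ_measurable M(1)]
  have "integrable plane (\<lambda>z. hQ z * indicator Q z)" .
  moreover have "hQ z * indicator Q z = hQ z" for z by (simp add: hQ_def indicator_def)
  ultimately show ?thesis by simp
qed

lemma slice_continuous: "t \<in> {s0..s1} \<Longrightarrow> continuous_on {c1..c2} (\<lambda>x. h (x, t))"
  by (rule continuous_on_compose2[OF h_cont]) (auto intro!: continuous_intros)

lemma integrable_slice:
  "integrable lborel (\<lambda>x. hQ (x, t))"
proof -
  obtain M where M: "\<And>z. \<bar>hQ z\<bar> \<le> M" "0 \<le> M" by (rule hQ_bounded) (rule that)
  have I: "integrable lborel (indicator {c1<..<c2} :: real \<Rightarrow> real)"
    by (rule integrable_real_indicator) (use c12 in auto)
  have "integrable lborel (\<lambda>x. hQ (x, t) * indicator {c1<..<c2} x)"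
    by (rule integrable_bounded_mult(1)[OF I _ M(1)]) measurable
  moreover have "hQ (x, t) * indicator {c1<..<c2} x = hQ (x, t)" for x by (simp add: hQ_def indicator_def)
  ultimately show ?thesis by simp
qed

text \<open>Du Bois-Reymond's lemma turns the weak derivative of a slice into a primitive for almost
  every \<open>x\<close>; continuity of \<open>h\<close> extends this to every \<open>x\<close>,
  endpoints included.\<close>

lemma slice_absolutely_continuous:
  "AE t in lborel. t \<in> {s0<..<s1} \<longrightarrow> integrable lborel (\<lambda>x. gQ (x, t)) \<and>
     (\<exists>C. \<forall>x\<in>{c1..c2}. h (x, t) = C + prim (\<lambda>x. gQ (x, t)) x)"
proof -
  have "AE t in lborel. t \<in> {s0<..<s1} \<longrightarrow> W1p_on p {c1<..<c2} (\<lambda>x. h (x, t)) (\<lambda>x. g (x, t))"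
    using Sobolev by (simp add: Lp_W1p_def)
  then show ?thesis
  proof eventually_elim
    case (elim t)
    show ?case
    proof
      assume t: "t \<in> {s0<..<s1}"
      with elim have W: "W1p_on p {c1<..<c2} (\<lambda>x. h (x, t)) (\<lambda>x. g (x, t))" by blast
      have gi: "gQ (x, t) = indicator {c1<..<c2} x * g (x, t)" "hQ (x, t) = indicator {c1<..<c2} x * h (x, t)" for x
        using t by (auto simp: gQ_def hQ_def indicator_def)
      have gp: "integrable lborel (\<lambda>x. \<bar>gQ (x, t)\<bar> powr p)"
      proof -
        have "set_integrable lborel {c1<..<c2} (\<lambda>x. norm (g (x, t)) powr p)"
          using W by (simp add: W1p_on_def Lp_on_def)
        moreover have "indicator {c1<..<c2} x *\<^sub>R norm (g (x, t)) powr p = \<bar>gQ (x, t)\<bar> powr p" for x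
          by (auto simp: gi indicator_def)
        ultimately show ?thesis by (simp add: set_integrable_def)
      qed
      have I: "integrable lborel (indicator {c1<..<c2} :: real \<Rightarrow> real)"
        by (rule integrable_real_indicator) (use c12 in auto)
      have ig: "integrable lborel (\<lambda>x. gQ (x, t))"
      proof (rule Bochner_Integration.integrable_bound)
        show "integrable lborel (\<lambda>x. indicator {c1<..<c2} x + \<bar>gQ (x, t)\<bar> powr p)"
          by (intro Bochner_Integration.integrable_add I gp)
        show "AE x in lborel. norm (gQ (x, t)) \<le> norm (indicator {c1<..<c2} x + \<bar>gQ (x, t)\<bar> powr p)"
        proof (intro AE_I2)
          fix x
          show "norm (gQ (x, t)) \<le> norm (indicator {c1<..<c2} x + \<bar>gQ (x, t)\<bar> powr p)"
            using powr_le_1_plus[of "\<bar>gQ (x, t)\<bar>" 1] p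
            by (cases "x \<in> {c1<..<c2}") (auto simp: gi)
        qed
      qed measurable
      have "\<exists>C. AE x in lborel. x \<in> {c1<..<c2} \<longrightarrow> hQ (x, t) = C + prim (\<lambda>x. gQ (x, t)) x"
      proof (rule du_Bois_Reymond[OF integrable_slice ig c12])
        fix X X' assume X: "X \<in> bumps c1 c2" "\<And>x. (X has_real_derivative X' x) (at x)" "continuous_on UNIV X'"
        have "(LINT x:{c1<..<c2}|lborel. h (x, t) *\<^sub>R grad X x) = - (LINT x:{c1<..<c2}|lborel. X x *\<^sub>R g (x, t))"
          using W bumps_test_functions[OF X(1)] by (simp add: W1p_on_def)
        then show "(LINT x|lborel. hQ (x, t) * X' x) = - (LINT x|lborel. gQ (x, t) * X x)"
          by (simp add: set_lebesgue_integral_def grad_real_eq[OF X(2)] gi mult_ac)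
      qed
      then obtain C where C: "AE x in lborel. x \<in> {c1<..<c2} \<longrightarrow> hQ (x, t) = C + prim (\<lambda>x. gQ (x, t)) x" by blast
      have "h (x, t) = C + prim (\<lambda>x. gQ (x, t)) x" if "x \<in> {c1..c2}" for x
      proof (rule AE_eq_imp_eq_on_interval[OF c12 _ _ _ that])
        show "AE x in lborel. x \<in> {c1<..<c2} \<longrightarrow> h (x, t) = C + prim (\<lambda>x. gQ (x, t)) x"
          using C by eventually_elim (auto simp: gi)
      qed (use t in \<open>auto intro!: slice_continuous continuous_intros continuous_prim ig\<close>)
      then show "integrable lborel (\<lambda>x. gQ (x, t)) \<and> (\<exists>C. \<forall>x\<in>{c1..c2}. h (x, t) = C + prim (\<lambda>x. gQ (x, t)) x)"
        using ig by blast
    qed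
  qed
qed

text \<open>Let \<open>K\<close> and \<open>L\<close> be the integrals over a slice of
  \<open>h\<close> against \<open>X\<close> and of the flux against \<open>X'\<close>. Testing with
  \<open>X x * Y t\<close> says that \<open>K\<close> has weak derivative \<open>- L\<close>, which
  du Bois-Reymond's lemma integrates; Fubini's theorem moves the time integral inside. Continuity in
  time gives all \<open>s\<close> and \<open>s'\<close>, not just almost all.\<close>

lemma time_increment:
  assumes X: "X \<in> bumps c1 c2" "smooth_real X'" "\<And>x. (X has_real_derivative X' x) (at x)"
    and s: "s0 < s" "s \<le> s'" "s' < s1"
  shows "(LINT x|lborel. (hQ (x, s') - hQ (x, s)) * X x)
    = - (LINT x|lborel. (LINT \<sigma>:{s..s'}|lborel. flux p (gQ (x, \<sigma>))) * X' x)"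
proof -
  obtain X'' B where B: "smooth_real X''" "\<And>x. (X has_real_derivative X'' x) (at x)"
    "\<And>x. \<bar>X x\<bar> \<le> B" "\<And>x. \<bar>X'' x\<bar> \<le> B"
    by (rule bumpsE[OF X(1)]) (rule that)
  have "X'' = X'" using DERIV_unique[OF B(2) X(3)] by (rule ext)
  note B = B(3) B(4)[unfolded this]
  have [measurable]: "X \<in> borel_measurable borel" "X' \<in> borel_measurable borel"
    using X by (auto intro: smooth_real_measurable simp: bumps_def)
  have ihX: "integrable plane (\<lambda>z. hQ z * X (fst z))"
    by (rule integrable_bounded_mult(2)[OF integrable_hQ _ B(1)]) measurable
  have ifX: "integrable plane (\<lambda>z. flux p (gQ z) * X' (fst z))"
    by (rule integrable_bounded_mult(2)[OF integrable_flux_gQ _ B(2)]) measurable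
  define K where "K t = (LINT x|lborel. hQ (x, t) * X x)" for t
  define L where "L t = (LINT x|lborel. flux p (gQ (x, t)) * X' x)" for t
  have iK: "integrable lborel K"
    unfolding K_def using lborel_pair.integrable_snd[of "\<lambda>x t. hQ (x, t) * X x"] ihX
    by (simp add: case_prod_unfold)
  have iL: "integrable lborel L"
    unfolding L_def using lborel_pair.integrable_snd[of "\<lambda>x t. flux p (gQ (x, t)) * X' x"] ifX
    by (simp add: case_prod_unfold)
  have ex: "\<exists>C. AE t in lborel. t \<in> {s0<..<s1} \<longrightarrow> K t = C + prim (\<lambda>t. - L t) t"
  proof (rule du_Bois_Reymond[OF iK _ s01])
    show "integrable lborel (\<lambda>t. - L t)" using iL by simp
    fix Y Y' assume Y: "Y \<in> bumps s0 s1" "\<And>x. (Y has_real_derivative Y' x) (at x)" "continuous_on UNIV Y'"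
    obtain Y'' C where C: "smooth_real Y''" "\<And>x. (Y has_real_derivative Y'' x) (at x)" "\<And>x. \<bar>Y x\<bar> \<le> C" "\<And>x. \<bar>Y'' x\<bar> \<le> C"
      by (rule bumpsE[OF Y(1)]) (rule that)
    have "Y'' = Y'" using DERIV_unique[OF C(2) Y(2)] by (rule ext)
    note C = C(1,3,4)[unfolded this]
    have [measurable]: "Y \<in> borel_measurable borel" "Y' \<in> borel_measurable borel"
      using Y C by (auto intro: smooth_real_measurable simp: bumps_def)
    define \<phi> where "\<phi> z = X (fst z) * Y (snd z)" for z
    have sg: "space_grad \<phi> z = X' (fst z) * Y (snd z)" for z
      unfolding space_grad_def \<phi>_def by (rule grad_real_eq) (auto intro!: derivative_eq_intros X(3))
    have td: "time_deriv \<phi> z = X (fst z) * Y' (snd z)" for z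
      unfolding time_deriv_def \<phi>_def by (rule DERIV_imp_deriv) (auto intro!: derivative_eq_intros Y(2))
    have "\<phi> \<in> test_functions Q"
      unfolding \<phi>_def using bumps_tensor_test_functions[OF X(1) Y(1)] .
    then have w: "(LINT z|plane. flux p (gQ z) * X' (fst z) * Y (snd z)) = (LINT z|plane. hQ z * X (fst z) * Y' (snd z))"
    proof -
      have e1: "indicator Q z *\<^sub>R ((norm (g z) powr (p - 2) *\<^sub>R g z) \<bullet> space_grad \<phi> z) = flux p (gQ z) * X' (fst z) * Y (snd z)" for z
        unfolding sg by (simp add: indicator_def gQ_def flux_def)
      have e2: "indicator Q z *\<^sub>R (h z * time_deriv \<phi> z) = hQ z * X (fst z) * Y' (snd z)" for z
        unfolding td by (simp add: indicator_def hQ_def)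
      show ?thesis using weak[OF \<open>\<phi> \<in> test_functions Q\<close>]
        unfolding set_lebesgue_integral_def e1 e2 lborel_prod by simp
    qed
    have i1: "integrable plane (\<lambda>z. flux p (gQ z) * X' (fst z) * Y (snd z))"
      by (rule integrable_bounded_mult(2)[OF ifX _ C(2)]) measurable
    have i2: "integrable plane (\<lambda>z. hQ z * X (fst z) * Y' (snd z))"
      by (rule integrable_bounded_mult(2)[OF ihX, where B = C]) (use C(3) in auto)
    have "(LINT t|lborel. K t * Y' t) = (LINT t|lborel. LINT x|lborel. hQ (x, t) * X x * Y' t)"
      unfolding K_def by simp
    also have "\<dots> = (LINT z|plane. hQ z * X (fst z) * Y' (snd z))"
      using lborel_pair.integral_snd[of "\<lambda>x t. hQ (x, t) * X x * Y' t"] i2 by (simp add: case_prod_unfold)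
    also have "\<dots> = (LINT t|lborel. LINT x|lborel. flux p (gQ (x, t)) * X' x * Y t)"
      using lborel_pair.integral_snd[of "\<lambda>x t. flux p (gQ (x, t)) * X' x * Y t"] i1 w by (simp add: case_prod_unfold)
    also have "\<dots> = (LINT t|lborel. L t * Y t)"
      unfolding L_def by simp
    finally show "(LINT t|lborel. K t * Y' t) = - (LINT t|lborel. - L t * Y t)" by simp
  qed
  then obtain C where C: "AE t in lborel. t \<in> {s0<..<s1} \<longrightarrow> K t = C + prim (\<lambda>t. - L t) t" by blast
  \<comment> \<open>\<open>K\<close> is built from the extension by zero and vanishes at
    \<open>s0\<close> and \<open>s1\<close>. \<open>Kc\<close> agrees with it at the times in
    between and is continuous on the closed interval, so an identity for almost every time holds for
    every time.\<close>
  define Kc where "Kc t = integral (cbox c1 c2) (\<lambda>x. h (x, t) * X x)" for t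
  have Kc: "K t = Kc t" if "t \<in> {s0<..<s1}" for t
  proof -
    have "set_integrable lborel {c1..c2} (\<lambda>x. h (x, t) * X x)"
      using that X by (intro borel_integrable_atLeastAtMost' continuous_intros slice_continuous smooth_real_continuous)
        (auto simp: bumps_def)
    from set_borel_integral_eq_integral(2)[OF this]
    have "Kc t = (LINT x:{c1..c2}|lborel. h (x, t) * X x)" by (simp add: Kc_def)
    also have "\<dots> = K t"
      unfolding K_def set_lebesgue_integral_def
    proof (intro Bochner_Integration.integral_cong refl)
      fix x
      show "indicator {c1..c2} x *\<^sub>R (h (x, t) * X x) = hQ (x, t) * X x"
        using bump_integrals(5)[OF X(1,3) smooth_real_continuous[OF X(2)], of x] that
        by (auto simp: hQ_def indicator_def)
    qed
    finally show ?thesis by simp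
  qed
  have "continuous_on {s0..s1} Kc"
    unfolding Kc_def
  proof (rule integral_continuous_on_param)
    show "continuous_on ({s0..s1} \<times> cbox c1 c2) (\<lambda>(t, x). h (x, t) * X x)"
      unfolding case_prod_unfold
      by (intro continuous_intros continuous_on_compose2[OF h_cont] continuous_on_compose2[OF smooth_real_continuous[of X UNIV]])
        (use X(1) in \<open>auto simp: bumps_def\<close>)
  qed
  then have "Kc t = C + prim (\<lambda>t. - L t) t" if "t \<in> {s0..s1}" for t
  proof (rule AE_eq_imp_eq_on_interval[OF s01 _ _ _ that])
    show "AE t in lborel. t \<in> {s0<..<s1} \<longrightarrow> Kc t = C + prim (\<lambda>t. - L t) t"
      using C by eventually_elim (auto simp: Kc)
  qed (auto intro!: continuous_intros continuous_prim simp: iL)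
  then have "K s' - K s = prim (\<lambda>t. - L t) s' - prim (\<lambda>t. - L t) s"
    using s by (simp add: Kc)
  also have "\<dots> = (LINT \<sigma>:{s..<s'}|lborel. - L \<sigma>)"
    using iL s by (intro prim_diff) auto
  also have "\<dots> = (LINT \<sigma>:{s..s'}|lborel. - L \<sigma>)"
    by (rule set_integral_Ico_eq_Icc) (use iL in auto)
  also have "\<dots> = - (LINT \<sigma>|lborel. LINT x|lborel. indicator {s..s'} \<sigma> * (flux p (gQ (x, \<sigma>)) * X' x))"
    by (simp add: set_lebesgue_integral_def L_def)
  also have "(LINT \<sigma>|lborel. LINT x|lborel. indicator {s..s'} \<sigma> * (flux p (gQ (x, \<sigma>)) * X' x))
    = (LINT x|lborel. LINT \<sigma>|lborel. indicator {s..s'} \<sigma> * (flux p (gQ (x, \<sigma>)) * X' x))"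
  proof (rule lborel_pair.Fubini_integral)
    show "integrable plane (\<lambda>(x, \<sigma>). indicator {s..s'} \<sigma> * (flux p (gQ (x, \<sigma>)) * X' x))"
      using integrable_bounded_mult(1)[OF ifX, of "\<lambda>z. indicator {s..s'} (snd z)" 1]
      by (simp add: case_prod_unfold indicator_def)
  qed
  also have "\<dots> = (LINT x|lborel. (LINT \<sigma>:{s..s'}|lborel. flux p (gQ (x, \<sigma>))) * X' x)"
    by (simp add: set_lebesgue_integral_def mult.assoc[symmetric])
  finally have *: "K s' - K s = - (LINT x|lborel. (LINT \<sigma>:{s..s'}|lborel. flux p (gQ (x, \<sigma>))) * X' x)" .
  have "integrable lborel (\<lambda>x. hQ (x, t) * X x)" for t
    by (rule integrable_bounded_mult(2)[OF integrable_slice _ B(1)]) measurable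
  then have "K s' - K s = (LINT x|lborel. (hQ (x, s') - hQ (x, s)) * X x)"
    unfolding K_def by (simp add: left_diff_distrib)
  with * show ?thesis by simp
qed

lemma integrable_time_flux:
  "integrable lborel (\<lambda>x. LINT \<sigma>:{s..s'}|lborel. flux p (gQ (x, \<sigma>)))"
proof -
  have "integrable plane (\<lambda>z. indicator {s..s'} (snd z) * flux p (gQ z))"
    by (rule integrable_bounded_mult(1)[OF integrable_flux_gQ, where B = 1]) (auto simp: indicator_def)
  then show ?thesis
    using lborel_pair.integrable_fst[of "\<lambda>x \<sigma>. indicator {s..s'} \<sigma> * flux p (gQ (x, \<sigma>))"]
    by (simp add: case_prod_unfold set_lebesgue_integral_def)
qed

text \<open>Du Bois-Reymond's lemma again, now in \<open>x\<close>. In the energy estimate this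
  identity takes the place of an equation with a time derivative.\<close>

lemma time_flux_absolutely_continuous:
  assumes s: "s0 < s" "s \<le> s'" "s' < s1"
  shows "\<exists>C. AE x in lborel. x \<in> {c1<..<c2} \<longrightarrow>
    (LINT \<sigma>:{s..s'}|lborel. flux p (gQ (x, \<sigma>))) = C + prim (\<lambda>x. hQ (x, s') - hQ (x, s)) x"
proof (rule du_Bois_Reymond[OF integrable_time_flux _ c12])
  show "integrable lborel (\<lambda>x. hQ (x, s') - hQ (x, s))"
    by (intro Bochner_Integration.integrable_diff integrable_slice)
  fix X X' assume X: "X \<in> bumps c1 c2" "\<And>x. (X has_real_derivative X' x) (at x)" "continuous_on UNIV X'"
  obtain X'' B where X'': "smooth_real X''" "\<And>x. (X has_real_derivative X'' x) (at x)"
    "\<And>x. \<bar>X x\<bar> \<le> B" "\<And>x. \<bar>X'' x\<bar> \<le> B"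
    by (rule bumpsE[OF X(1)]) (rule that)
  have "X'' = X'" using DERIV_unique[OF X''(2) X(2)] by (rule ext)
  with X''(1) have "smooth_real X'" by simp
  from time_increment[OF X(1) this X(2) s]
  show "(LINT x|lborel. (LINT \<sigma>:{s..s'}|lborel. flux p (gQ (x, \<sigma>))) * X' x) = - (LINT x|lborel. (hQ (x, s') - hQ (x, s)) * X x)"
    by simp
qed

end

subsection \<open>The energy estimate\<close>

lemma prim_linear:
  assumes "integrable lborel f" "integrable lborel k"
  shows "prim (\<lambda>x. f x - k x) x = prim f x - prim k x"
  unfolding prim_def by (intro set_integral_diff set_integrable_lborel assms) auto

lemma prim_of_derivative:
  assumes "\<And>x. (\<psi> has_real_derivative f x) (at x)" "continuous_on UNIV f" "x \<in> {c1..c2}"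
  shows "prim (\<lambda>x. indicator {c1<..<c2} x * f x) x = \<psi> x - \<psi> c1"
proof -
  have [measurable]: "f \<in> borel_measurable borel"
    by (rule borel_measurable_continuous_onI[OF assms(2)])
  have "prim (\<lambda>x. indicator {c1<..<c2} x * f x) x = (LINT s:{c1..x}|lborel. f s)"
    unfolding prim_def set_lebesgue_integral_def
  proof (rule integral_cong_AE)
    have "AE s in lborel. s \<noteq> x" "AE s in lborel. s \<noteq> c1" by (rule AE_lborel_singleton)+
    then show "AE s in lborel. indicator {..<x} s *\<^sub>R (indicator {c1<..<c2} s * f s) = indicator {c1..x} s *\<^sub>R f s"
      by eventually_elim (use assms(3) in \<open>auto simp: indicator_def\<close>)
  qed auto
  also have "\<dots> = \<psi> x - \<psi> c1"
    using integral_FTC_Icc[of c1 x \<psi> f] assms continuous_on_subset[OF assms(2)]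
    by (simp add: has_real_derivative_iff_has_vector_derivative[symmetric] has_field_derivative_at_within set_lebesgue_integral_def)
  finally show ?thesis .
qed

lemma continuous_sgn_root:
  assumes "1 < p"
  shows "continuous_on S (sgn_root p)"
proof -
  have "isCont (sgn_root p) y" for y
  proof (cases "y = 0")
    case True
    have "((\<lambda>y. \<bar>y\<bar> powr (1 / (p - 1))) \<longlongrightarrow> 0) (at 0)"
      using assms by (intro tendsto_zero_powrI tendsto_rabs_zero tendsto_ident_at tendsto_const always_eventually) auto
    then have "((\<lambda>y. \<bar>sgn_root p y\<bar>) \<longlongrightarrow> 0) (at 0)" by (simp add: abs_sgn_root)
    then have "(sgn_root p \<longlongrightarrow> 0) (at 0)" by (simp only: tendsto_rabs_zero_iff)
    then show ?thesis using True by (simp add: isCont_def sgn_root_def)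
  next
    case False
    then show ?thesis
      unfolding sgn_root_def[abs_def] isCont_def by (intro tendsto_intros) auto
  qed
  then show ?thesis by (simp add: continuous_at_imp_continuous_on)
qed

text \<open>\<open>chain_rule_prim\<close> asks for a continuously differentiable function of the
  excess. The positive part is not, but its square is. \<open>pos_cube\<close> is the primitive of
  \<open>pos_square\<close> and serves as energy density.\<close>

definition pos_cube :: "real \<Rightarrow> real" where "pos_cube y = (max 0 y) ^ 3 / 3"
definition pos_square :: "real \<Rightarrow> real" where "pos_square y = (max 0 y) ^ 2"

lemma DERIV_pos_square: "(pos_square has_real_derivative 2 * max 0 y) (at y)"
proof -
  consider "y < 0" | "y > 0" | "y = 0" by linarith
  then show ?thesis
  proof cases
    case 1
    have "((\<lambda>y. 0) has_real_derivative 2 * max 0 y) (at y)" using 1 by simp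
    then show ?thesis
      by (rule has_field_derivative_transform_within_open[where S = "{..<0}"]) (use 1 in \<open>auto simp: pos_square_def\<close>)
  next
    case 2
    have "((\<lambda>y. y ^ 2) has_real_derivative 2 * max 0 y) (at y)" using 2 by (auto intro!: derivative_eq_intros)
    then show ?thesis
      by (rule has_field_derivative_transform_within_open[where S = "{0<..}"]) (use 2 in \<open>auto simp: pos_square_def\<close>)
  next
    case 3
    have "((\<lambda>h. max 0 h) \<longlongrightarrow> max 0 0) (at (0::real))" by (intro tendsto_intros)
    then have "((\<lambda>h. max 0 h) \<longlongrightarrow> 0) (at (0::real))" by simp
    then have "((\<lambda>h. (pos_square (0 + h) - pos_square 0) / h) \<longlongrightarrow> 0) (at 0)"
      by (rule Lim_transform_eventually) (auto simp: eventually_at_filter pos_square_def max_def power2_eq_square)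
    then show ?thesis using 3 by (simp add: DERIV_def)
  qed
qed

text \<open>Convexity: the tangent of \<open>pos_cube\<close> at \<open>y\<close> stays below the
  graph. For \<open>y > 0\<close> and \<open>v = max 0 z\<close> the difference is the explicit
  square \<open>(y - v)^2 * (2 * y + v) / 3\<close>, and lowering \<open>v\<close> to
  \<open>z\<close> only helps.\<close>

lemma pos_cube_convex: "pos_cube y - pos_cube z \<le> (y - z) * pos_square y"
proof (cases "y > 0")
  case True
  define v where "v = max 0 z"
  have "0 \<le> (y - v)\<^sup>2 * (2 * y + v) / 3" using True by (simp add: v_def)
  also have "\<dots> = (y - v) * y\<^sup>2 - (y ^ 3 / 3 - v ^ 3 / 3)"
    by (simp add: power2_eq_square power3_eq_cube field_simps)
  finally have "y ^ 3 / 3 - v ^ 3 / 3 \<le> (y - v) * y\<^sup>2" by simp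
  also have "\<dots> \<le> (y - z) * y\<^sup>2" by (intro mult_right_mono) (auto simp: v_def)
  finally show ?thesis using True by (simp add: pos_cube_def pos_square_def v_def)
qed (simp add: pos_cube_def pos_square_def)

text \<open>The integral of the increments telescopes: what remains is the integral of
  \<open>P\<close> over the last \<epsilon> of time minus that over the \<epsilon> before
  \<open>sa\<close>, and the latter is zero.\<close>

lemma continuous_increment_integral:
  fixes P :: "real \<Rightarrow> real"
  assumes P: "continuous_on {s0..s1} P" and t: "s0 \<le> sa - \<epsilon>" "0 < \<epsilon>" "sa \<le> ts - \<epsilon>" "ts \<le> s1"
    and zero: "\<And>t. t \<in> {s0..sa} \<Longrightarrow> P t = 0"
    and ge: "\<And>t. t \<in> {ts - \<epsilon>..ts} \<Longrightarrow> \<kappa> \<le> P t"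
  shows "\<kappa> * \<epsilon> \<le> (LINT t:{sa<..<ts}|lborel. P t - P (t - \<epsilon>))"
proof -
  have c: "continuous_on {x..y} P" if "s0 \<le> x" "y \<le> s1" for x y
    using continuous_on_subset[OF P] that by auto
  have cs: "continuous_on {sa..ts} (\<lambda>t. P (t - \<epsilon>))"
    by (rule continuous_on_compose2[OF P]) (use t in \<open>auto intro!: continuous_intros\<close>)
  have si: "set_integrable lborel {sa..ts} (\<lambda>t. P t - P (t - \<epsilon>))"
    by (rule borel_integrable_atLeastAtMost') (use t in \<open>auto intro!: continuous_intros cs c\<close>)
  have shift: "integral {sa..ts} (\<lambda>t. P (t - \<epsilon>)) = integral {sa - \<epsilon>..ts - \<epsilon>} P"
    using integral_shift[of sa "- \<epsilon>" ts P] c t by (simp add: o_def)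
  have "integral {sa - \<epsilon>..sa} P = 0"
    using zero t by (intro integral_unique has_integral_is_0) auto
  then have 1: "integral {sa - \<epsilon>..ts - \<epsilon>} P = integral {sa..ts - \<epsilon>} P"
    using Henstock_Kurzweil_Integration.integral_combine[of "sa - \<epsilon>" sa "ts - \<epsilon>" P] t
    by (auto simp: integrable_continuous_interval c)
  have 2: "integral {sa..ts} P = integral {sa..ts - \<epsilon>} P + integral {ts - \<epsilon>..ts} P"
    using Henstock_Kurzweil_Integration.integral_combine[of sa "ts - \<epsilon>" ts P] t
    by (auto simp: integrable_continuous_interval c)
  have "\<kappa> * \<epsilon> = integral {ts - \<epsilon>..ts} (\<lambda>_. \<kappa>)" using t by simp
  also have "\<dots> \<le> integral {ts - \<epsilon>..ts} P"
    using ge t by (intro integral_le integrable_continuous_interval c) auto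
  also have "\<dots> = integral {sa..ts} P - integral {sa..ts} (\<lambda>t. P (t - \<epsilon>))"
    using 1 2 shift by simp
  also have "\<dots> = integral {sa..ts} (\<lambda>t. P t - P (t - \<epsilon>))"
    using t by (intro Henstock_Kurzweil_Integration.integral_diff[symmetric] integrable_continuous_interval cs c) auto
  also have "\<dots> = (LINT t:{sa..ts}|lborel. P t - P (t - \<epsilon>))"
    using set_borel_integral_eq_integral(2)[OF si] by simp
  also have "\<dots> = (LINT t:{sa<..<ts}|lborel. P t - P (t - \<epsilon>))"
  proof (rule set_integral_cong_set)
    have m: "set_borel_measurable lborel {sa..ts} (\<lambda>t. P t - P (t - \<epsilon>))"
      using si unfolding set_integrable_def set_borel_measurable_def by blast
    then show "set_borel_measurable lborel {sa<..<ts} (\<lambda>t. P t - P (t - \<epsilon>))"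
      by (rule set_borel_measurable_subset) auto
    show "set_borel_measurable lborel {sa..ts} (\<lambda>t. P t - P (t - \<epsilon>))" by (rule m)
    have "AE s in lborel. s \<noteq> sa" "AE s in lborel. s \<noteq> ts" by (rule AE_lborel_singleton)+
    then show "AE x in lborel. (x \<in> {sa<..<ts}) = (x \<in> {sa..ts})"
      by eventually_elim auto
  qed
  finally show ?thesis .
qed

text \<open>The margin \<eta> makes the positive part of the excess vanish on the lateral sides and
  throughout the strip \<open>[s0, sa]\<close>. Hence the square of that positive part already has
  zero lateral values, and times between \<open>sa\<close> and \<open>ts\<close> moved back by less
  than \<open>sa - s0\<close> stay inside the rectangle.\<close>

locale weak_comparison_box = weak_solution_box +
  fixes a b \<eta> sa ts :: real and \<psi> :: "real \<Rightarrow> real"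
  assumes \<psi>: "\<And>x. (\<psi> has_real_derivative sgn_root p (a * x + b)) (at x)"
    and times: "s0 < sa" "sa < ts" "ts < s1"
    and initial: "\<And>x t. x \<in> {c1..c2} \<Longrightarrow> t \<in> {s0..sa} \<Longrightarrow> h (x, t) - (a * t + \<psi> x) \<le> \<eta>"
    and lateral: "\<And>t. t \<in> {s0..s1} \<Longrightarrow> h (c1, t) - (a * t + \<psi> c1) \<le> \<eta> \<and> h (c2, t) - (a * t + \<psi> c2) \<le> \<eta>"
begin

text \<open>The exact solution has flux \<open>a * x + b\<close>, so \<open>flux_diff\<close> is the
  difference of the two fluxes and \<open>d'\<close> that of the two slopes.
  \<open>test_grad\<close> is the slope of \<open>pos_square (d z)\<close>, cut off in time.\<close>

definition "d z = h z - (a * snd z + \<psi> (fst z)) - \<eta>"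
definition "d' z = gQ z - indicator Q z * sgn_root p (a * fst z + b)"
definition "flux_diff z = flux p (gQ z) - indicator Q z * (a * fst z + b)"
definition "test_grad z = indicator ({c1<..<c2} \<times> {sa<..<ts}) z * (2 * max 0 (d z)) * d' z"
definition "energy t = (LINT x|lborel. indicator {c1<..<c2} x * pos_cube (d (x, t)))"

lemma \<psi>_cont: "continuous_on S \<psi>"
  using \<psi> DERIV_isCont continuous_at_imp_continuous_on by blast

lemma d_cont: "continuous_on ({c1..c2} \<times> {s0..s1}) d"
  unfolding d_def[abs_def]
  by (intro continuous_intros h_cont continuous_on_compose2[OF \<psi>_cont[of UNIV]]) auto

lemma d_slice_cont: "t \<in> {s0..s1} \<Longrightarrow> continuous_on {c1..c2} (\<lambda>x. d (x, t))"
  by (rule continuous_on_compose2[OF d_cont]) (auto intro!: continuous_intros)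

lemma root_cont: "continuous_on S (\<lambda>x. sgn_root p (a * x + b))"
  by (intro continuous_on_compose2[OF continuous_sgn_root[OF p, of UNIV]] continuous_intros) auto

lemma root_measurable [measurable]: "(\<lambda>x. sgn_root p (a * x + b)) \<in> borel_measurable borel"
  by (rule borel_measurable_continuous_onI[OF root_cont])

lemma d'_measurable [measurable]: "d' \<in> borel_measurable plane"
  unfolding d'_def[abs_def] by measurable

lemma indicator_Q_affine_integrable: "integrable plane (\<lambda>z. indicator Q z * (a * fst z + b))"
proof -
  have "integrable plane (\<lambda>z. (indicator {c1<..<c2} (fst z) * (a * fst z + b)) * indicator {s0<..<s1} (snd z))"
  proof (rule integrable_tensor)
    have "set_integrable lborel {c1..c2} (\<lambda>x. a * x + b)"
      by (intro borel_integrable_atLeastAtMost' continuous_intros)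
    then have "set_integrable lborel {c1<..<c2} (\<lambda>x. a * x + b)"
      by (rule set_integrable_subset) auto
    then show "integrable lborel (\<lambda>x. indicator {c1<..<c2} x * (a * x + b))"
      by (simp add: set_integrable_def)
    show "integrable lborel (indicator {s0<..<s1} :: real \<Rightarrow> real)"
      by (rule integrable_real_indicator) (use s01 in auto)
  qed
  moreover have "(indicator {c1<..<c2} (fst z) * (a * fst z + b)) * indicator {s0<..<s1} (snd z) = indicator Q z * (a * fst z + b)" for z :: "real \<times> real"
    by (cases z) (auto simp: indicator_def)
  ultimately show ?thesis by simp
qed

lemma flux_diff_integrable: "integrable plane flux_diff"
  unfolding flux_diff_def[abs_def]
  by (intro Bochner_Integration.integrable_diff integrable_flux_gQ indicator_Q_affine_integrable)

lemma flux_diff_measurable [measurable]: "flux_diff \<in> borel_measurable plane"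
  using flux_diff_integrable by auto

lemma test_grad_measurable [measurable]: "test_grad \<in> borel_measurable plane"
proof -
  let ?E = "{c1<..<c2} \<times> {sa<..<ts}"
  have "?E \<in> sets borel" by (intro borel_open open_Times) auto
  then have "(\<lambda>z. indicator ?E z *\<^sub>R (2 * max 0 (d z))) \<in> borel_measurable borel"
    by (rule borel_measurable_continuous_on_indicator)
      (use times in \<open>auto intro!: continuous_intros continuous_on_subset[OF d_cont]\<close>)
  then have [measurable]: "(\<lambda>z. indicator ?E z * (2 * max 0 (d z))) \<in> borel_measurable plane"
    by (simp add: lborel_prod)
  show ?thesis unfolding test_grad_def[abs_def] by measurable
qed

text \<open>At equal times both factors come from the same pair of slopes, and \<open>flux p\<close>
  is monotone.\<close>

lemma flux_diff_test_grad_nonneg: "0 \<le> flux_diff z * test_grad z"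
proof (cases "z \<in> {c1<..<c2} \<times> {sa<..<ts}")
  case True
  then have "z \<in> Q" using times by auto
  then have "flux_diff z * d' z = (flux p (gQ z) - flux p (sgn_root p (a * fst z + b))) * (gQ z - sgn_root p (a * fst z + b))"
    by (simp add: flux_diff_def d'_def flux_sgn_root[OF p])
  then have "0 \<le> flux_diff z * d' z" using flux_monotone[OF p] by simp
  then have "0 \<le> (2 * max 0 (d z)) * (flux_diff z * d' z)"
    using mult_nonneg_nonneg[of "2 * max 0 (d z)" "flux_diff z * d' z"] by simp
  then show ?thesis using True by (simp add: test_grad_def mult_ac)
qed (simp add: test_grad_def)

text \<open>At different times no sign is available. The terms at \<sigma> and at \<open>t\<close>
  are separated, which is the form that survives averaging in \<sigma>.\<close>

lemma flux_diff_test_grad_bound: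
  obtains c m where "0 \<le> c" "\<And>x \<sigma> t. \<bar>flux_diff (x, \<sigma>) * test_grad (x, t)\<bar> \<le>
    c * (\<bar>gQ (x, \<sigma>)\<bar> powr p + \<bar>gQ (x, t)\<bar> powr p + m powr p * indicator Q (x, t))"
proof -
  have "bounded (d ` ({c1..c2} \<times> {s0..s1}))"
    by (intro compact_imp_bounded compact_continuous_image d_cont compact_Times compact_Icc)
  then obtain K where K: "\<And>z. z \<in> {c1..c2} \<times> {s0..s1} \<Longrightarrow> \<bar>d z\<bar> \<le> K"
    unfolding bounded_iff real_norm_def by blast
  define L where "L = 2 * max 0 K"
  \<comment> \<open>\<open>M\<close> bounds the exact flux and \<open>m\<close> the exact slope. The
    summand \<open>1\<close> keeps \<open>M\<close> positive, so that
    \<open>m powr (p - 1) = M\<close>.\<close>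
  define M where "M = \<bar>a\<bar> * (\<bar>c1\<bar> + \<bar>c2\<bar>) + \<bar>b\<bar> + 1"
  define m where "m = M powr (1 / (p - 1))"
  have "M > 0" by (simp add: M_def add_nonneg_pos)
  then have mp: "m powr (p - 1) = M" "0 \<le> m" using p by (auto simp: m_def powr_powr)
  have affine: "\<bar>a * x + b\<bar> \<le> M" if "x \<in> {c1<..<c2}" for x
  proof -
    have "\<bar>a * x\<bar> \<le> \<bar>a\<bar> * (\<bar>c1\<bar> + \<bar>c2\<bar>)"
      unfolding abs_mult using that by (intro mult_left_mono) auto
    then show ?thesis unfolding M_def by linarith
  qed
  have "\<bar>flux_diff (x, \<sigma>) * test_grad (x, t)\<bar> \<le>
    (4 * L) * (\<bar>gQ (x, \<sigma>)\<bar> powr p + \<bar>gQ (x, t)\<bar> powr p + m powr p * indicator Q (x, t))" for x \<sigma> t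
  proof (cases "(x, t) \<in> {c1<..<c2} \<times> {sa<..<ts}")
    case True
    then have xt: "(x, t) \<in> Q" "x \<in> {c1<..<c2}" using times by auto
    have 1: "\<bar>flux_diff (x, \<sigma>)\<bar> \<le> \<bar>gQ (x, \<sigma>)\<bar> powr (p - 1) + m powr (p - 1)"
    proof -
      have "\<bar>indicator Q (x, \<sigma>) * (a * x + b)\<bar> \<le> M"
        using affine[OF xt(2)] \<open>M > 0\<close> by (auto simp: indicator_def)
      then have "\<bar>flux_diff (x, \<sigma>)\<bar> \<le> \<bar>flux p (gQ (x, \<sigma>))\<bar> + M"
        unfolding flux_diff_def fst_conv by linarith
      then show ?thesis by (simp add: mp abs_flux)
    qed
    have 2: "\<bar>d' (x, t)\<bar> \<le> \<bar>gQ (x, t)\<bar> + m"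
    proof -
      have "\<bar>sgn_root p (a * x + b)\<bar> \<le> m"
        unfolding abs_sgn_root m_def using affine[OF xt(2)] p by (intro powr_mono2) auto
      then show ?thesis using xt(1) by (simp add: d'_def)
    qed
    have 3: "\<bar>2 * max 0 (d (x, t))\<bar> \<le> L"
      using K[of "(x, t)"] xt by (auto simp: L_def max_def abs_le_iff)
    have "L \<ge> 0" by (simp add: L_def)
    have "\<bar>flux_diff (x, \<sigma>) * test_grad (x, t)\<bar> = \<bar>2 * max 0 (d (x, t))\<bar> * (\<bar>flux_diff (x, \<sigma>)\<bar> * \<bar>d' (x, t)\<bar>)"
      using True by (simp add: test_grad_def abs_mult)
    also have "\<dots> \<le> L * ((\<bar>gQ (x, \<sigma>)\<bar> powr (p - 1) + m powr (p - 1)) * (\<bar>gQ (x, t)\<bar> + m))"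
      using 1 2 3 mp \<open>L \<ge> 0\<close> by (intro mult_mono) auto
    also have "\<dots> \<le> L * (4 * (\<bar>gQ (x, \<sigma>)\<bar> powr p + \<bar>gQ (x, t)\<bar> powr p + m powr p))"
      using powr_sum_mult_bound[OF p, of "\<bar>gQ (x, \<sigma>)\<bar>" "\<bar>gQ (x, t)\<bar>" m] mp \<open>L \<ge> 0\<close>
      by (intro mult_left_mono) auto
    finally show ?thesis using xt by (simp add: mult_ac)
  next
    case False
    then have "test_grad (x, t) = 0" by (simp add: test_grad_def)
    then show ?thesis by (simp add: L_def)
  qed
  with that[of "4 * L" m] show ?thesis by (simp add: L_def)
qed

lemma pos_cube_cont: "continuous_on S pos_cube"
  unfolding pos_cube_def[abs_def] by (intro continuous_intros) auto

lemma energy_integrand_integrable: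
  assumes "t \<in> {s0..s1}"
  shows "integrable lborel (\<lambda>x. indicator {c1<..<c2} x * pos_cube (d (x, t)))"
proof -
  have "set_integrable lborel {c1..c2} (\<lambda>x. pos_cube (d (x, t)))"
    by (intro borel_integrable_atLeastAtMost' continuous_on_compose2[OF pos_cube_cont d_slice_cont[OF assms]]) auto
  then have "set_integrable lborel {c1<..<c2} (\<lambda>x. pos_cube (d (x, t)))"
    by (rule set_integrable_subset) auto
  then show ?thesis by (simp add: set_integrable_def)
qed

lemma energy_cont: "continuous_on {s0..s1} energy"
proof -
  have "continuous_on {s0..s1} (\<lambda>t. integral (cbox c1 c2) (\<lambda>x. pos_cube (d (x, t))))"
  proof (rule integral_continuous_on_param)
    show "continuous_on ({s0..s1} \<times> cbox c1 c2) (\<lambda>(t, x). pos_cube (d (x, t)))"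
      unfolding case_prod_unfold
      by (intro continuous_on_compose2[OF pos_cube_cont[of UNIV]] continuous_on_compose2[OF d_cont] continuous_intros) auto
  qed
  moreover have "integral (cbox c1 c2) (\<lambda>x. pos_cube (d (x, t))) = energy t" if t: "t \<in> {s0..s1}" for t
  proof -
    have "integral {c1..c2} (\<lambda>x. pos_cube (d (x, t))) = integral {c1<..<c2} (\<lambda>x. pos_cube (d (x, t)))"
      by (simp add: integral_open_interval_real)
    also have "\<dots> = energy t"
      using set_borel_integral_eq_integral(2)[of "{c1<..<c2}" "\<lambda>x. pos_cube (d (x, t))"] energy_integrand_integrable[OF t]
      by (simp add: set_integrable_def set_lebesgue_integral_def energy_def)
    finally show ?thesis by simp
  qed
  ultimately show ?thesis by (rule continuous_on_eq)
qed

text \<open>As a function of \<open>x\<close>, the flux difference integrated over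
  \<open>[t - \<epsilon>, t]\<close> is a constant plus the primitive of the increment
  \<open>e\<close> of \<open>d\<close>. The test function vanishes at both ends, so the constant
  drops out and integration by parts leaves minus the integral of
  \<open>e * pos_square (d (x, t))\<close>. Convexity compares this with the increment of the
  energy.\<close>

lemma energy_slice_estimate:
  assumes \<epsilon>: "0 < \<epsilon>" "\<epsilon> < sa - s0"
  shows "AE t in lborel. t \<in> {sa<..<ts} \<longrightarrow>
    (LINT x|lborel. (LINT \<sigma>:{t - \<epsilon>..t}|lborel. flux_diff (x, \<sigma>)) * test_grad (x, t))
      \<le> - (energy t - energy (t - \<epsilon>))"
  using slice_absolutely_continuous
proof eventually_elim
  case (elim t)
  show ?case
  proof
    assume t: "t \<in> {sa<..<ts}"
    define s where "s = t - \<epsilon>"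
    have s: "s0 < s" "s \<le> t" "t < s1" using t times \<epsilon> by (auto simp: s_def)
    have ts: "t \<in> {s0<..<s1}" "t \<in> {s0..s1}" "s \<in> {s0..s1}" "s \<in> {s0<..<s1}"
      using t times s by auto
    obtain C where gi: "integrable lborel (\<lambda>x. gQ (x, t))"
      and C: "\<And>x. x \<in> {c1..c2} \<Longrightarrow> h (x, t) = C + prim (\<lambda>x. gQ (x, t)) x"
      using elim ts by blast
    have I: "integrable lborel (\<lambda>x. indicator {c1<..<c2} x * f x)" if "continuous_on {c1..c2} f" for f :: "real \<Rightarrow> real"
    proof -
      have "set_integrable lborel {c1<..<c2} f"
        by (rule set_integrable_subset[OF borel_integrable_atLeastAtMost'[OF that]]) auto
      then show ?thesis by (simp add: set_integrable_def)
    qed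
    define e where "e x = indicator {c1<..<c2} x * (d (x, t) - d (x, s))" for x
    define \<zeta> where "\<zeta> x = test_grad (x, t)" for x
    have ie: "integrable lborel e"
      unfolding e_def[abs_def] by (intro I continuous_intros d_slice_cont ts)
    have d't: "d' (x, t) = gQ (x, t) - indicator {c1<..<c2} x * sgn_root p (a * x + b)" for x
      using ts by (auto simp: d'_def indicator_def)
    have id': "integrable lborel (\<lambda>x. d' (x, t))"
      unfolding d't by (intro Bochner_Integration.integrable_diff gi I root_cont)
    have dC: "d (x, t) = (C - a * t - \<psi> c1 - \<eta>) + prim (\<lambda>x. d' (x, t)) x" if "x \<in> {c1..c2}" for x
      unfolding d't prim_linear[OF gi I[OF root_cont]] prim_of_derivative[OF \<psi> root_cont that]
      using C[OF that] by (simp add: d_def)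
    have chain: "integrable lborel (\<lambda>s. indicator {c1..x} s * (2 * max 0 (d (s, t))) * d' (s, t)) \<and>
        pos_square (d (x, t)) - pos_square (d (c1, t)) = (LINT s:{c1..<x}|lborel. 2 * max 0 (d (s, t)) * d' (s, t))"
      if "x \<in> {c1..c2}" for x
    proof -
      have "continuous_on UNIV (\<lambda>y::real. 2 * max 0 y)" by (intro continuous_intros)
      moreover have "c1 \<le> x" using that by simp
      moreover have "d (y, t) = (C - a * t - \<psi> c1 - \<eta>) + prim (\<lambda>x. d' (x, t)) y" if "y \<in> {c1..x}" for y
        using dC[of y] that \<open>x \<in> {c1..c2}\<close> by simp
      ultimately show ?thesis
        using chain_rule_prim[OF id', of c1 x "\<lambda>x. d (x, t)" _ pos_square "\<lambda>y. 2 * max 0 y"] DERIV_pos_square by blast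
    qed
    have d'0: "d' (x, t) = 0" if "x \<notin> {c1<..<c2}" for x
      using that by (auto simp: d'_def gQ_def indicator_def)
    have \<zeta>_eq: "\<zeta> x = indicator {c1..c2} x * (2 * max 0 (d (x, t))) * d' (x, t)" for x
      using t d'0[of x] by (cases "x \<in> {c1<..<c2}") (auto simp: \<zeta>_def test_grad_def)
    have i\<zeta>: "integrable lborel \<zeta>"
      unfolding \<zeta>_eq[abs_def] using chain[of c2] c12 by auto
    have prim\<zeta>: "prim \<zeta> x = pos_square (d (x, t))" if x: "x \<in> {c1..c2}" for x
    proof -
      have "prim \<zeta> x = (LINT s:{c1..<x}|lborel. 2 * max 0 (d (s, t)) * d' (s, t))"
        unfolding prim_def set_lebesgue_integral_def
        by (intro Bochner_Integration.integral_cong) (use x in \<open>auto simp: \<zeta>_eq indicator_def\<close>)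
      also have "\<dots> = pos_square (d (x, t)) - pos_square (d (c1, t))" using chain[OF x] by simp
      also have "pos_square (d (c1, t)) = 0"
        using lateral[of t] ts by (simp add: pos_square_def d_def)
      finally show ?thesis by simp
    qed
    \<comment> \<open>The positive part of \<open>d\<close> is zero at \<open>c1\<close> and
      \<open>c2\<close>. This removes the unknown constant \<open>C2\<close> as well as the boundary
      term of the integration by parts.\<close>
    have int\<zeta>: "(LINT x|lborel. \<zeta> x) = 0"
    proof -
      have "(LINT x|lborel. \<zeta> x) = prim \<zeta> c2"
        unfolding prim_def set_lebesgue_integral_def
        by (intro Bochner_Integration.integral_cong) (auto simp: \<zeta>_eq indicator_def d'0)
      also have "\<dots> = 0"
        using prim\<zeta>[of c2] c12 lateral[of t] ts by (simp add: pos_square_def d_def)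
      finally show ?thesis .
    qed
    obtain C1 where C1: "AE x in lborel. x \<in> {c1<..<c2} \<longrightarrow>
        (LINT \<sigma>:{s..t}|lborel. flux p (gQ (x, \<sigma>))) = C1 + prim (\<lambda>x. hQ (x, t) - hQ (x, s)) x"
      using time_flux_absolutely_continuous[OF s] by blast
    \<comment> \<open>Over the time \<epsilon> the exact flux integrates to
      \<open>\<epsilon> * (a * x + b)\<close>. Its value at \<open>c1\<close> joins the constant;
      the rest, \<open>\<epsilon> * a * (x - c1)\<close>, is absorbed by
      \<open>prim e\<close>.\<close>
    define C2 where "C2 = C1 - \<epsilon> * (a * c1 + b)"
    have pe: "prim e x = prim (\<lambda>x. hQ (x, t) - hQ (x, s)) x - \<epsilon> * a * (x - c1)" if "x \<in> {c1..c2}" for x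
    proof -
      have "e = (\<lambda>x. (hQ (x, t) - hQ (x, s)) - indicator {c1<..<c2} x * (\<epsilon> * a))"
        using ts by (auto simp: fun_eq_iff e_def hQ_def d_def indicator_def s_def algebra_simps)
      then have "prim e x = prim (\<lambda>x. hQ (x, t) - hQ (x, s)) x - prim (\<lambda>x. indicator {c1<..<c2} x * (\<epsilon> * a)) x"
        by (simp only:) (intro prim_linear Bochner_Integration.integrable_diff integrable_slice I continuous_intros)
      also have "prim (\<lambda>x. indicator {c1<..<c2} x * (\<epsilon> * a)) x = \<epsilon> * a * x - \<epsilon> * a * c1"
        by (rule prim_of_derivative[OF _ _ that]) (auto intro!: derivative_eq_intros continuous_intros)
      finally show ?thesis by (simp add: algebra_simps)
    qed
    have AEb: "AE x in lborel. x \<in> {c1<..<c2} \<longrightarrow> (LINT \<sigma>:{s..t}|lborel. flux_diff (x, \<sigma>)) = C2 + prim e x"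
      using C1 lborel_pair.AE_integrable_fst'[OF integrable_flux_gQ]
    proof eventually_elim
      case (elim x)
      show ?case
      proof
        assume x: "x \<in> {c1<..<c2}"
        have "(LINT \<sigma>:{s..t}|lborel. flux_diff (x, \<sigma>)) = (LINT \<sigma>:{s..t}|lborel. flux p (gQ (x, \<sigma>)) - (a * x + b))"
          unfolding set_lebesgue_integral_def
          by (intro Bochner_Integration.integral_cong) (use x ts in \<open>auto simp: flux_diff_def indicator_def\<close>)
        also have "\<dots> = (LINT \<sigma>:{s..t}|lborel. flux p (gQ (x, \<sigma>))) - (LINT \<sigma>:{s..t}|lborel. a * x + b)"
          by (rule set_integral_diff(2)[OF set_integrable_lborel[OF elim(2)] borel_integrable_atLeastAtMost'])
            (auto intro!: continuous_intros)
        also have "(LINT \<sigma>:{s..t}|lborel. a * x + b) = \<epsilon> * (a * x + b)"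
          using s by (simp add: set_integral_const s_def)
        finally show "(LINT \<sigma>:{s..t}|lborel. flux_diff (x, \<sigma>)) = C2 + prim e x"
          using elim x pe[of x] by (simp add: C2_def algebra_simps)
      qed
    qed
    have ipe: "integrable lborel (\<lambda>x. prim e x * \<zeta> x)"
      by (rule integrable_bounded_mult(1)[OF i\<zeta> _ abs_prim_le[OF ie]]) (use ie in measurable)
    have [measurable]: "\<zeta> \<in> borel_measurable borel" "e \<in> borel_measurable borel"
      using i\<zeta> ie by auto
    have im: "(\<lambda>x. LINT \<sigma>:{s..t}|lborel. flux_diff (x, \<sigma>)) \<in> borel_measurable borel"
      unfolding set_lebesgue_integral_def by measurable
    have "(LINT x|lborel. (LINT \<sigma>:{s..t}|lborel. flux_diff (x, \<sigma>)) * \<zeta> x) = (LINT x|lborel. C2 * \<zeta> x + prim e x * \<zeta> x)"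
    proof (rule integral_cong_AE)
      show "AE x in lborel. (LINT \<sigma>:{s..t}|lborel. flux_diff (x, \<sigma>)) * \<zeta> x = C2 * \<zeta> x + prim e x * \<zeta> x"
        using AEb
      proof eventually_elim
        case (elim x)
        then show ?case
          using d'0[of x] by (cases "x \<in> {c1<..<c2}") (auto simp: \<zeta>_eq distrib_right)
      qed
    qed (use im in measurable)
    also have "\<dots> = (LINT x|lborel. prim e x * \<zeta> x)"
      using i\<zeta> ipe int\<zeta> by simp
    also have "\<dots> = - (LINT x|lborel. e x * prim \<zeta> x)"
      using integral_by_parts_prim[OF ie i\<zeta>] int\<zeta> by simp
    also have "\<dots> \<le> - (energy t - energy s)"
    proof -
      have "energy t - energy s = (LINT x|lborel. indicator {c1<..<c2} x * pos_cube (d (x, t)) - indicator {c1<..<c2} x * pos_cube (d (x, s)))"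
        unfolding energy_def using energy_integrand_integrable ts by simp
      also have "\<dots> \<le> (LINT x|lborel. e x * prim \<zeta> x)"
      proof (rule integral_mono)
        show "integrable lborel (\<lambda>x. e x * prim \<zeta> x)"
          by (rule integrable_bounded_mult(2)[OF ie _ abs_prim_le[OF i\<zeta>]]) measurable
        show "indicator {c1<..<c2} x * pos_cube (d (x, t)) - indicator {c1<..<c2} x * pos_cube (d (x, s)) \<le> e x * prim \<zeta> x" for x
          using pos_cube_convex[of "d (x, t)" "d (x, s)"] prim\<zeta>[of x]
          by (cases "x \<in> {c1<..<c2}") (auto simp: e_def)
      qed (intro Bochner_Integration.integrable_diff energy_integrand_integrable ts)
      finally show ?thesis by simp
    qed
    finally show "(LINT x|lborel. (LINT \<sigma>:{t - \<epsilon>..t}|lborel. flux_diff (x, \<sigma>)) * test_grad (x, t)) \<le> - (energy t - energy (t - \<epsilon>))"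
      by (simp add: \<zeta>_def s_def)
  qed
qed

lemma energy_nonneg: "0 \<le> energy t"
  unfolding energy_def by (intro integral_nonneg_AE) (auto simp: pos_cube_def)

lemma energy_initial: "t \<in> {s0..sa} \<Longrightarrow> energy t = 0"
proof -
  assume t: "t \<in> {s0..sa}"
  have z: "indicator {c1<..<c2} x * pos_cube (d (x, t)) = 0" for x
    using initial[OF _ t, of x] by (auto simp: indicator_def pos_cube_def d_def)
  show ?thesis unfolding energy_def z by simp
qed

text \<open>If the final energy were positive, integrating the slice estimate in time would bound
  the averaged pairing of flux difference and test gradient by \<open>- \<kappa>\<close> for all
  small \<epsilon>. Monotonicity of the flux, through \<open>average_pairing_limit\<close>, yields
  an \<epsilon> for which the pairing is larger.\<close>

theorem energy_final: "energy ts = 0"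
proof (rule ccontr)
  assume "energy ts \<noteq> 0"
  define \<kappa> where "\<kappa> = energy ts / 2"
  have \<kappa>: "0 < \<kappa>" "\<kappa> < energy ts" using energy_nonneg[of ts] \<open>energy ts \<noteq> 0\<close> by (auto simp: \<kappa>_def)
  have "\<exists>r>0. \<forall>t\<in>{s0..s1}. \<bar>t - ts\<bar> < r \<longrightarrow> \<bar>energy t - energy ts\<bar> < energy ts - \<kappa>"
    using energy_cont \<kappa> times unfolding continuous_on_iff dist_real_def by simp
  then obtain r where r: "r > 0" "\<And>t. t \<in> {s0..s1} \<Longrightarrow> \<bar>t - ts\<bar> < r \<Longrightarrow> \<bar>energy t - energy ts\<bar> < energy ts - \<kappa>"
    by blast
  \<comment> \<open>Below \<open>r\<close> the energy exceeds \<kappa> during the last \<epsilon> of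
    time, below \<open>sa - s0\<close> the averages stay in the rectangle, and below
    \<open>ts - sa\<close> that last piece of time begins after \<open>sa\<close>.\<close>
  define \<epsilon>0 where "\<epsilon>0 = min r (min (sa - s0) (ts - sa)) / 2"
  define \<epsilon> where "\<epsilon> n = \<epsilon>0 / real (Suc n)" for n
  have \<epsilon>0: "0 < \<epsilon>0" "\<epsilon>0 < r" "\<epsilon>0 < sa - s0" "\<epsilon>0 < ts - sa" using r times by (auto simp: \<epsilon>0_def min_def)
  have \<epsilon>pos: "0 < \<epsilon> n" "\<epsilon> n \<le> \<epsilon>0" for n using \<epsilon>0 by (auto simp: \<epsilon>_def field_simps)
  have \<epsilon>lim: "\<epsilon> \<longlonglongrightarrow> 0"
    unfolding \<epsilon>_def using LIMSEQ_inverse_real_of_nat[THEN tendsto_mult_right_zero, of \<epsilon>0] by (simp add: divide_inverse)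
  obtain c m where c: "0 \<le> c" "\<And>x \<sigma> t. \<bar>flux_diff (x, \<sigma>) * test_grad (x, t)\<bar> \<le>
    c * (\<bar>gQ (x, \<sigma>)\<bar> powr p + \<bar>gQ (x, t)\<bar> powr p + m powr p * indicator Q (x, t))"
    by (rule flux_diff_test_grad_bound) (rule that)
  have iN: "integrable plane (\<lambda>z. m powr p * indicator Q z)" using integrable_Q by simp
  note lim = average_pairing_limit[OF test_grad_measurable integrable_gQ_powr _ iN _ flux_diff_integrable c(2,1)
      flux_diff_test_grad_nonneg \<epsilon>lim \<epsilon>pos(1) \<kappa>(1)]
  define f where "f n z = (LINT \<sigma>:{snd z - \<epsilon> n..snd z}|lborel. flux_diff (fst z, \<sigma>)) / \<epsilon> n * test_grad z" for n z
  have f: "integrable plane (f n)" for n unfolding f_def[abs_def] by (rule lim(1)) auto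
  have "\<exists>n. (LINT z|plane. f n z) > - \<kappa>" unfolding f_def by (rule lim(2)) auto
  then obtain n where n: "(LINT z|plane. f n z) > - \<kappa>" by blast
  have e: "\<epsilon> n < sa - s0" using \<epsilon>0 \<epsilon>pos[of n] by simp
  have i1: "integrable lborel (\<lambda>t. LINT x|lborel. f n (x, t))"
    using lborel_pair.integrable_snd[of "\<lambda>x t. f n (x, t)"] f[of n] by simp
  have si: "set_integrable lborel {sa<..<ts} (\<lambda>t. energy t - energy (t - \<epsilon> n))"
  proof (rule set_integrable_subset[of _ "{sa..ts}"])
    show "set_integrable lborel {sa..ts} (\<lambda>t. energy t - energy (t - \<epsilon> n))"
      by (rule borel_integrable_atLeastAtMost')
        (use times e \<epsilon>pos[of n] in \<open>auto intro!: continuous_intros continuous_on_subset[OF energy_cont] continuous_on_compose2[OF energy_cont]\<close>)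
  qed auto
  have "(LINT z|plane. f n z) = (LINT t|lborel. LINT x|lborel. f n (x, t))"
    using lborel_pair.integral_snd[of "\<lambda>x t. f n (x, t)"] f[of n] by simp
  also have "\<dots> \<le> (LINT t|lborel. - (1 / \<epsilon> n) * (indicator {sa<..<ts} t * (energy t - energy (t - \<epsilon> n))))"
  proof (rule integral_mono_AE[OF i1])
    show "integrable lborel (\<lambda>t. - (1 / \<epsilon> n) * (indicator {sa<..<ts} t * (energy t - energy (t - \<epsilon> n))))"
      using si unfolding set_integrable_def by (intro Bochner_Integration.integrable_mult_right) simp
    show "AE t in lborel. (LINT x|lborel. f n (x, t)) \<le> - (1 / \<epsilon> n) * (indicator {sa<..<ts} t * (energy t - energy (t - \<epsilon> n)))"
      using energy_slice_estimate[OF \<epsilon>pos(1)[of n] e]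
    proof eventually_elim
      case (elim t)
      have "(LINT x|lborel. f n (x, t)) = (LINT x|lborel. (LINT \<sigma>:{t - \<epsilon> n..t}|lborel. flux_diff (x, \<sigma>)) * test_grad (x, t)) / \<epsilon> n"
        unfolding f_def by simp
      then show ?case
      proof (cases "t \<in> {sa<..<ts}")
        case True
        with elim \<epsilon>pos(1)[of n] have "(LINT x|lborel. (LINT \<sigma>:{t - \<epsilon> n..t}|lborel. flux_diff (x, \<sigma>)) * test_grad (x, t)) / \<epsilon> n
            \<le> - (energy t - energy (t - \<epsilon> n)) / \<epsilon> n"
          by (intro divide_right_mono) auto
        then show ?thesis using True by (simp add: f_def diff_divide_distrib)
      next
        case False
        then show ?thesis by (simp add: f_def test_grad_def)
      qed
    qed
  qed
  also have "\<dots> = - (1 / \<epsilon> n) * (LINT t:{sa<..<ts}|lborel. energy t - energy (t - \<epsilon> n))"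
    by (simp add: set_lebesgue_integral_def)
  also have "\<dots> \<le> - (1 / \<epsilon> n) * (\<kappa> * \<epsilon> n)"
  proof (rule mult_left_mono_neg)
    show "\<kappa> * \<epsilon> n \<le> (LINT t:{sa<..<ts}|lborel. energy t - energy (t - \<epsilon> n))"
    proof (rule continuous_increment_integral[OF energy_cont])
      fix t assume "t \<in> {ts - \<epsilon> n..ts}"
      then have "t \<in> {s0..s1}" "\<bar>t - ts\<bar> < r" using times \<epsilon>0 \<epsilon>pos[of n] by auto
      from r(2)[OF this] show "\<kappa> \<le> energy t" by linarith
    qed (use times \<epsilon>0 \<epsilon>pos[of n] energy_initial in auto)
  qed (use \<epsilon>pos[of n] in auto)
  also have "\<dots> = - \<kappa>" using \<epsilon>pos(1)[of n] by simp
  finally show False using n by simp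
qed

theorem comparison:
  assumes "x \<in> {c1..c2}"
  shows "h (x, ts) - (a * ts + \<psi> x) \<le> \<eta>"
proof -
  have ts: "ts \<in> {s0..s1}" using times by simp
  have "AE x in lborel. indicator {c1<..<c2} x * pos_cube (d (x, ts)) = 0"
    using energy_final integral_nonneg_eq_0_iff_AE[OF energy_integrand_integrable[OF ts]]
    unfolding energy_def by (auto simp: pos_cube_def)
  then have "AE x in lborel. x \<in> {c1<..<c2} \<longrightarrow> pos_cube (d (x, ts)) = 0"
    by eventually_elim auto
  from AE_eq_imp_eq_on_interval[OF c12 _ _ this assms]
  have "pos_cube (d (x, ts)) = 0"
    by (auto intro!: continuous_on_compose2[OF pos_cube_cont[of UNIV] d_slice_cont[OF ts]])
  then show ?thesis by (auto simp: pos_cube_def d_def max_def split: if_splits)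
qed

end

subsection \<open>Comparison with exact solutions\<close>

lemma closure_open_rectangle:
  fixes x1 x2 t1 t2 :: real
  assumes "x1 < x2" "t1 < t2"
  shows "closure ({x1<..<x2} \<times> {t1<..<t2}) = {x1..x2} \<times> {t1..t2}"
  using assms by (simp add: closure_Times)

text \<open>By uniform continuity the excess is at most \<eta> in a thin layer along the sides and
  the bottom. The energy estimate is applied on a rectangle compactly inside, whose sides and
  initial strip lie in that layer. Then \<eta> tends to \<open>0\<close>, and the final time is
  reached by continuity.\<close>

lemma p_parabolic_comparison:
  fixes h :: "real \<times> real \<Rightarrow> real"
  assumes p: "1 < p" and x12: "x1 < x2" and t12: "t1 < t2"
    and par: "p_parabolic p ({x1<..<x2} \<times> {t1<..<t2}) h"
    and cont: "continuous_on ({x1..x2} \<times> {t1..t2}) h"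
    and \<psi>: "\<And>x. (\<psi> has_real_derivative sgn_root p (a * x + b)) (at x)"
    and bottom: "\<And>x. x \<in> {x1..x2} \<Longrightarrow> h (x, t1) \<le> a * t1 + \<psi> x"
    and sides: "\<And>t. t \<in> {t1..t2} \<Longrightarrow> h (x1, t) \<le> a * t + \<psi> x1 \<and> h (x2, t) \<le> a * t + \<psi> x2"
    and z: "x \<in> {x1..x2}" "t \<in> {t1..t2}"
  shows "h (x, t) \<le> a * t + \<psi> x"
proof -
  have \<psi>_cont: "continuous_on S \<psi>" for S
    using \<psi> DERIV_isCont continuous_at_imp_continuous_on by blast
  define w where "w z = h z - (a * snd z + \<psi> (fst z))" for z
  have w_cont: "continuous_on ({x1..x2} \<times> {t1..t2}) w"
    unfolding w_def[abs_def]
    by (intro continuous_intros cont continuous_on_compose2[OF \<psi>_cont[of UNIV]]) auto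
  have small: "w (x, t) \<le> \<eta>" if \<eta>: "\<eta> > 0" and x: "x \<in> {x1..x2}" and t: "t \<in> {t1<..<t2}" for \<eta> x t
  proof -
    have "uniformly_continuous_on ({x1..x2} \<times> {t1..t2}) w"
      by (intro compact_uniformly_continuous w_cont compact_Times compact_Icc)
    then obtain r where r: "r > 0" "\<And>z z'. z \<in> {x1..x2} \<times> {t1..t2} \<Longrightarrow> z' \<in> {x1..x2} \<times> {t1..t2} \<Longrightarrow>
        dist z' z < r \<Longrightarrow> \<bar>w z' - w z\<bar> < \<eta>"
      unfolding uniformly_continuous_on_def dist_real_def using \<eta> by metis
    define \<rho> where "\<rho> = min (r / 3) (min ((x2 - x1) / 4) ((t - t1) / 4))"
    have \<rho>: "0 < \<rho>" "2 * \<rho> < r" "2 * \<rho> < x2 - x1" "2 * \<rho> < t - t1"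
    proof -
      show "0 < \<rho>" using r(1) x12 t by (auto simp: \<rho>_def)
      have "\<rho> \<le> r / 3" "\<rho> \<le> (x2 - x1) / 4" "\<rho> \<le> (t - t1) / 4" unfolding \<rho>_def by linarith+
      then show "2 * \<rho> < r" "2 * \<rho> < x2 - x1" "2 * \<rho> < t - t1" using r(1) x12 t by simp_all
    qed
    have left: "w (y, s) \<le> \<eta>" if "x1 \<le> y" "y \<le> x1 + \<rho>" "s \<in> {t1..t2}" for y s
    proof -
      have "\<bar>w (y, s) - w (x1, s)\<bar> < \<eta>"
        using that \<rho> x12 by (intro r(2)) (auto simp: dist_Pair_Pair dist_real_def)
      then show ?thesis using sides[OF that(3)] unfolding w_def fst_conv snd_conv by linarith
    qed
    have right: "w (y, s) \<le> \<eta>" if "y \<le> x2" "x2 - \<rho> \<le> y" "s \<in> {t1..t2}" for y s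
    proof -
      have "\<bar>w (y, s) - w (x2, s)\<bar> < \<eta>"
        using that \<rho> x12 by (intro r(2)) (auto simp: dist_Pair_Pair dist_real_def)
      then show ?thesis using sides[OF that(3)] unfolding w_def fst_conv snd_conv by linarith
    qed
    have low: "w (y, s) \<le> \<eta>" if "y \<in> {x1..x2}" "t1 \<le> s" "s \<le> t1 + 2 * \<rho>" for y s
    proof -
      have "\<bar>w (y, s) - w (y, t1)\<bar> < \<eta>"
        using that \<rho> t by (intro r(2)) (auto simp: dist_Pair_Pair dist_real_def)
      then show ?thesis using bottom[OF that(1)] unfolding w_def fst_conv snd_conv by linarith
    qed
    \<comment> \<open>The bottom layer has thickness \<open>2 * \<rho>\<close> and the rectangle
      starts in its middle, so \<open>[s0, t1 + 2 * \<rho>]\<close> is an initial strip with small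
      excess. \<open>s1\<close> leaves room above \<open>t\<close> and below
      \<open>t2\<close>.\<close>
    define c1 c2 s0 s1 where "c1 = x1 + \<rho>" and "c2 = x2 - \<rho>" and "s0 = t1 + \<rho>" and "s1 = (t + t2) / 2"
    have c: "c1 < c2" "s0 < t1 + 2 * \<rho>" "t1 + 2 * \<rho> < t" "t < s1" "s1 < t2"
      using \<rho> t by (auto simp: c1_def c2_def s0_def s1_def)
    have sub: "{c1..c2} \<times> {s0..s1} \<subseteq> {x1<..<x2} \<times> {t1<..<t2}"
      using c \<rho> by (auto simp: c1_def c2_def s0_def)
    have "compactly_in ({c1<..<c2} \<times> {s0<..<s1}) ({x1<..<x2} \<times> {t1<..<t2})"
      unfolding compactly_in_def using sub c by (simp add: closure_open_rectangle compact_Times)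
    moreover have "s0 < s1" using c by linarith
    ultimately obtain g where g: "Lp_W1p p {c1<..<c2} s0 s1 h g"
      "\<And>\<phi>. \<phi> \<in> test_functions ({c1<..<c2} \<times> {s0<..<s1}) \<Longrightarrow>
          (LINT z:{c1<..<c2} \<times> {s0<..<s1}|lborel. (norm (g z) powr (p - 2) *\<^sub>R g z) \<bullet> space_grad \<phi> z)
          - (LINT z:{c1<..<c2} \<times> {s0<..<s1}|lborel. h z * time_deriv \<phi> z) = 0"
      using par unfolding p_parabolic_def by (meson open_greaterThanLessThan)
    interpret weak_comparison_box p c1 c2 s0 s1 h g a b \<eta> "t1 + 2 * \<rho>" t \<psi>
    proof
      show "continuous_on ({c1..c2} \<times> {s0..s1}) h"
        by (rule continuous_on_subset[OF cont]) (use sub in auto)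
      show "h (y, s) - (a * s + \<psi> y) \<le> \<eta>" if "y \<in> {c1..c2}" "s \<in> {s0..t1 + 2 * \<rho>}" for y s
        using low[of y s] that \<rho> by (auto simp: w_def c1_def c2_def s0_def)
      show "h (c1, s) - (a * s + \<psi> c1) \<le> \<eta> \<and> h (c2, s) - (a * s + \<psi> c2) \<le> \<eta>" if "s \<in> {s0..s1}" for s
        using left[of c1 s] right[of c2 s] that \<rho> c by (auto simp: w_def c1_def c2_def s0_def)
    qed (use p c g \<psi> in auto)
    show "w (x, t) \<le> \<eta>"
      using comparison[of x] left[of x t] right[of x t] x t
      by (cases "x < c1"; cases "x > c2") (auto simp: w_def[of "(x, t)"] c1_def c2_def)
  qed
  have inner: "w (x, t) \<le> 0" if "x \<in> {x1..x2}" "t \<in> {t1<..<t2}" for x t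
    by (rule field_le_epsilon) (use small that in auto)
  have "w (x, t) \<le> 0"
  proof (rule continuous_le_on_closure[where S = "{t1<..<t2}" and f = "\<lambda>t. w (x, t)"])
    show "continuous_on (closure {t1<..<t2}) (\<lambda>t. w (x, t))"
      using z t12 by (auto intro!: continuous_on_compose2[OF w_cont] continuous_intros)
  qed (use inner z t12 in auto)
  then show ?thesis by (simp add: w_def)
qed

section \<open>Exact solutions are \<open>p\<close>-parabolic\<close>

lemma Lp_on_continuous:
  fixes f :: "'b::euclidean_space \<Rightarrow> real"
  assumes "continuous_on UNIV f" "S \<in> sets borel" "bounded S" "0 < p"
  shows "Lp_on p S f"
proof -
  have [measurable]: "f \<in> borel_measurable borel" by (rule borel_measurable_continuous_onI[OF assms(1)])
  have "continuous_on UNIV (\<lambda>x. norm (f x) powr p)"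
    using assms by (intro continuous_on_powr' continuous_intros) auto
  moreover have "compact (closure S)" using assms by simp
  ultimately have "set_integrable lborel (closure S) (\<lambda>x. norm (f x) powr p)"
    unfolding set_integrable_def by (intro borel_integrable_compact) (auto intro: continuous_on_subset)
  then have "set_integrable lborel S (\<lambda>x. norm (f x) powr p)"
    by (rule set_integrable_subset) (use assms closure_subset in auto)
  then show ?thesis
    using assms by (auto simp: Lp_on_def set_borel_measurable_def)
qed

lemma set_integrable_continuous_bounded:
  fixes f :: "'b::euclidean_space \<Rightarrow> real"
  assumes "continuous_on UNIV f" "S \<in> sets borel" "bounded S"
  shows "set_integrable lborel S f"
proof -
  have "compact (closure S)" using assms by simp
  then have "set_integrable lborel (closure S) f"
    unfolding set_integrable_def using assms(1) by (intro borel_integrable_compact) (auto intro: continuous_on_subset)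
  then show ?thesis
    by (rule set_integrable_subset) (use assms closure_subset in auto)
qed

lemma integrable_continuous_compact_support:
  fixes f :: "'b::euclidean_space \<Rightarrow> real"
  assumes "continuous_on UNIV f" "compact K" "\<And>x. x \<notin> K \<Longrightarrow> f x = 0"
  shows "integrable lborel f"
proof -
  have "(\<lambda>x. indicator K x *\<^sub>R f x) = f"
    using assms(3) by (auto simp: indicator_def fun_eq_iff)
  then show ?thesis
    using borel_integrable_compact[OF assms(2) continuous_on_subset[OF assms(1)]] by auto
qed

lemma integration_by_parts_compact_support:
  fixes k k' f f' :: "real \<Rightarrow> real"
  assumes k: "\<And>x. (k has_real_derivative k' x) (at x)" "continuous_on UNIV k'"
    and f: "\<And>x. (f has_real_derivative f' x) (at x)" "continuous_on UNIV f'"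
    and K: "compact K" "\<And>x. x \<notin> K \<Longrightarrow> f x = 0" "\<And>x. x \<notin> K \<Longrightarrow> f' x = 0"
  shows "(LINT x|lborel. k x * f' x) = - (LINT x|lborel. k' x * f x)"
proof -
  have ck: "continuous_on UNIV k" and cf: "continuous_on UNIV f"
    using k f DERIV_isCont continuous_at_imp_continuous_on by blast+
  obtain R where R: "\<And>x. x \<in> K \<Longrightarrow> \<bar>x\<bar> \<le> R" "0 < R"
    using compact_imp_bounded[OF K(1)] unfolding bounded_pos by auto
  have i1: "integrable lborel (\<lambda>x. k x * f' x)" and i2: "integrable lborel (\<lambda>x. k' x * f x)"
    using K by (auto intro!: integrable_continuous_compact_support[OF _ K(1)] continuous_intros ck cf f k)
  have "(LINT x|lborel. k x * f' x) + (LINT x|lborel. k' x * f x) = (LINT x|lborel. k x * f' x + k' x * f x)"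
    using i1 i2 by simp
  also have "\<dots> = (LINT x:{- R - 1..R + 1}|lborel. k x * f' x + k' x * f x)"
    unfolding set_lebesgue_integral_def
  proof (intro Bochner_Integration.integral_cong refl)
    fix x
    show "k x * f' x + k' x * f x = indicator {- R - 1..R + 1} x *\<^sub>R (k x * f' x + k' x * f x)"
      using R(1)[of x] K(2,3)[of x] by (cases "x \<in> K") (auto simp: indicator_def)
  qed
  also have "\<dots> = k (R + 1) * f (R + 1) - k (- R - 1) * f (- R - 1)"
  proof -
    have "((\<lambda>x. k x * f x) has_real_derivative k x * f' x + k' x * f x) (at x)" for x
      by (auto intro!: derivative_eq_intros k f)
    moreover have "continuous_on {- R - 1..R + 1} (\<lambda>x. k x * f' x + k' x * f x)"
      by (intro continuous_intros continuous_on_subset[OF ck] continuous_on_subset[OF cf]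
          continuous_on_subset[OF f(2)] continuous_on_subset[OF k(2)]) auto
    ultimately show ?thesis
      using integral_FTC_Icc[of "- R - 1" "R + 1" "\<lambda>x. k x * f x" "\<lambda>x. k x * f' x + k' x * f x"] R(2)
      by (simp add: has_real_derivative_iff_has_vector_derivative[symmetric] has_field_derivative_at_within set_lebesgue_integral_def)
  qed
  also have "\<dots> = 0"
  proof -
    have "R + 1 \<notin> K" "- R - 1 \<notin> K" using R(1)[of "R + 1"] R(1)[of "- R - 1"] R(2) by auto
    then show ?thesis using K(2) by simp
  qed
  finally show ?thesis by simp
qed

lemma test_function_C1:
  fixes \<phi> :: "'a::euclidean_space \<Rightarrow> real"
  assumes "\<phi> \<in> test_functions S"
  obtains G K where "\<And>x. GDERIV \<phi> x :> G x" "\<And>b. b \<in> Basis \<Longrightarrow> continuous_on UNIV (\<lambda>x. G x \<bullet> b)"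
    "compact K" "K \<subseteq> S" "\<And>x. x \<notin> K \<Longrightarrow> \<phi> x = 0" "\<And>x. x \<notin> K \<Longrightarrow> G x = 0"
proof -
  define K where "K = closure {x. \<phi> x \<noteq> 0}"
  have K: "compact K" "K \<subseteq> S" using assms by (auto simp: test_functions_def K_def)
  have "C_k (Suc 0) \<phi>" using assms by (auto simp: test_functions_def)
  then obtain G where G: "\<And>x. GDERIV \<phi> x :> G x" "\<And>b. b \<in> Basis \<Longrightarrow> continuous_on UNIV (\<lambda>x. G x \<bullet> b)"
    by auto
  have 0: "\<phi> x = 0" if "x \<notin> K" for x
    using that closure_subset[of "{x. \<phi> x \<noteq> 0}"] by (auto simp: K_def)
  have "G x = 0" if "x \<notin> K" for x
  proof -
    have o: "open (- K)" using K(1) compact_imp_closed by blast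
    have "(\<phi> has_derivative (\<lambda>h. h \<bullet> G x)) (at x)" using G(1)[of x] by (simp add: gderiv_def)
    then have "((\<lambda>x. 0) has_derivative (\<lambda>h. h \<bullet> G x)) (at x)"
      by (rule has_derivative_transform_within_open[OF _ o]) (use that 0 in auto)
    then have "(\<lambda>h. h \<bullet> G x) = (\<lambda>h. 0)"
      using has_derivative_const has_derivative_unique by blast
    then have "G x \<bullet> G x = 0" by (rule fun_cong)
    then show ?thesis by simp
  qed
  with G K 0 show ?thesis by (rule that)
qed

text \<open>The flux \<open>a * x + b\<close> is smooth even where \<psi> has no second derivative.
  Integration by parts in \<open>x\<close> turns the first term into \<open>- a\<close> times the
  integral of \<phi>; integration by parts in \<open>t\<close> gives the same value for the
  second.\<close>

lemma p_parabolic_exact: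
  fixes \<Theta> :: "(real \<times> real) set"
  assumes p: "1 < p" and \<psi>: "\<And>x. (\<psi> has_real_derivative sgn_root p (a * x + b)) (at x)"
  shows "p_parabolic p \<Theta> (\<lambda>z. a * snd z + \<psi> (fst z))"
proof -
  let ?H = "\<lambda>z. a * snd z + \<psi> (fst z)"
  let ?g = "\<lambda>z::real \<times> real. sgn_root p (a * fst z + b)"
  have \<psi>_cont: "continuous_on S \<psi>" for S
    using \<psi> DERIV_isCont continuous_at_imp_continuous_on by blast
  have root_cont: "continuous_on S (\<lambda>x. sgn_root p (a * x + b))" for S
    by (intro continuous_on_compose2[OF continuous_sgn_root[OF p, of UNIV]] continuous_intros) auto
  have H_cont: "continuous_on S ?H" for S
    by (intro continuous_intros continuous_on_compose2[OF \<psi>_cont[of UNIV]]) auto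
  have g_cont: "continuous_on S ?g" for S
    by (intro continuous_intros continuous_on_compose2[OF root_cont[of UNIV]]) auto
  show ?thesis
    unfolding p_parabolic_def
  proof (intro conjI allI impI H_cont, goal_cases)
    case (1 U t1 t2)
    then have U: "open U" "t1 < t2" and c: "compact (closure (U \<times> {t1<..<t2}))"
      by (auto simp: compactly_in_def)
    have bUT: "bounded (U \<times> {t1<..<t2})" using c by simp
    have bU: "bounded U"
      by (rule bounded_subset[OF bounded_fst[OF bUT]]) (use U in force)
    have U_sets [measurable]: "U \<in> sets borel" using U by auto
    have s1: "set_integrable lborel U (\<lambda>x. \<psi> x ^ 2)" "set_integrable lborel U \<psi>" "set_integrable lborel U (\<lambda>x. 1 :: real)"
      by (intro set_integrable_continuous_bounded U_sets bU continuous_intros \<psi>_cont)+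
    \<comment> \<open>Expanding the square shows a polynomial in \<open>t\<close>, hence the
      required continuity in time.\<close>
    have "(LINT x:U|lborel. \<bar>?H (x, t)\<bar>\<^sup>2) =
      (LINT x:U|lborel. \<psi> x ^ 2) + ((2 * a * t) * (LINT x:U|lborel. \<psi> x) + (a * t)^2 * (LINT x:U|lborel. 1))" for t
    proof -
      have "(LINT x:U|lborel. \<bar>?H (x, t)\<bar>\<^sup>2) = (LINT x:U|lborel. \<psi> x ^ 2 + ((2 * a * t) * \<psi> x + (a * t)^2 * 1))"
        by (simp add: power2_eq_square algebra_simps)
      also have "\<dots> = (LINT x:U|lborel. \<psi> x ^ 2) + (LINT x:U|lborel. (2 * a * t) * \<psi> x + (a * t)^2 * 1)"
        by (intro set_integral_add s1 set_integrable_mult_right)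
      also have "(LINT x:U|lborel. (2 * a * t) * \<psi> x + (a * t)^2 * 1) = (LINT x:U|lborel. (2 * a * t) * \<psi> x) + (LINT x:U|lborel. (a * t)^2 * 1)"
        by (intro set_integral_add s1 set_integrable_mult_right)
      finally show ?thesis by (simp only: set_integral_mult_right)
    qed
    then show ?case by (simp only:) (intro continuous_intros)
  next
    case (2 U t1 t2)
    then have U: "open U" "t1 < t2" and c: "compact (closure (U \<times> {t1<..<t2}))"
      by (auto simp: compactly_in_def)
    let ?S = "U \<times> {t1<..<t2}"
    have bUT: "bounded ?S" using c by simp
    have bU: "bounded U"
      by (rule bounded_subset[OF bounded_fst[OF bUT]]) (use U in force)
    have sets: "U \<in> sets borel" "?S \<in> sets borel"
      using U by (auto intro!: borel_open open_Times)
    have W: "W1p_on p U (\<lambda>x. ?H (x, t)) (\<lambda>x. ?g (x, t))" for t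
      unfolding W1p_on_def
    proof (intro conjI ballI)
      show "Lp_on p U (\<lambda>x. ?H (x, t))" "Lp_on p U (\<lambda>x. ?g (x, t))"
        using p by (auto intro!: Lp_on_continuous sets bU continuous_intros \<psi>_cont root_cont)
      fix \<phi> assume \<phi>: "\<phi> \<in> test_functions U"
      obtain G K where G: "\<And>x. GDERIV \<phi> x :> G x" "\<And>b. b \<in> Basis \<Longrightarrow> continuous_on UNIV (\<lambda>x. G x \<bullet> b)"
        and K: "compact K" "K \<subseteq> U" "\<And>x. x \<notin> K \<Longrightarrow> \<phi> x = 0" "\<And>x. x \<notin> K \<Longrightarrow> G x = 0"
        by (rule test_function_C1[OF \<phi>]) (rule that)
      have DG: "(\<phi> has_real_derivative G x) (at x)" for x
        using G(1)[of x] by (simp add: gderiv_def has_field_derivative_def mult_commute_abs)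
      have cG: "continuous_on UNIV G" using G(2)[of 1] by simp
      have "(LINT x:U|lborel. ?H (x, t) *\<^sub>R grad \<phi> x) = (LINT x|lborel. (a * t + \<psi> x) * G x)"
        unfolding set_lebesgue_integral_def
        by (intro Bochner_Integration.integral_cong refl) (use K in \<open>auto simp: grad_real_eq[OF DG] indicator_def\<close>)
      also have "\<dots> = - (LINT x|lborel. sgn_root p (a * x + b) * \<phi> x)"
        by (rule integration_by_parts_compact_support[OF _ root_cont DG cG K(1,3,4)]) (auto intro!: derivative_eq_intros \<psi>)
      also have "(LINT x|lborel. sgn_root p (a * x + b) * \<phi> x) = (LINT x:U|lborel. \<phi> x *\<^sub>R ?g (x, t))"
        unfolding set_lebesgue_integral_def
        by (intro Bochner_Integration.integral_cong refl) (use K in \<open>auto simp: indicator_def\<close>)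
      finally show "(LINT x:U|lborel. ?H (x, t) *\<^sub>R grad \<phi> x) = - (LINT x:U|lborel. \<phi> x *\<^sub>R ?g (x, t))" .
    qed
    have "Lp_W1p p U t1 t2 ?H ?g"
      unfolding Lp_W1p_def using p W
      by (auto intro!: Lp_on_continuous sets bUT H_cont g_cont)
    moreover have "(LINT z:?S|lborel. (norm (?g z) powr (p - 2) *\<^sub>R ?g z) \<bullet> space_grad \<phi> z)
        - (LINT z:?S|lborel. ?H z * time_deriv \<phi> z) = 0" if \<phi>: "\<phi> \<in> test_functions ?S" for \<phi>
    proof -
      obtain G K where G: "\<And>x. GDERIV \<phi> x :> G x" "\<And>b. b \<in> Basis \<Longrightarrow> continuous_on UNIV (\<lambda>x. G x \<bullet> b)"
        and K: "compact K" "K \<subseteq> ?S" "\<And>x. x \<notin> K \<Longrightarrow> \<phi> x = 0" "\<And>x. x \<notin> K \<Longrightarrow> G x = 0"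
        by (rule test_function_C1[OF \<phi>]) (rule that)
      have offS: "G z = 0" if "z \<notin> ?S" for z using that K(2,4) by blast
      have c1: "continuous_on UNIV (\<lambda>z. fst (G z))" and c2: "continuous_on UNIV (\<lambda>z. snd (G z))"
        using G(2)[of "(1, 0)"] G(2)[of "(0, 1)"] by (auto simp: Basis_prod_def inner_prod_def)
      have der: "(\<phi> has_derivative (\<lambda>h. h \<bullet> G z)) (at z)" for z using G(1)[of z] by (simp add: gderiv_def)
      have cx: "continuous_on UNIV (\<lambda>x. fst (G (x, t)))" for t
        by (rule continuous_on_compose2[OF c1]) (auto intro!: continuous_intros)
      have ct: "continuous_on UNIV (\<lambda>t. snd (G (x, t)))" for x
        by (rule continuous_on_compose2[OF c2]) (auto intro!: continuous_intros)
      have c0: "continuous_on UNIV \<phi>"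
        using der has_derivative_continuous continuous_at_imp_continuous_on by blast
      have Dx: "((\<lambda>x. \<phi> (x, t)) has_real_derivative fst (G (x, t))) (at x)" for x t
        using has_derivative_compose[OF has_derivative_Pair[OF has_derivative_ident has_derivative_const] der[of "(x, t)"]]
        by (simp add: has_field_derivative_def inner_prod_def mult_commute_abs)
      have Dt: "((\<lambda>t. \<phi> (x, t)) has_real_derivative snd (G (x, t))) (at t)" for x t
        using has_derivative_compose[OF has_derivative_Pair[OF has_derivative_const has_derivative_ident] der[of "(x, t)"]]
        by (simp add: has_field_derivative_def inner_prod_def mult_commute_abs)
      have sg: "space_grad \<phi> z = fst (G z)" for z
        unfolding space_grad_def using grad_real_eq[OF Dx[of "snd z" "fst z"]] by simp
      have td: "time_deriv \<phi> z = snd (G z)" for z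
        unfolding time_deriv_def using DERIV_imp_deriv[OF Dt[of "fst z" "snd z"]] by simp
      have K1: "compact (fst ` K)" "compact (snd ` K)"
        using K(1) by (auto intro!: compact_continuous_image continuous_intros)
      have out: "\<phi> (x, t) = 0 \<and> G (x, t) = 0" if "x \<notin> fst ` K \<or> t \<notin> snd ` K" for x t
      proof -
        have "(x, t) \<notin> K" using that by force
        then show ?thesis using K by simp
      qed
      have i0: "integrable (lborel \<Otimes>\<^sub>M lborel) \<phi>"
        unfolding lborel_prod by (rule integrable_continuous_compact_support[OF c0 K(1,3)])
      have i1: "integrable (lborel \<Otimes>\<^sub>M lborel) (\<lambda>z. (a * fst z + b) * fst (G z))"
        unfolding lborel_prod using K
        by (intro integrable_continuous_compact_support[OF _ K(1)] continuous_intros c1) auto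
      have i2: "integrable (lborel \<Otimes>\<^sub>M lborel) (\<lambda>z. ?H z * snd (G z))"
        unfolding lborel_prod using K
        by (intro integrable_continuous_compact_support[OF _ K(1)] continuous_intros H_cont c2
            continuous_on_compose2[OF \<psi>_cont[of UNIV]]) auto
      have "(LINT z:?S|lborel. (norm (?g z) powr (p - 2) *\<^sub>R ?g z) \<bullet> space_grad \<phi> z) = (LINT z|(lborel \<Otimes>\<^sub>M lborel). (a * fst z + b) * fst (G z))"
        unfolding set_lebesgue_integral_def lborel_prod
      proof (intro Bochner_Integration.integral_cong refl)
        fix z :: "real \<times> real"
        have "norm (?g z) powr (p - 2) * ?g z = a * fst z + b"
          using flux_sgn_root[OF p, of "a * fst z + b"] by (simp add: flux_def)
        then show "indicator ?S z *\<^sub>R ((norm (?g z) powr (p - 2) *\<^sub>R ?g z) \<bullet> space_grad \<phi> z) = (a * fst z + b) * fst (G z)"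
          using offS[of z] by (cases "z \<in> ?S") (simp_all add: sg)
      qed
      also have "\<dots> = (LINT t|lborel. LINT x|lborel. (a * x + b) * fst (G (x, t)))"
        using lborel_pair.integral_snd[of "\<lambda>x t. (a * x + b) * fst (G (x, t))"] i1 by (simp add: case_prod_unfold)
      also have "\<dots> = (LINT t|lborel. - (LINT x|lborel. a * \<phi> (x, t)))"
      proof (intro Bochner_Integration.integral_cong refl)
        fix t
        show "(LINT x|lborel. (a * x + b) * fst (G (x, t))) = - (LINT x|lborel. a * \<phi> (x, t))"
          by (rule integration_by_parts_compact_support[OF _ _ Dx cx K1(1)])
            (use out in \<open>auto intro!: derivative_eq_intros\<close>)
      qed
      also have "\<dots> = - a * (LINT z|(lborel \<Otimes>\<^sub>M lborel). \<phi> z)"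
        using lborel_pair.integral_snd[of "\<lambda>x t. \<phi> (x, t)"] i0 by simp
      finally have 1: "(LINT z:?S|lborel. (norm (?g z) powr (p - 2) *\<^sub>R ?g z) \<bullet> space_grad \<phi> z) = - a * (LINT z|(lborel \<Otimes>\<^sub>M lborel). \<phi> z)" .
      have "(LINT z:?S|lborel. ?H z * time_deriv \<phi> z) = (LINT z|(lborel \<Otimes>\<^sub>M lborel). ?H z * snd (G z))"
        unfolding set_lebesgue_integral_def lborel_prod
      proof (intro Bochner_Integration.integral_cong refl)
        fix z show "indicator ?S z *\<^sub>R (?H z * time_deriv \<phi> z) = ?H z * snd (G z)"
          using offS[of z] by (cases "z \<in> ?S") (simp_all add: td)
      qed
      also have "\<dots> = (LINT x|lborel. LINT t|lborel. (a * t + \<psi> x) * snd (G (x, t)))"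
        using lborel_pair.integral_fst[of "\<lambda>x t. (a * t + \<psi> x) * snd (G (x, t))"] i2 by (simp add: case_prod_unfold)
      also have "\<dots> = (LINT x|lborel. - (LINT t|lborel. a * \<phi> (x, t)))"
      proof (intro Bochner_Integration.integral_cong refl)
        fix x
        show "(LINT t|lborel. (a * t + \<psi> x) * snd (G (x, t))) = - (LINT t|lborel. a * \<phi> (x, t))"
          by (rule integration_by_parts_compact_support[OF _ _ Dt ct K1(2)])
            (use out in \<open>auto intro!: derivative_eq_intros\<close>)
      qed
      also have "\<dots> = - a * (LINT z|(lborel \<Otimes>\<^sub>M lborel). \<phi> z)"
        using lborel_pair.integral_fst[of "\<lambda>x t. \<phi> (x, t)"] i0 by simp
      finally show ?thesis using 1 by simp
    qed
    ultimately show ?case by blast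
  qed
qed

lemma exact_solution_exists:
  assumes "1 < p"
  obtains \<psi> where "\<And>x. (\<psi> has_real_derivative sgn_root p (a * x + b)) (at x)" "\<psi> x0 = (0::real)"
proof -
  have "continuous_on UNIV (\<lambda>x. sgn_root p (a * x + b))"
    by (intro continuous_on_compose2[OF continuous_sgn_root[OF assms, of UNIV]] continuous_intros) auto
  then obtain F where F: "\<And>x. (F has_real_derivative sgn_root p (a * x + b)) (at x)"
    by (rule antiderivative_exists) (rule that)
  show ?thesis
    by (rule that[of "\<lambda>x. F x - F x0"]) (auto intro!: derivative_eq_intros F)
qed

section \<open>Superparabolic functions above exact solutions\<close>

lemma Liminf_antimono_filter:
  fixes f :: "'a \<Rightarrow> 'b :: complete_linorder"
  assumes "F \<le> F'"
  shows "Liminf F' f \<le> Liminf F f"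
  unfolding le_Liminf_iff using assms by (auto dest!: less_LiminfD intro: filter_leD)

text \<open>\<open>A\<close> need not be closed. At points of \<open>K\<close> outside
  \<open>A\<close> the value of \<open>f\<close> is replaced by \<open>M\<close>, which exceeds some
  value on \<open>A\<close>, so the infimum cannot escape to them. Were it not attained, finitely
  many neighbourhoods with lower bounds above the infimum would cover \<open>K\<close>.\<close>

lemma lsc_attains_Inf:
  fixes f :: "'a::topological_space \<Rightarrow> ereal"
  assumes K: "compact K" and A: "A \<subseteq> K" "A \<noteq> {}"
    and lsc: "\<And>\<xi> c. \<xi> \<in> K \<Longrightarrow> (\<xi> \<in> A \<Longrightarrow> c < f \<xi>) \<Longrightarrow> (\<xi> \<notin> A \<Longrightarrow> c < M) \<Longrightarrow>
      \<exists>N. open N \<and> \<xi> \<in> N \<and> (\<forall>y\<in>N \<inter> A. c \<le> f y)"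
    and less: "z \<in> A" "f z < M"
  obtains \<xi> where "\<xi> \<in> A" "\<And>y. y \<in> A \<Longrightarrow> f \<xi> \<le> f y"
proof -
  define I where "I = (INF y\<in>A. f y)"
  have "\<exists>\<xi>\<in>A. f \<xi> = I"
  proof (rule ccontr)
    assume no: "\<not> ?thesis"
    have IM: "I < M"
      unfolding I_def using INF_lower[OF less(1), of f] less(2) by (rule le_less_trans)
    have "\<exists>N c. open N \<and> \<xi> \<in> N \<and> I < c \<and> (\<forall>y\<in>N \<inter> A. c \<le> f y)" if \<xi>: "\<xi> \<in> K" for \<xi>
    proof -
      have "I < (if \<xi> \<in> A then f \<xi> else M)"
        using no IM INF_lower[of \<xi> A f] by (auto simp: I_def less_le)
      then obtain c where c: "I < c" "c < (if \<xi> \<in> A then f \<xi> else M)" using dense by blast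
      then have "\<exists>N. open N \<and> \<xi> \<in> N \<and> (\<forall>y\<in>N \<inter> A. c \<le> f y)"
        by (intro lsc \<xi>) (auto split: if_splits)
      then show ?thesis using c by blast
    qed
    then obtain N c where N: "\<And>\<xi>. \<xi> \<in> K \<Longrightarrow> open (N \<xi>) \<and> \<xi> \<in> N \<xi> \<and> I < c \<xi> \<and> (\<forall>y\<in>N \<xi> \<inter> A. c \<xi> \<le> f y)"
      by metis
    have N1: "\<And>\<xi>. \<xi> \<in> K \<Longrightarrow> open (N \<xi>)" and N2: "K \<subseteq> (\<Union>\<xi>\<in>K. N \<xi>)" using N by auto
    obtain D where D: "D \<subseteq> K" "finite D" "K \<subseteq> (\<Union>\<xi>\<in>D. N \<xi>)"
      by (rule compactE_image[OF K N1 N2], assumption, rule that)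
    have "D \<noteq> {}" using D A by auto
    have "Min (c ` D) \<le> f y" if y: "y \<in> A" for y
    proof -
      obtain \<xi> where "\<xi> \<in> D" "y \<in> N \<xi>" using D(3) A(1) y by blast
      then have "c \<xi> \<le> f y" using N[of \<xi>] D(1) y by blast
      then show ?thesis using \<open>\<xi> \<in> D\<close> D(2) by (intro order_trans[OF Min_le]) auto
    qed
    then have "Min (c ` D) \<le> I" unfolding I_def by (intro INF_greatest)
    moreover have "I < Min (c ` D)" using D \<open>D \<noteq> {}\<close> N by (subst Min_gr_iff) auto
    ultimately show False by simp
  qed
  then obtain \<xi> where "\<xi> \<in> A" "f \<xi> = I" by blast
  then show ?thesis using that[of \<xi>] INF_lower[of _ A f] by (simp add: I_def)
qed

text \<open>If \<open>u\<close> dropped below the exact solution \<open>a t + \<psi> x\<close>, then \<open>u\<close> minus the strict subsolution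
  \<open>(a - \<eta>) t + \<psi> x\<close> would have a negative minimum. At the minimum point an exact solution of time
  slope \<open>a - \<eta> / 2\<close> and the same flux touches from below and beats \<open>u\<close> in a small box.\<close>

lemma superparabolic_comparison:
  fixes \<Theta> G :: "(real \<times> real) set" and u :: "real \<times> real \<Rightarrow> ereal"
  assumes p: "1 < p" and super: "p_superparabolic p \<Theta> u"
    and G: "open G" "bounded G" "G \<subseteq> \<Theta>"
    and \<psi>: "\<And>x. (\<psi> has_real_derivative sgn_root p (a * x + b)) (at x)"
    and boundary: "\<And>\<xi>. \<xi> \<in> frontier G \<Longrightarrow> snd \<xi> \<le> T \<Longrightarrow>
      ereal (a * snd \<xi> + \<psi> (fst \<xi>)) \<le> Liminf (at \<xi> within G) u"
    and z0: "z0 \<in> G" "snd z0 \<le> T"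
  shows "ereal (a * snd z0 + \<psi> (fst z0)) \<le> u z0"
proof (rule ccontr)
  assume "\<not> ?thesis"
  then have less: "u z0 < ereal (a * snd z0 + \<psi> (fst z0))" by simp
  have u_minf: "u z \<noteq> -\<infinity>" if "z \<in> G" for z
    using super that G(3) by (auto simp: p_superparabolic_def)
  have u_lsc: "u z \<le> Liminf (at z within G) u" if "z \<in> G" for z
  proof -
    have "u z \<le> Liminf (at z within \<Theta>) u"
      using super that G(3) by (auto simp: p_superparabolic_def)
    also have "\<dots> \<le> Liminf (at z within G) u"
      by (rule Liminf_antimono_filter[OF at_le[OF G(3)]])
    finally show ?thesis .
  qed
  have \<psi>_cont: "continuous_on S \<psi>" for S
    using \<psi> DERIV_isCont continuous_at_imp_continuous_on by blast
  obtain R where R: "\<And>z. z \<in> closure G \<Longrightarrow> norm z \<le> R"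
    using bounded_closure[OF G(2)] unfolding bounded_iff by blast
  have tR: "\<bar>snd z\<bar> \<le> R" if "z \<in> closure G" for z
    using R[OF that] norm_snd_le[of "snd z" "fst z"] by simp
  have z0c: "z0 \<in> closure G" using z0 closure_subset by blast
  have "0 \<le> R" using tR[OF z0c] by linarith
  obtain r0 where r0: "u z0 = ereal r0" using less u_minf[OF z0(1)] by (cases "u z0") auto
  \<comment> \<open>The penalty \<open>\<eta> * (snd z + R)\<close> is nonnegative on the closure of
    \<open>G\<close>, and at \<open>z0\<close> it is at most half of the gap between
    \<open>u\<close> and the exact solution; so \<open>v\<close> still exceeds \<open>u\<close>
    there.\<close>
  define \<eta> where "\<eta> = (a * snd z0 + \<psi> (fst z0) - r0) / (2 * (2 * R + 1))"
  have \<eta>: "\<eta> > 0" using less r0 \<open>0 \<le> R\<close> by (simp add: \<eta>_def)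
  define v where "v z = a * snd z + \<psi> (fst z) - \<eta> * (snd z + R)" for z
  have v_cont: "continuous_on S v" for S
    unfolding v_def[abs_def] by (intro continuous_intros continuous_on_compose2[OF \<psi>_cont[of UNIV]]) auto
  have v_le: "v z \<le> a * snd z + \<psi> (fst z)" if "z \<in> closure G" for z
    using tR[OF that] \<eta> by (simp add: v_def)
  have vz0: "r0 < v z0"
  proof -
    have "\<eta> * (snd z0 + R) \<le> \<eta> * (2 * R + 1)" using tR[OF z0c] \<eta> by (intro mult_left_mono) auto
    also have "\<dots> = (a * snd z0 + \<psi> (fst z0) - r0) / 2"
    proof -
      have half: "x / (2 * k) * k = x / 2" if "k \<noteq> 0" for x k :: real using that by simp
      show ?thesis unfolding \<eta>_def by (rule half) (use \<open>0 \<le> R\<close> in linarith)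
    qed
    finally show ?thesis using less r0 by (simp add: v_def)
  qed
  define A where "A = {z \<in> G. snd z \<le> T}"
  define K where "K = closure G \<inter> {z. snd z \<le> T}"
  define f where "f z = u z - ereal (v z)" for z
  have fc: "c < f z \<longleftrightarrow> ereal (c' + v z) < u z" if "c = ereal c'" for c c' z
    unfolding f_def that by (cases "u z") auto
  have "closed {z :: real \<times> real. snd z \<le> T}" by (intro closed_Collect_le continuous_intros)
  then have K: "compact K"
    unfolding K_def using G(2) by (intro compact_Int_closed) auto
  have AK: "A \<subseteq> K" "z0 \<in> A" using z0 closure_subset[of G] by (auto simp: A_def K_def)
  \<comment> \<open>The level prescribed outside \<open>A\<close> is \<open>0\<close>: at the
    frontier \<open>u\<close> is asymptotically above the exact solution, hence above
    \<open>v\<close>.\<close>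
  obtain z1 where z1: "z1 \<in> A" "\<And>y. y \<in> A \<Longrightarrow> f z1 \<le> f y"
  proof (rule lsc_attains_Inf[OF K AK(1), of f "0::ereal" z0])
    fix \<xi> c
    assume \<xi>: "\<xi> \<in> K" and cA: "\<xi> \<in> A \<Longrightarrow> c < f \<xi>" and cM: "\<xi> \<notin> A \<Longrightarrow> c < 0"
    show "\<exists>N. open N \<and> \<xi> \<in> N \<and> (\<forall>y\<in>N \<inter> A. c \<le> f y)"
    proof -
      have xiG: "\<xi> \<in> A \<longleftrightarrow> \<xi> \<in> G" using \<xi> by (auto simp: A_def K_def)
      have "c < (if \<xi> \<in> A then f \<xi> else 0)" using cA cM by auto
      then obtain c' where c': "c < ereal c'" "ereal c' < (if \<xi> \<in> A then f \<xi> else 0)"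
        using ereal_dense2 by blast
      have "ereal (c' + v \<xi>) < Liminf (at \<xi> within G) u"
      proof (cases "\<xi> \<in> A")
        case True
        then have "ereal (c' + v \<xi>) < u \<xi>" using c'(2) fc by auto
        then show ?thesis using u_lsc xiG True by (meson less_le_trans)
      next
        case False
        then have "\<xi> \<in> frontier G" using \<xi> xiG G(1) by (simp add: frontier_def interior_open K_def)
        then have "ereal (a * snd \<xi> + \<psi> (fst \<xi>)) \<le> Liminf (at \<xi> within G) u"
          using boundary \<xi> by (simp add: K_def)
        moreover have "c' + v \<xi> < a * snd \<xi> + \<psi> (fst \<xi>)"
          using c'(2) False v_le[of \<xi>] \<xi> by (simp add: K_def zero_ereal_def)
        ultimately show ?thesis by (meson less_ereal.simps(1) less_le_trans)
      qed
      then obtain c1 where c1: "ereal (c' + v \<xi>) < ereal c1" "ereal c1 < Liminf (at \<xi> within G) u"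
        using ereal_dense2 by blast
      have "eventually (\<lambda>y. ereal c1 < u y) (at \<xi> within G)"
        using c1(2) less_LiminfD by blast
      moreover have "eventually (\<lambda>y. v y < c1 - c') (at \<xi> within G)"
      proof (rule order_tendstoD(2))
        show "(v \<longlongrightarrow> v \<xi>) (at \<xi> within G)"
          using continuous_at_imp_continuous_at_within[of \<xi> v G] v_cont[of UNIV]
            continuous_on_eq_continuous_at[OF open_UNIV, of v] by (auto simp only: continuous_within)
        show "v \<xi> < c1 - c'" using c1(1) by simp
      qed
      ultimately have "eventually (\<lambda>y. ereal c' < f y) (at \<xi> within G)"
      proof eventually_elim
        case (elim y)
        then have "ereal (c' + v y) < ereal c1" by simp
        then show ?case unfolding fc[OF refl] using elim(1) by (rule less_trans)
      qed
      then obtain N where N: "open N" "\<xi> \<in> N" "\<And>y. y \<in> N \<Longrightarrow> y \<noteq> \<xi> \<Longrightarrow> y \<in> G \<Longrightarrow> ereal c' < f y"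
        unfolding eventually_at_topological by blast
      have "c \<le> f y" if "y \<in> N \<inter> A" for y
      proof (cases "y = \<xi>")
        case True
        then show ?thesis using that cA by (auto intro: less_imp_le)
      next
        case False
        then have "ereal c' < f y" using N(3)[of y] that by (auto simp: A_def)
        then show ?thesis using c'(1) by simp
      qed
      then show ?thesis using N by blast
    qed
  qed (use AK r0 vz0 in \<open>auto simp: f_def\<close>)
  have fz1: "f z1 < 0"
  proof -
    have "f z1 \<le> f z0" by (rule z1(2)[OF AK(2)])
    also have "\<dots> < 0" using r0 vz0 by (simp add: f_def)
    finally show ?thesis .
  qed
  have z1G: "z1 \<in> G" "snd z1 \<le> T" using z1(1) by (auto simp: A_def)
  obtain r1 where r1: "u z1 = ereal r1" using fz1 u_minf[OF z1G(1)] by (cases "u z1") (auto simp: f_def)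
  define m where "m = r1 - v z1"
  have u_ge: "ereal (v y + m) \<le> u y" if "y \<in> A" for y
    using z1(2)[OF that] r1 by (cases "u y") (auto simp: f_def m_def)
  define x1 t1 where "x1 = fst z1" and "t1 = snd z1"
  have z1_eq: "z1 = (x1, t1)" by (simp add: x1_def t1_def)
  \<comment> \<open>Halfway between \<open>a\<close> and the time slope \<open>a - \<eta>\<close> of
    \<open>v\<close>. The constant term in the next line makes the two fluxes agree at
    \<open>x1\<close>; as \<open>a2 < a\<close>, the difference \<open>D\<close> of the profiles has
    a strict minimum there.\<close>
  define a2 where "a2 = a - \<eta> / 2"
  obtain \<psi>2 where \<psi>2: "\<And>x. (\<psi>2 has_real_derivative sgn_root p (a2 * x + (a * x1 + b - a2 * x1))) (at x)" "\<psi>2 x1 = 0"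
    by (rule exact_solution_exists[OF p]) (rule that)
  define D where "D x = (\<psi> x - \<psi> x1) - \<psi>2 x" for x
  have DD: "(D has_real_derivative sgn_root p (a * x + b) - sgn_root p (a2 * x + (a * x1 + b - a2 * x1))) (at x)" for x
    unfolding D_def by (auto intro!: derivative_eq_intros \<psi> \<psi>2)
  have D1: "D x1 = 0" using \<psi>2 by (simp add: D_def)
  have slope: "(a * x + b) - (a2 * x + (a * x1 + b - a2 * x1)) = (\<eta> / 2) * (x - x1)" for x
    by (simp add: a2_def algebra_simps)
  have D_pos: "0 < D x" if "x \<noteq> x1" for x
  proof (cases "x1 < x")
    case True
    obtain y where y: "x1 < y" "y < x" "D x - D x1 = (x - x1) * (sgn_root p (a * y + b) - sgn_root p (a2 * y + (a * x1 + b - a2 * x1)))"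
      using MVT2[OF True DD] by blast
    have "a2 * y + (a * x1 + b - a2 * x1) < a * y + b"
      using slope[of y] mult_pos_pos[of "\<eta> / 2" "y - x1"] y \<eta> by linarith
    from sgn_root_strict_mono[OF p this] show ?thesis using y D1 True by simp
  next
    case False
    then have "x < x1" using that by simp
    obtain y where y: "x < y" "y < x1" "D x1 - D x = (x1 - x) * (sgn_root p (a * y + b) - sgn_root p (a2 * y + (a * x1 + b - a2 * x1)))"
      using MVT2[OF \<open>x < x1\<close> DD] by blast
    have "a * y + b < a2 * y + (a * x1 + b - a2 * x1)"
      using slope[of y] mult_pos_neg[of "\<eta> / 2" "y - x1"] y \<eta> by linarith
    from sgn_root_strict_mono[OF p this]
    have "D x1 - D x < 0" unfolding y(3) using \<open>x < x1\<close> by (intro mult_pos_neg) auto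
    then show ?thesis using D1 by simp
  qed
  have D_nonneg: "0 \<le> D x" for x using D_pos[of x] D1 by (cases "x = x1") auto
  obtain r where r: "r > 0" "{x1 - r..x1 + r} \<times> {t1 - r..t1 + r} \<subseteq> G"
  proof -
    obtain e where e: "e > 0" "ball z1 e \<subseteq> G" using G(1) z1G openE by blast
    have "{x1 - e/3..x1 + e/3} \<times> {t1 - e/3..t1 + e/3} \<subseteq> ball z1 e"
    proof
      fix z assume z: "z \<in> {x1 - e/3..x1 + e/3} \<times> {t1 - e/3..t1 + e/3}"
      have "dist z1 z \<le> \<bar>x1 - fst z\<bar> + \<bar>t1 - snd z\<bar>"
        using norm_Pair_le[of "x1 - fst z" "t1 - snd z"] by (simp add: z1_eq dist_norm minus_prod_def)
      also have "\<dots> < e" using z e(1) by (cases z) (auto simp: abs_le_iff abs_if)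
      finally show "z \<in> ball z1 e" by simp
    qed
    then show ?thesis using that[of "e/3"] e by auto
  qed
  \<comment> \<open>\<open>H\<close> will exceed \<open>u\<close> at \<open>z1\<close> by \<delta>.
    This must be less than what \<open>H - v\<close> gains between the times \<open>t1 - r\<close>
    and \<open>t1\<close>, and less than \<open>D\<close> at both sides of the box.\<close>
  define \<delta> where "\<delta> = min (\<eta> / 2 * r) (min (D (x1 - r)) (D (x1 + r))) / 2"
  have \<delta>: "0 < \<delta>" "\<delta> < \<eta> / 2 * r" "\<delta> < D (x1 - r)" "\<delta> < D (x1 + r)"
  proof -
    define l where "l = min (\<eta> / 2 * r) (min (D (x1 - r)) (D (x1 + r)))"
    have l: "0 < l" using D_pos[of "x1 - r"] D_pos[of "x1 + r"] \<eta> r(1) by (simp add: l_def)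
    have "\<delta> = l / 2" "l \<le> \<eta> / 2 * r" "l \<le> D (x1 - r)" "l \<le> D (x1 + r)"
      by (simp_all add: \<delta>_def l_def)
    with l show "0 < \<delta>" "\<delta> < \<eta> / 2 * r" "\<delta> < D (x1 - r)" "\<delta> < D (x1 + r)" by linarith+
  qed
  define C where "C = v z1 + m + \<delta> - a2 * t1"
  define H where "H z = a2 * snd z + (\<psi>2 (fst z) + C)" for z
  have H_par: "p_parabolic p S H" for S
    unfolding H_def by (rule p_parabolic_exact[OF p]) (auto intro!: derivative_eq_intros \<psi>2)
  have \<psi>2_cont: "continuous_on S \<psi>2" for S
    using \<psi>2(1) DERIV_isCont continuous_at_imp_continuous_on by blast
  have H_cont: "continuous_on S H" for S
    unfolding H_def[abs_def] by (intro continuous_intros continuous_on_compose2[OF \<psi>2_cont[of UNIV]]) auto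
  have H_eq: "H (x, t) = v (x, t) + m + \<delta> + (\<eta> / 2) * (t - t1) - D x" for x t
    by (simp add: H_def v_def D_def C_def a2_def z1_eq field_simps)
  have inA: "(x, t) \<in> A" if "x \<in> {x1 - r..x1 + r}" "t \<in> {t1 - r..t1}" for x t
    using r that z1G by (auto simp: A_def z1_eq)
  \<comment> \<open>The box must reach beyond \<open>t1\<close>, because comparison is asserted in
    its open interior, but if \<open>t1 = T\<close> the minimum says nothing about later times. The
    strict inequality at the two side points persists for a short time by lower semicontinuity of
    \<open>u\<close>.\<close>
  have later: "\<exists>s>0. \<forall>t. t1 \<le> t \<and> t \<le> t1 + s \<longrightarrow> ereal (H (y, t)) \<le> u (y, t)"
    if y: "y \<in> {x1 - r..x1 + r}" "\<delta> < D y" for y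
  proof -
    have yA: "(y, t1) \<in> A" by (rule inA) (use y r in auto)
    then have yG: "(y, t1) \<in> G" by (simp add: A_def)
    have lt: "ereal (H (y, t1)) < u (y, t1)"
    proof -
      have "H (y, t1) < v (y, t1) + m" using y by (simp add: H_eq)
      then show ?thesis using u_ge[OF yA] by (meson less_ereal.simps(1) less_le_trans)
    qed
    then obtain c where c: "ereal (H (y, t1)) < ereal c" "ereal c < u (y, t1)" using ereal_dense2 by blast
    have "eventually (\<lambda>z. ereal c < u z) (at (y, t1) within G)"
      using less_le_trans[OF c(2) u_lsc[OF yG]] less_LiminfD by blast
    moreover have "eventually (\<lambda>z. H z < c) (at (y, t1) within G)"
    proof (rule order_tendstoD(2))
      show "(H \<longlongrightarrow> H (y, t1)) (at (y, t1) within G)"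
        using continuous_at_imp_continuous_at_within[of "(y, t1)" H G] H_cont[of UNIV]
          continuous_on_eq_continuous_at[OF open_UNIV, of H] by (auto simp only: continuous_within)
    qed (use c in simp)
    ultimately have "eventually (\<lambda>z. ereal (H z) < u z) (at (y, t1) within G)"
      by eventually_elim (meson less_ereal.simps(1) less_trans)
    then obtain e where e: "e > 0" "\<And>z. z \<in> G \<Longrightarrow> z \<noteq> (y, t1) \<Longrightarrow> dist z (y, t1) < e \<Longrightarrow> ereal (H z) < u z"
      unfolding eventually_at by blast
    show ?thesis
    proof (intro exI[of _ "min r (e / 2)"] conjI allI impI)
      show "0 < min r (e / 2)" using r e by simp
      fix t assume t: "t1 \<le> t \<and> t \<le> t1 + min r (e / 2)"
      have "(y, t) \<in> G" using r y t by auto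
      moreover have "dist (y, t) (y, t1) < e"
        using t e(1) min.cobounded2[of r "e / 2"] unfolding dist_Pair_Pair dist_real_def by simp
      ultimately show "ereal (H (y, t)) \<le> u (y, t)"
        using e(2)[of "(y, t)"] lt by (cases "t = t1") (auto intro: less_imp_le)
    qed
  qed
  obtain s1 s2 where s: "s1 > 0" "s2 > 0"
    "\<And>t. t1 \<le> t \<Longrightarrow> t \<le> t1 + s1 \<Longrightarrow> ereal (H (x1 - r, t)) \<le> u (x1 - r, t)"
    "\<And>t. t1 \<le> t \<Longrightarrow> t \<le> t1 + s2 \<Longrightarrow> ereal (H (x1 + r, t)) \<le> u (x1 + r, t)"
    using later[of "x1 - r"] later[of "x1 + r"] \<delta> r(1) by force
  define s where "s = min r (min s1 s2)"
  have s_pos: "0 < s" "s \<le> r" "s \<le> s1" "s \<le> s2" using s r by (auto simp: s_def)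
  have early: "ereal (H (x, t)) \<le> u (x, t)"
    if "x \<in> {x1 - r..x1 + r}" "t \<in> {t1 - r..t1}" "\<delta> + (\<eta> / 2) * (t - t1) \<le> D x" for x t
  proof -
    have "ereal (H (x, t)) \<le> ereal (v (x, t) + m)" using that by (simp add: H_eq)
    also have "\<dots> \<le> u (x, t)" by (rule u_ge[OF inA[OF that(1,2)]])
    finally show ?thesis .
  qed
  have side: "ereal (H (y, t)) \<le> u (y, t)" if "y = x1 - r \<or> y = x1 + r" "t \<in> {t1 - r..t1 + s}" for y t
  proof (cases "t \<le> t1")
    case True
    have "(\<eta> / 2) * (t - t1) \<le> 0" using True \<eta> by (intro mult_nonneg_nonpos) auto
    then show ?thesis using that True \<delta> r(1) by (intro early) auto
  next
    case False
    then show ?thesis using that s(3)[of t] s(4)[of t] s_pos by auto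
  qed
  have bottom: "ereal (H (x, t1 - r)) \<le> u (x, t1 - r)" if "x \<in> {x1 - r..x1 + r}" for x
    using that \<delta> r(1) D_nonneg[of x] by (intro early) auto
  have fr: "frontier (box (x1 - r) (x1 + r)) = {x1 - r, x1 + r}"
    using r(1) by (auto simp: frontier_def interior_open)
  have bdry: "\<forall>z\<in>parabolic_boundary (box (x1 - r) (x1 + r)) (t1 - r) (t1 + s). ereal (H z) \<le> u z"
    unfolding parabolic_boundary_def fr using bottom side r(1) s_pos by auto
  have cl: "closure (box (x1 - r) (x1 + r) \<times> {t1 - r<..<t1 + s}) = {x1 - r..x1 + r} \<times> {t1 - r..t1 + s}"
    using r(1) s_pos by (simp add: closure_open_rectangle)
  have "{x1 - r..x1 + r} \<times> {t1 - r..t1 + s} \<subseteq> \<Theta>" using r(2) s_pos G(3) by force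
  then have "compactly_in (box (x1 - r) (x1 + r) \<times> {t1 - r<..<t1 + s}) \<Theta>"
    unfolding compactly_in_def cl by (simp add: compact_Times)
  moreover have "box (x1 - r) (x1 + r) \<noteq> {}" "t1 - r < t1 + s" using r(1) s_pos by auto
  ultimately have "\<forall>z\<in>box (x1 - r) (x1 + r) \<times> {t1 - r<..<t1 + s}. ereal (H z) \<le> u z"
    using super H_par[of "box (x1 - r) (x1 + r) \<times> {t1 - r<..<t1 + s}"]
      H_cont[of "closure (box (x1 - r) (x1 + r) \<times> {t1 - r<..<t1 + s})"] bdry
    unfolding p_superparabolic_def by blast
  then have "ereal (H (x1, t1)) \<le> u (x1, t1)" using r(1) s_pos by auto
  then show False using r1 \<delta>(1) D1 by (simp add: H_eq z1_eq m_def)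
qed

subsection \<open>Barriers\<close>

text \<open>The gluing below handles exact solutions through this predicate, which is stable under
  adding constants, change of sign and reflection in \<open>x\<close>.\<close>

definition exact_solution :: "real \<Rightarrow> (real \<times> real \<Rightarrow> real) \<Rightarrow> bool" where
  "exact_solution p H \<longleftrightarrow> (\<exists>a b \<psi>. (\<forall>x. (\<psi> has_real_derivative sgn_root p (a * x + b)) (at x)) \<and>
     H = (\<lambda>z. a * snd z + \<psi> (fst z)))"

lemma sgn_root_minus: "sgn_root p (- y) = - sgn_root p y"
  by (simp add: sgn_root_def sgn_minus)

lemma exact_solution_const: "exact_solution p (\<lambda>z. c)"
  unfolding exact_solution_def
  by (intro exI[of _ 0] exI[of _ "\<lambda>x. c"]) (auto simp: sgn_root_def)

lemma exact_solution_add_const: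
  assumes "exact_solution p H"
  shows "exact_solution p (\<lambda>z. c + H z)"
proof -
  obtain a b \<psi> where "\<And>x. (\<psi> has_real_derivative sgn_root p (a * x + b)) (at x)" "H = (\<lambda>z. a * snd z + \<psi> (fst z))"
    using assms unfolding exact_solution_def by blast
  then show ?thesis
    unfolding exact_solution_def
    by (intro exI[of _ a] exI[of _ b] exI[of _ "\<lambda>x. c + \<psi> x"]) (auto intro!: derivative_eq_intros)
qed

text \<open>Both sides of the equation are odd in the solution. The same barrier can therefore be
  used from above and from below.\<close>

lemma exact_solution_uminus:
  assumes "exact_solution p H"
  shows "exact_solution p (\<lambda>z. - H z)"
proof -
  obtain a b \<psi> where *: "\<And>x. (\<psi> has_real_derivative sgn_root p (a * x + b)) (at x)" "H = (\<lambda>z. a * snd z + \<psi> (fst z))"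
    using assms unfolding exact_solution_def by blast
  have "sgn_root p (- a * x + - b) = - sgn_root p (a * x + b)" for x
    using sgn_root_minus[of p "a * x + b"] by simp
  with * show ?thesis
    unfolding exact_solution_def
    by (intro exI[of _ "- a"] exI[of _ "- b"] exI[of _ "\<lambda>x. - \<psi> x"]) (auto intro!: derivative_eq_intros)
qed

lemma exact_solution_diff:
  "exact_solution p H \<Longrightarrow> exact_solution p (\<lambda>z. c - H z)"
  using exact_solution_add_const[OF exact_solution_uminus, of p H c] by simp

lemma exact_solution_reflect:
  assumes "exact_solution p H"
  shows "exact_solution p (\<lambda>z. H (- fst z, snd z))"
proof -
  obtain a b \<psi> where *: "\<And>x. (\<psi> has_real_derivative sgn_root p (a * x + b)) (at x)" "H = (\<lambda>z. a * snd z + \<psi> (fst z))"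
    using assms unfolding exact_solution_def by blast
  have "sgn_root p (a * x + - b) = - sgn_root p (a * (- x) + b)" for x
    using sgn_root_minus[of p "a * (- x) + b"] by simp
  moreover have "((\<lambda>x. \<psi> (- x)) has_real_derivative sgn_root p (a * (- x) + b) * - 1) (at x)" for x
    by (rule DERIV_chain2[OF *(1)]) (auto intro!: derivative_eq_intros)
  ultimately show ?thesis
    unfolding exact_solution_def *(2)
    by (intro exI[of _ a] exI[of _ "- b"] exI[of _ "\<lambda>x. \<psi> (- x)"]) auto
qed

lemma exact_solution_continuous:
  assumes "exact_solution p H"
  shows "continuous_on S H"
proof -
  obtain a b \<psi> where *: "\<And>x. (\<psi> has_real_derivative sgn_root p (a * x + b)) (at x)" "H = (\<lambda>z. a * snd z + \<psi> (fst z))"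
    using assms unfolding exact_solution_def by blast
  have c: "continuous_on UNIV \<psi>"
    using *(1) DERIV_isCont continuous_at_imp_continuous_on by blast
  show ?thesis
    unfolding *(2) by (intro continuous_intros continuous_on_compose2[OF c]) auto
qed

lemma exact_solution_tendsto:
  assumes "exact_solution p H"
  shows "(H \<longlongrightarrow> H z) (at z within S)"
proof -
  have "isCont H z"
    using exact_solution_continuous[OF assms, of UNIV] continuous_on_eq_continuous_at[OF open_UNIV, of H] by blast
  then show ?thesis unfolding isCont_def by (rule tendsto_within_subset) simp
qed

lemma compactly_in_mono: "compactly_in D \<Theta>' \<Longrightarrow> \<Theta>' \<subseteq> \<Theta> \<Longrightarrow> compactly_in D \<Theta>"
  unfolding compactly_in_def by (rule conjI, erule conjunct1, erule conjE, erule order_trans)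

lemma p_parabolic_subset:
  assumes "p_parabolic p \<Theta> u" "\<Theta>' \<subseteq> \<Theta>"
  shows "p_parabolic p \<Theta>' u"
proof -
  note par = assms(1)[unfolded p_parabolic_def]
  show ?thesis
    unfolding p_parabolic_def
  proof (rule conjI, rule continuous_on_subset[OF conjunct1[OF par] assms(2)], intro allI impI, goal_cases)
    case (1 U t1 t2)
    then have "open U \<and> t1 < t2 \<and> compactly_in (U \<times> {t1<..<t2}) \<Theta>"
      using compactly_in_mono[OF _ assms(2)] by simp
    from mp[OF conjunct2[OF par, THEN spec[of _ U], THEN spec[of _ t1], THEN spec[of _ t2]] this]
    show ?case .
  qed
qed

lemma p_parabolic_le_exact_solution:
  fixes h :: "real \<times> real \<Rightarrow> real"
  assumes "1 < p" "exact_solution p H" "x1 < x2" "t1 < t2"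
    and "p_parabolic p \<Theta> h" "{x1<..<x2} \<times> {t1<..<t2} \<subseteq> \<Theta>"
    and "continuous_on ({x1..x2} \<times> {t1..t2}) h"
    and "\<And>x. x \<in> {x1..x2} \<Longrightarrow> h (x, t1) \<le> H (x, t1)"
    and "\<And>t. t \<in> {t1..t2} \<Longrightarrow> h (x1, t) \<le> H (x1, t) \<and> h (x2, t) \<le> H (x2, t)"
    and "x \<in> {x1..x2}" "t \<in> {t1..t2}"
  shows "h (x, t) \<le> H (x, t)"
proof -
  obtain a b \<psi> where *: "\<And>x. (\<psi> has_real_derivative sgn_root p (a * x + b)) (at x)" "H = (\<lambda>z. a * snd z + \<psi> (fst z))"
    using assms(2) unfolding exact_solution_def by blast
  show ?thesis
    using p_parabolic_comparison[OF assms(1,3,4) p_parabolic_subset[OF assms(5,6)] assms(7) *(1) _ _ assms(10,11)] assms(8,9)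
    by (simp add: *(2))
qed

lemma exact_solution_le_superparabolic:
  assumes "1 < p" "p_superparabolic p \<Theta> u" "exact_solution p H"
    and "open G" "bounded G" "G \<subseteq> \<Theta>"
    and "\<And>\<xi>. \<xi> \<in> frontier G \<Longrightarrow> snd \<xi> \<le> T \<Longrightarrow> ereal (H \<xi>) \<le> Liminf (at \<xi> within G) u"
    and "z \<in> G" "snd z \<le> T"
  shows "ereal (H z) \<le> u z"
proof -
  obtain a b \<psi> where *: "\<And>x. (\<psi> has_real_derivative sgn_root p (a * x + b)) (at x)" "H = (\<lambda>z. a * snd z + \<psi> (fst z))"
    using assms(3) unfolding exact_solution_def by blast
  show ?thesis
    using superparabolic_comparison[OF assms(1,2,4,5,6) *(1) _ assms(8,9)] assms(7)
    by (simp add: *(2))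
qed

section \<open>Gluing the pieces of the barrier and estimating the Perron solution\<close>

definition past_side :: "real \<Rightarrow> real \<Rightarrow> (real \<times> real) set" where
  "past_side k \<sigma> = {z. snd z \<le> 0 \<and> 0 \<le> \<sigma> * (fst z + k * snd z)}"

text \<open>\<open>H \<sigma>\<close> is the barrier on the side \<open>\<sigma> = \<plusminus>1\<close> of the ray \<open>x = - k t\<close>, \<open>t \<le> 0\<close>, and \<open>Hp\<close> the one
  for positive times.\<close>

locale ray_barrier =
  fixes p k \<epsilon> \<delta> M :: real and \<Theta> :: "(real \<times> real) set"
    and H :: "real \<Rightarrow> real \<times> real \<Rightarrow> real" and \<rho> :: "real \<Rightarrow> real" and Hp :: "real \<times> real \<Rightarrow> real"
  assumes p: "1 < p" and \<delta>: "0 < \<delta>" and M: "0 < M"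
    and \<Theta>: "open \<Theta>" "bounded \<Theta>"
    and ray: "\<And>z. z \<in> \<Theta> \<Longrightarrow> snd z \<le> 0 \<Longrightarrow> fst z + k * snd z \<noteq> 0"
    and H: "\<And>\<sigma>. \<bar>\<sigma>\<bar> = 1 \<Longrightarrow> exact_solution p (H \<sigma>)"
    and \<rho>: "\<And>\<sigma>. \<bar>\<sigma>\<bar> = 1 \<Longrightarrow> 0 < \<rho> \<sigma> \<and> \<rho> \<sigma> \<le> \<delta>"
    and H_nonneg: "\<And>\<sigma> z. \<bar>\<sigma>\<bar> = 1 \<Longrightarrow> z \<in> past_side k \<sigma> \<Longrightarrow> \<bar>fst z\<bar> \<le> \<rho> \<sigma> \<Longrightarrow> 0 \<le> H \<sigma> z"
    and H_large: "\<And>\<sigma> z. \<bar>\<sigma>\<bar> = 1 \<Longrightarrow> z \<in> past_side k \<sigma> \<Longrightarrow> \<bar>fst z\<bar> \<le> \<rho> \<sigma> \<Longrightarrow>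
      \<bar>fst z\<bar> = \<rho> \<sigma> \<or> snd z \<le> - \<delta> \<Longrightarrow> M \<le> H \<sigma> z"
    and H_origin: "\<And>\<sigma>. \<bar>\<sigma>\<bar> = 1 \<Longrightarrow> H \<sigma> (0, 0) \<le> \<epsilon>"
    and Hp: "exact_solution p Hp"
    and Hp_nonneg: "\<And>z. 0 \<le> snd z \<Longrightarrow> 0 \<le> Hp z"
    and Hp_large: "\<And>z. 0 \<le> snd z \<Longrightarrow> \<delta> \<le> \<bar>fst z\<bar> \<or> \<delta> \<le> snd z \<Longrightarrow> M \<le> Hp z"
    and Hp_origin: "Hp (0, 0) \<le> \<epsilon>"
    and Hp_initial: "\<And>\<sigma> x. \<bar>\<sigma>\<bar> = 1 \<Longrightarrow> 0 \<le> \<sigma> * x \<Longrightarrow>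
      (if \<bar>x\<bar> < \<rho> \<sigma> then min (H \<sigma> (x, 0)) M else M) \<le> Hp (x, 0)"
begin

text \<open>The value on the ray itself is a convention: \<Theta> does not meet the ray.\<close>

definition "side z = (if 0 \<le> fst z + k * snd z then 1 else - 1 :: real)"

text \<open>In the sector \<open>H \<sigma>\<close> is at least \<open>M\<close> where
  \<open>\<bar>x\<bar> = \<rho> \<sigma>\<close>, so the truncated function continues as the
  constant \<open>M\<close> without a jump.\<close>

definition "past \<sigma> z = (if \<bar>fst z\<bar> < \<rho> \<sigma> then min (H \<sigma> z) M else M)"

definition "barrier z = (if 0 < snd z then min (Hp z) M else past (side z) z)"

lemma abs_side [simp]: "\<bar>side z\<bar> = 1"
  by (simp add: side_def)

lemma past_side_side: "snd z \<le> 0 \<Longrightarrow> z \<in> past_side k (side z)"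
  by (auto simp: past_side_def side_def)

lemma barrier_le: "barrier z \<le> M"
  by (auto simp: barrier_def past_def)

lemma barrier_nonneg: "0 \<le> barrier z"
  using Hp_nonneg[of z] H_nonneg[OF abs_side past_side_side, of z] M by (auto simp: barrier_def past_def)

text \<open>Time \<open>0\<close> belongs to the past piece. The inequality says that the barrier
  can only jump upwards as time becomes positive; lower semicontinuity and the comparison after time
  \<open>0\<close> both rest on this.\<close>

lemma barrier_initial: "snd z = 0 \<Longrightarrow> barrier z \<le> Hp z"
  using Hp_initial[of "side z" "fst z"] by (cases z) (auto simp: barrier_def past_def side_def)

lemma barrier_le_Hp: "0 \<le> snd z \<Longrightarrow> barrier z \<le> Hp z"
  using barrier_initial[of z] by (cases "snd z = 0") (auto simp: barrier_def)

lemma barrier_far: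
  assumes "\<delta> \<le> \<bar>fst z\<bar> \<or> \<delta> \<le> \<bar>snd z\<bar>"
  shows "barrier z = M"
proof (cases "0 < snd z")
  case True
  then show ?thesis using Hp_large[of z] assms by (auto simp: barrier_def)
next
  case False
  show ?thesis
  proof (cases "\<bar>fst z\<bar> < \<rho> (side z)")
    case True
    then have "\<bar>fst z\<bar> < \<delta>" using \<rho>[of "side z"] by simp
    then have "snd z \<le> - \<delta>" using assms False by auto
    then have "M \<le> H (side z) z" using H_large[OF abs_side past_side_side, of z] True False by auto
    then show ?thesis using False by (simp add: barrier_def past_def)
  qed (use False in \<open>simp add: barrier_def past_def\<close>)
qed

lemma past_le_H:
  assumes "snd z \<le> 0" "\<bar>fst z\<bar> \<le> \<rho> (side z)"
  shows "past (side z) z \<le> H (side z) z"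
  using H_large[OF abs_side past_side_side[OF assms(1)] assms(2)] assms(2) by (auto simp: past_def)

text \<open>All three pieces are at most \<epsilon> at the vertex, and close to it
  \<open>\<bar>x\<bar>\<close> is below both radii.\<close>

lemma barrier_small_at_origin:
  assumes "0 < e"
  shows "eventually (\<lambda>z. barrier z < \<epsilon> + e) (at (0, 0) within S)"
proof -
  have 1: "eventually (\<lambda>z. H 1 z < \<epsilon> + e) (at (0, 0) within S)"
    using H_origin[of 1] assms by (intro order_tendstoD(2)[OF exact_solution_tendsto[OF H]]) auto
  have 2: "eventually (\<lambda>z. H (- 1) z < \<epsilon> + e) (at (0, 0) within S)"
    using H_origin[of "- 1"] assms by (intro order_tendstoD(2)[OF exact_solution_tendsto[OF H]]) auto
  have 3: "eventually (\<lambda>z. Hp z < \<epsilon> + e) (at (0, 0) within S)"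
    using Hp_origin assms by (intro order_tendstoD(2)[OF exact_solution_tendsto[OF Hp]]) auto
  have 4: "((\<lambda>z. \<bar>fst z\<bar>) \<longlongrightarrow> 0) (at (0, 0) within S)" for S :: "(real \<times> real) set"
    using tendsto_rabs[OF tendsto_fst[OF tendsto_ident_at[of "(0, 0) :: real \<times> real" S]]] by simp
  have 5: "eventually (\<lambda>z. \<bar>fst z\<bar> < \<rho> 1) (at (0, 0) within S)" "eventually (\<lambda>z. \<bar>fst z\<bar> < \<rho> (- 1)) (at (0, 0) within S)"
    using \<rho>[of 1] \<rho>[of "- 1"] by (auto intro!: order_tendstoD(2)[OF 4])
  show ?thesis
    using 1 2 3 5
  proof eventually_elim
    case (elim z)
    then show ?case by (auto simp: barrier_def past_def side_def)
  qed
qed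

text \<open>The linear form \<open>x + k * t\<close> does not vanish at a past point of \<Theta>, so
  its sign is locally constant.\<close>

lemma side_eventually:
  assumes "z \<in> \<Theta>" "snd z \<le> 0"
  shows "eventually (\<lambda>y. side y = side z) (at z within S)"
proof -
  have t: "((\<lambda>y. fst y + k * snd y) \<longlongrightarrow> fst z + k * snd z) (at z within S)"
    by (intro tendsto_intros)
  consider "fst z + k * snd z < 0" | "0 < fst z + k * snd z" using ray[OF assms] by linarith
  then show ?thesis
  proof cases
    case 1
    from order_tendstoD(2)[OF t 1] show ?thesis
      by eventually_elim (use 1 in \<open>auto simp: side_def\<close>)
  next
    case 2
    from order_tendstoD(1)[OF t 2] show ?thesis
      by eventually_elim (use 2 in \<open>auto simp: side_def\<close>)
  qed
qed

lemma barrier_lsc: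
  assumes z: "z \<in> \<Theta>" and y: "y < barrier z"
  shows "eventually (\<lambda>z. y < barrier z) (at z within S)"
proof -
  have yM: "y < M" using y barrier_le[of z] by simp
  have sndt: "(snd \<longlongrightarrow> snd z) (at z within S)" by (intro tendsto_intros)
  \<comment> \<open>The future and the past piece are treated as separate implications, since both
    occur near a point at time \<open>0\<close>.\<close>
  have future: "eventually (\<lambda>z. 0 < snd z \<longrightarrow> y < min (Hp z) M) (at z within S)"
  proof (cases "0 \<le> snd z")
    case True
    have "eventually (\<lambda>z. y < Hp z) (at z within S)"
      using barrier_le_Hp[OF True] y by (intro order_tendstoD(1)[OF exact_solution_tendsto[OF Hp]]) simp
    then show ?thesis by eventually_elim (use yM in auto)
  next
    case False
    then have "eventually (\<lambda>z. snd z < 0) (at z within S)" by (intro order_tendstoD(2)[OF sndt]) simp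
    then show ?thesis by eventually_elim auto
  qed
  have "eventually (\<lambda>z. \<not> 0 < snd z \<longrightarrow> y < past (side z) z) (at z within S)"
  proof (cases "0 < snd z")
    case True
    then have "eventually (\<lambda>z. 0 < snd z) (at z within S)" by (intro order_tendstoD(1)[OF sndt])
    then show ?thesis by eventually_elim auto
  next
    case False
    then have s0: "snd z \<le> 0" by simp
    have yp: "y < past (side z) z" using y False by (simp add: barrier_def)
    have "eventually (\<lambda>z'. y < past (side z) z') (at z within S)"
    proof (cases "\<bar>fst z\<bar> \<le> \<rho> (side z)")
      case True
      have "y < H (side z) z" using yp past_le_H[OF s0 True] by simp
      then have "eventually (\<lambda>z'. y < H (side z) z') (at z within S)"
        by (intro order_tendstoD(1)[OF exact_solution_tendsto[OF H]]) auto
      then show ?thesis by eventually_elim (use yM in \<open>auto simp: past_def\<close>)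
    next
      case False
      have "((\<lambda>z. \<bar>fst z\<bar>) \<longlongrightarrow> \<bar>fst z\<bar>) (at z within S)" by (intro tendsto_intros)
      from order_tendstoD(1)[OF this, of "\<rho> (side z)"] False
      have "eventually (\<lambda>z'. \<rho> (side z) < \<bar>fst z'\<bar>) (at z within S)" by simp
      then show ?thesis by eventually_elim (use yM in \<open>auto simp: past_def\<close>)
    qed
    with side_eventually[OF z s0, of S] show ?thesis
      by eventually_elim auto
  qed
  with future show ?thesis by eventually_elim (auto simp: barrier_def)
qed

text \<open>A box is connected, and \<open>x + k * t\<close> cannot take the value \<open>0\<close>
  on a past box inside \<Theta>.\<close>

lemma side_constant:
  assumes "{a..b} \<times> {t1..T} \<subseteq> \<Theta>" "T \<le> 0" "z \<in> {a..b} \<times> {t1..T}" "z' \<in> {a..b} \<times> {t1..T}"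
  shows "side z = side z'"
proof (rule ccontr)
  assume ne: "side z \<noteq> side z'"
  let ?f = "\<lambda>z. fst z + k * snd z"
  let ?R = "{a..b} \<times> {t1..T}"
  have conn: "connected (?f ` ?R)"
    by (rule connected_continuous_image)
      (intro continuous_intros, intro connected_Times connected_Icc)
  have mem: "?f z \<in> ?f ` ?R" "?f z' \<in> ?f ` ?R" by (rule imageI, rule assms)+
  have "?f z \<le> 0 \<and> 0 \<le> ?f z' \<or> ?f z' \<le> 0 \<and> 0 \<le> ?f z" using ne by (auto simp: side_def split: if_splits)
  then have "0 \<in> ?f ` ?R"
    using conn[unfolded connected_iff_interval, rule_format, OF mem(1,2), of 0]
      conn[unfolded connected_iff_interval, rule_format, OF mem(2,1), of 0] by argo
  then obtain y where y: "y \<in> ?R" "?f y = 0" by (elim imageE) simp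
  have "y \<in> \<Theta>" using y(1) assms(1) by (rule subsetD[rotated])
  moreover have "snd y \<le> 0" using y(1) assms(2) by (simp add: mem_Times_iff)
  ultimately show False using ray y(2) by blast
qed

text \<open>\<open>h\<close> is compared with one exact solution at a time: with
  \<open>c + M\<close> on the whole box, with \<open>c + H \<sigma>\<close> inside the strip up to
  time \<open>0\<close>, and with \<open>c + Hp\<close> from time \<open>0\<close> on, where the
  bound already proved at time \<open>0\<close> provides the initial values.\<close>

lemma barrier_box_comparison:
  fixes h :: "real \<times> real \<Rightarrow> real"
  assumes ab: "a < b" and t12: "t1 < t2"
    and R: "{a..b} \<times> {t1..t2} \<subseteq> \<Theta>"
    and h: "p_parabolic p ({a<..<b} \<times> {t1<..<t2}) h" "continuous_on ({a..b} \<times> {t1..t2}) h"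
    and bottom: "\<And>x. x \<in> {a..b} \<Longrightarrow> h (x, t1) \<le> c + barrier (x, t1)"
    and sides: "\<And>t. t \<in> {t1..t2} \<Longrightarrow> h (a, t) \<le> c + barrier (a, t) \<and> h (b, t) \<le> c + barrier (b, t)"
    and x: "x \<in> {a..b}" and t: "t \<in> {t1..t2}"
  shows "h (x, t) \<le> c + barrier (x, t)"
proof -
  have hM: "h (x, t) \<le> c + M" if "x \<in> {a..b}" "t \<in> {t1..t2}" for x t
  proof (rule p_parabolic_le_exact_solution[OF p exact_solution_const ab t12 h(1) order_refl h(2) _ _ that])
    show "h (x, t1) \<le> c + M" if "x \<in> {a..b}" for x
      using bottom[OF that] barrier_le[of "(x, t1)"] by linarith
    show "h (a, t) \<le> c + M \<and> h (b, t) \<le> c + M" if "t \<in> {t1..t2}" for t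
      using sides[OF that] barrier_le[of "(a, t)"] barrier_le[of "(b, t)"] by linarith
  qed
  have past: "h (x, t) \<le> c + barrier (x, t)" if x: "x \<in> {a..b}" and t: "t \<in> {t1..t2}" "t \<le> 0" for x t
  proof (cases "t1 < 0")
    case False
    then have "t = t1" using t by simp
    then show ?thesis using bottom x by simp
  next
    case True
    define T where "T = min t2 0"
    have T: "t1 < T" "T \<le> 0" "T \<le> t2" using True t12 by (auto simp: T_def)
    have RT: "{a..b} \<times> {t1..T} \<subseteq> \<Theta>" using R T by force
    define \<sigma> where "\<sigma> = side (x, t)"
    have \<sigma>1: "\<bar>\<sigma>\<bar> = 1" by (simp add: \<sigma>_def)
    have side: "side (y, s) = \<sigma>" if "y \<in> {a..b}" "s \<in> {t1..T}" for y s
      unfolding \<sigma>_def by (rule side_constant[OF RT T(2)]) (use that x t in \<open>auto simp: T_def\<close>)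
    show ?thesis
    proof (cases "\<bar>x\<bar> < \<rho> \<sigma>")
      case False
      then show ?thesis using hM[OF x t(1)] t(2) by (simp add: barrier_def past_def \<sigma>_def)
    next
      case near: True
      \<comment> \<open>Each side of the cut box is either a side of the original one or satisfies
        \<open>\<bar>x\<bar> = \<rho> \<sigma>\<close>; there \<open>H \<sigma>\<close> is at least
        \<open>M\<close> and the bound by \<open>c + M\<close> suffices.\<close>
      define a' b' where "a' = max a (- \<rho> \<sigma>)" and "b' = min b (\<rho> \<sigma>)"
      have ab': "a' < b'" "a \<le> a'" "b' \<le> b" "x \<in> {a'..b'}" "- \<rho> \<sigma> \<le> a'" "b' \<le> \<rho> \<sigma>"
        using near x ab by (auto simp: a'_def b'_def abs_less_iff)
      have upper: "h (y, s) \<le> c + H \<sigma> (y, s)"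
        if y: "y \<in> {a'..b'}" and s: "s \<in> {t1..T}" and bd: "h (y, s) \<le> c + barrier (y, s) \<or> \<bar>y\<bar> = \<rho> \<sigma>" for y s
      proof -
        have in_box: "y \<in> {a..b}" "\<bar>y\<bar> \<le> \<rho> \<sigma>" "s \<le> 0" using y s ab' T by auto
        have sd: "side (y, s) = \<sigma>" by (rule side) (use in_box s in auto)
        have ps: "(y, s) \<in> past_side k \<sigma>" using past_side_side[of "(y, s)"] in_box sd by simp
        show ?thesis
        proof (cases "\<bar>y\<bar> = \<rho> \<sigma>")
          case True
          then have "M \<le> H \<sigma> (y, s)" using H_large[OF \<sigma>1 ps] by simp
          moreover have "h (y, s) \<le> c + M" using hM[of y s] in_box s T by simp
          ultimately show ?thesis by simp
        next
          case False
          then have "h (y, s) \<le> c + barrier (y, s)" using bd by simp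
          also have "barrier (y, s) \<le> H \<sigma> (y, s)"
            using past_le_H[of "(y, s)"] in_box sd by (simp add: barrier_def)
          finally show ?thesis by simp
        qed
      qed
      have "h (x, t) \<le> c + H \<sigma> (x, t)"
      proof (rule p_parabolic_le_exact_solution[OF p exact_solution_add_const[OF H[OF \<sigma>1]] ab'(1) T(1) h(1)])
        show "{a'<..<b'} \<times> {t1<..<T} \<subseteq> {a<..<b} \<times> {t1<..<t2}" using ab' T by auto
        show "continuous_on ({a'..b'} \<times> {t1..T}) h"
          by (rule continuous_on_subset[OF h(2)]) (use ab' T in auto)
        show "h (y, t1) \<le> c + H \<sigma> (y, t1)" if "y \<in> {a'..b'}" for y
          using bottom[of y] that ab' T by (intro upper) auto
        show "h (a', s) \<le> c + H \<sigma> (a', s) \<and> h (b', s) \<le> c + H \<sigma> (b', s)" if s: "s \<in> {t1..T}" for s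
        proof
          have "a' = a \<or> \<bar>a'\<bar> = \<rho> \<sigma>" "b' = b \<or> \<bar>b'\<bar> = \<rho> \<sigma>"
            using \<rho>[OF \<sigma>1] by (auto simp: a'_def b'_def)
          then show "h (a', s) \<le> c + H \<sigma> (a', s)" "h (b', s) \<le> c + H \<sigma> (b', s)"
            using sides[of s] s ab' T by (auto intro!: upper)
        qed
      qed (use ab' x t T in \<open>auto simp: T_def\<close>)
      then show ?thesis using hM[OF x t(1)] t(2) near by (simp add: barrier_def past_def \<sigma>_def)
    qed
  qed
  show ?thesis
  proof (cases "0 < t")
    case False
    then show ?thesis using past x t by simp
  next
    case True
    define T where "T = max t1 0"
    have T: "T < t2" "t1 \<le> T" "0 \<le> T" "T \<le> t" using True t12 t by (auto simp: T_def)
    have le: "h (y, s) \<le> c + Hp (y, s)" if "0 \<le> s" "h (y, s) \<le> c + barrier (y, s)" for y s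
      using that barrier_le_Hp[of "(y, s)"] by simp
    have "h (x, t) \<le> c + Hp (x, t)"
    proof (rule p_parabolic_le_exact_solution[OF p exact_solution_add_const[OF Hp] ab T(1) h(1)])
      show "{a<..<b} \<times> {T<..<t2} \<subseteq> {a<..<b} \<times> {t1<..<t2}" using T by auto
      show "continuous_on ({a..b} \<times> {T..t2}) h"
        by (rule continuous_on_subset[OF h(2)]) (use T in auto)
      show "h (y, T) \<le> c + Hp (y, T)" if "y \<in> {a..b}" for y
        using bottom[OF that] past[OF that, of T] T t12 by (intro le) (auto simp: T_def max_def split: if_splits)
      show "h (a, s) \<le> c + Hp (a, s) \<and> h (b, s) \<le> c + Hp (b, s)" if "s \<in> {T..t2}" for s
        using sides[of s] that T by (auto intro!: le)
    qed (use x t T in auto)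
    then show ?thesis using hM[OF x t] True by (simp add: barrier_def)
  qed
qed

lemma barrier_superparabolic: "p_superparabolic p \<Theta> (\<lambda>z. ereal (c + barrier z))"
  unfolding p_superparabolic_def
proof (intro conjI ballI allI impI)
  show "ereal (c + barrier z) \<noteq> - \<infinity>" for z by simp
  show "ereal (c + barrier z) \<le> Liminf (at z within \<Theta>) (\<lambda>z. ereal (c + barrier z))" if z: "z \<in> \<Theta>" for z
    unfolding le_Liminf_iff
  proof (intro allI impI)
    fix y :: ereal assume y: "y < ereal (c + barrier z)"
    then obtain r where r: "y < ereal r" "ereal r < ereal (c + barrier z)" using ereal_dense2 by blast
    have "eventually (\<lambda>z. r - c < barrier z) (at z within \<Theta>)" by (rule barrier_lsc[OF z]) (use r in simp)
    then show "eventually (\<lambda>z. y < ereal (c + barrier z)) (at z within \<Theta>)"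
    proof eventually_elim
      case (elim z)
      then have "ereal r < ereal (c + barrier z)" by simp
      then show ?case using r(1) by (rule less_trans[rotated])
    qed
  qed
  show "\<Theta> \<subseteq> closure {z \<in> \<Theta>. ereal (c + barrier z) \<noteq> \<infinity>}" using closure_subset by simp
  fix a b t1 t2 :: real and h :: "real \<times> real \<Rightarrow> real" and z
  assume asm: "box a b \<noteq> {} \<and> t1 < t2 \<and> compactly_in (box a b \<times> {t1<..<t2}) \<Theta> \<and>
      p_parabolic p (box a b \<times> {t1<..<t2}) h \<and> continuous_on (closure (box a b \<times> {t1<..<t2})) h \<and>
      (\<forall>z\<in>parabolic_boundary (box a b) t1 t2. ereal (h z) \<le> ereal (c + barrier z))"
    and z: "z \<in> box a b \<times> {t1<..<t2}"
  have box: "box a b \<noteq> {}" using asm by (elim conjE)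
  have t12: "t1 < t2" using asm by (elim conjE)
  have compact_in: "compactly_in (box a b \<times> {t1<..<t2}) \<Theta>" using asm by (elim conjE)
  have par: "p_parabolic p (box a b \<times> {t1<..<t2}) h" using asm by (elim conjE)
  have cont: "continuous_on (closure (box a b \<times> {t1<..<t2})) h" using asm by (elim conjE)
  have le: "\<forall>z\<in>parabolic_boundary (box a b) t1 t2. ereal (h z) \<le> ereal (c + barrier z)"
    using asm by (elim conjE)
  have ab: "a < b" using box by simp
  have cl: "closure (box a b \<times> {t1<..<t2}) = {a..b} \<times> {t1..t2}"
    using ab t12 by (simp add: closure_open_rectangle)
  have fr: "frontier (box a b) = {a, b}"
    using ab by (auto simp: frontier_def interior_open)
  have bd: "h z \<le> c + barrier z" if "z \<in> {a..b} \<times> {t1} \<union> {a, b} \<times> {t1<..t2}" for z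
  proof -
    have "closure (box a b) = {a..b}" using ab by simp
    with that have "z \<in> parabolic_boundary (box a b) t1 t2" unfolding parabolic_boundary_def fr by simp
    from bspec[OF le this] show ?thesis by simp
  qed
  have "h (fst z, snd z) \<le> c + barrier (fst z, snd z)"
  proof (rule barrier_box_comparison[OF ab t12])
    show "{a..b} \<times> {t1..t2} \<subseteq> \<Theta>" using compact_in unfolding compactly_in_def cl by (rule conjunct2)
    show "p_parabolic p ({a<..<b} \<times> {t1<..<t2}) h" using par by simp
    show "continuous_on ({a..b} \<times> {t1..t2}) h" using cont unfolding cl .
    show "h (x, t1) \<le> c + barrier (x, t1)" if "x \<in> {a..b}" for x
      by (rule bd) (use that in simp)
    show "h (a, t) \<le> c + barrier (a, t) \<and> h (b, t) \<le> c + barrier (b, t)" if "t \<in> {t1..t2}" for t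
      using bd[of "(a, t)"] bd[of "(b, t)"] ab that by (cases "t = t1") simp_all
    show "fst z \<in> {a..b}" "snd z \<in> {t1..t2}" using z by (simp_all add: mem_Times_iff)
  qed
  then show "ereal (h z) \<le> ereal (c + barrier z)" by simp
qed

text \<open>\<open>c + barrier\<close> belongs to the upper class. A frontier point that is not near
  has a coordinate of modulus at least \<open>2 * \<delta>\<close>, so the points around it still
  have one above \<delta>, where the barrier equals \<open>M\<close>. This is the reason for the
  factor \<open>2\<close>.\<close>

lemma upper_perron_le:
  assumes near: "\<And>\<xi>. \<xi> \<in> frontier \<Theta> \<Longrightarrow> \<bar>fst \<xi>\<bar> < 2 * \<delta> \<Longrightarrow> \<bar>snd \<xi>\<bar> < 2 * \<delta> \<Longrightarrow> f \<xi> \<le> c"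
    and far: "\<And>\<xi>. \<xi> \<in> frontier \<Theta> \<Longrightarrow> f \<xi> \<le> c + M"
  shows "upper_perron p \<Theta> f z \<le> ereal (c + barrier z)"
proof -
  have "(\<lambda>z. ereal (c + barrier z)) \<in> upper_class p \<Theta> f"
    unfolding upper_class_def mem_Collect_eq
  proof (intro conjI ballI)
    show "\<exists>m. \<forall>z\<in>\<Theta>. ereal m \<le> ereal (c + barrier z)"
      using barrier_nonneg by (intro exI[of _ c]) simp
    fix \<xi> assume \<xi>: "\<xi> \<in> frontier \<Theta>"
    have "eventually (\<lambda>z. ereal (f \<xi>) \<le> ereal (c + barrier z)) (at \<xi> within \<Theta>)"
    proof (cases "\<bar>fst \<xi>\<bar> < 2 * \<delta> \<and> \<bar>snd \<xi>\<bar> < 2 * \<delta>")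
      case True
      then show ?thesis using near[OF \<xi>] barrier_nonneg by (auto intro!: always_eventually add_increasing2)
    next
      case False
      have "((\<lambda>z. max \<bar>fst z\<bar> \<bar>snd z\<bar>) \<longlongrightarrow> max \<bar>fst \<xi>\<bar> \<bar>snd \<xi>\<bar>) (at \<xi> within \<Theta>)"
        by (intro tendsto_intros)
      moreover have "\<delta> < max \<bar>fst \<xi>\<bar> \<bar>snd \<xi>\<bar>" using False \<delta> by auto
      ultimately have "eventually (\<lambda>z. \<delta> < max \<bar>fst z\<bar> \<bar>snd z\<bar>) (at \<xi> within \<Theta>)" by (rule order_tendstoD(1))
      then show ?thesis
      proof eventually_elim
        case (elim z)
        then have "barrier z = M" by (intro barrier_far) auto
        then show ?case using far[OF \<xi>] by simp
      qed
    qed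
    then show "ereal (f \<xi>) \<le> Liminf (at \<xi> within \<Theta>) (\<lambda>z. ereal (c + barrier z))"
      by (rule Liminf_bounded)
  qed (rule barrier_superparabolic)
  then show ?thesis unfolding upper_perron_def by (rule INF_lower)
qed

text \<open>No equation for \<open>c - barrier\<close> is involved. Each \<open>u\<close> is
  compared with \<open>c - M\<close> on \<Theta>, with \<open>c - H \<sigma>\<close> on a sector of
  the strip and with \<open>c - Hp\<close> on the future part.\<close>

lemma upper_class_ge:
  assumes near: "\<And>\<xi>. \<xi> \<in> frontier \<Theta> \<Longrightarrow> \<bar>fst \<xi>\<bar> < 2 * \<delta> \<Longrightarrow> \<bar>snd \<xi>\<bar> < 2 * \<delta> \<Longrightarrow> c \<le> f \<xi>"
    and far: "\<And>\<xi>. \<xi> \<in> frontier \<Theta> \<Longrightarrow> c - M \<le> f \<xi>"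
    and u: "u \<in> upper_class p \<Theta> f" and z: "z \<in> \<Theta>"
  shows "ereal (c - barrier z) \<le> u z"
proof -
  have super: "p_superparabolic p \<Theta> u"
    and bdry: "\<And>\<xi>. \<xi> \<in> frontier \<Theta> \<Longrightarrow> ereal (f \<xi>) \<le> Liminf (at \<xi> within \<Theta>) u"
    using u unfolding upper_class_def mem_Collect_eq by blast+
  have bdry': "ereal r \<le> Liminf (at \<xi> within G) u" if "\<xi> \<in> frontier \<Theta>" "r \<le> f \<xi>" "G \<subseteq> \<Theta>" for \<xi> r G
  proof -
    have "ereal r \<le> ereal (f \<xi>)" using that by simp
    also have "\<dots> \<le> Liminf (at \<xi> within \<Theta>) u" by (rule bdry[OF that(1)])
    also have "\<dots> \<le> Liminf (at \<xi> within G) u" by (rule Liminf_antimono_filter[OF at_le[OF that(3)]])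
    finally show ?thesis .
  qed
  have uM: "ereal (c - M) \<le> u z" if "z \<in> \<Theta>" for z
    by (rule exact_solution_le_superparabolic[OF p super exact_solution_const \<Theta> order_refl _ that order_refl])
      (intro bdry' far order_refl)
  have uM': "ereal r \<le> Liminf (at \<xi> within G) u" if "r \<le> c - M" "G \<subseteq> \<Theta>" for r \<xi> G
  proof (rule Liminf_bounded)
    have "eventually (\<lambda>z. z \<in> G) (at \<xi> within G)"
      unfolding eventually_at_filter by (intro always_eventually allI impI)
    then show "eventually (\<lambda>z. ereal r \<le> u z) (at \<xi> within G)"
    proof eventually_elim
      case (elim z)
      have "ereal r \<le> ereal (c - M)" using that by simp
      also have "\<dots> \<le> u z" using elim that(2) by (intro uM) (rule subsetD)
      finally show ?case .
    qed
  qed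
  have past: "ereal (c - barrier z) \<le> u z" if z: "z \<in> \<Theta>" "snd z \<le> 0" for z
  proof (cases "\<bar>fst z\<bar> < \<rho> (side z)")
    case False
    then show ?thesis using uM[OF z(1)] z(2) by (simp add: barrier_def past_def)
  next
    case True
    define \<sigma> where "\<sigma> = side z"
    have \<sigma>1: "\<bar>\<sigma>\<bar> = 1" by (simp add: \<sigma>_def)
    \<comment> \<open>This piece is not cut at time \<open>0\<close>; the time limit in
      \<open>exact_solution_le_superparabolic\<close> takes care of that. A frontier point with
      \<open>t \<le> 0\<close> that lies in \<Theta> is not on the ray, hence has
      \<open>\<bar>x\<bar> = \<rho> \<sigma>\<close>.\<close>
    define G where "G = \<Theta> \<inter> ({z. 0 < \<sigma> * (fst z + k * snd z)} \<inter> {z. \<bar>fst z\<bar> < \<rho> \<sigma>})"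
    have G: "open G" "bounded G" "G \<subseteq> \<Theta>"
      unfolding G_def using \<Theta> by (auto intro!: open_Int open_Collect_less continuous_intros intro: bounded_subset)
    have zG: "z \<in> G"
      using z ray[OF z] True by (auto simp: G_def \<sigma>_def side_def)
    have "ereal (c - H \<sigma> z) \<le> u z"
    proof (rule exact_solution_le_superparabolic[OF p super exact_solution_diff[OF H[OF \<sigma>1]] G _ zG z(2)])
      fix \<xi> assume \<xi>: "\<xi> \<in> frontier G" "snd \<xi> \<le> 0"
      have "closure G \<subseteq> closure \<Theta> \<inter> ({z. 0 \<le> \<sigma> * (fst z + k * snd z)} \<inter> {z. \<bar>fst z\<bar> \<le> \<rho> \<sigma>})"
        by (rule closure_minimal)
          (use closure_subset[of \<Theta>] in \<open>auto simp: G_def intro!: closed_Int closed_Collect_le continuous_intros\<close>)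
      then have \<xi>c: "\<xi> \<in> closure \<Theta>" "0 \<le> \<sigma> * (fst \<xi> + k * snd \<xi>)" "\<bar>fst \<xi>\<bar> \<le> \<rho> \<sigma>"
        using \<xi>(1) by (auto simp: frontier_def)
      have ps: "\<xi> \<in> past_side k \<sigma>" using \<xi>c \<xi>(2) by (simp add: past_side_def)
      have nG: "\<xi> \<notin> G" using \<xi>(1) G(1) by (simp add: frontier_def interior_open)
      show "ereal (c - H \<sigma> \<xi>) \<le> Liminf (at \<xi> within G) u"
      proof (cases "\<bar>fst \<xi>\<bar> = \<rho> \<sigma> \<or> snd \<xi> \<le> - \<delta>")
        case True
        then have "M \<le> H \<sigma> \<xi>" by (rule H_large[OF \<sigma>1 ps \<xi>c(3)])
        then show ?thesis by (intro uM' G) simp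
      next
        case False
        have "\<xi> \<notin> \<Theta>"
        proof
          assume "\<xi> \<in> \<Theta>"
          then have "\<sigma> * (fst \<xi> + k * snd \<xi>) \<noteq> 0" using ray[OF _ \<xi>(2)] \<sigma>1 by auto
          then show False using nG \<open>\<xi> \<in> \<Theta>\<close> \<xi>c False by (auto simp: G_def)
        qed
        then have fr: "\<xi> \<in> frontier \<Theta>" using \<xi>c(1) \<Theta>(1) by (simp add: frontier_def interior_open)
        have "c \<le> f \<xi>" using \<rho>[OF \<sigma>1] \<xi>c(3) \<xi>(2) False \<delta> by (intro near fr) auto
        moreover have "0 \<le> H \<sigma> \<xi>" by (rule H_nonneg[OF \<sigma>1 ps \<xi>c(3)])
        ultimately show ?thesis by (intro bdry' fr G) simp
      qed
    qed
    then show ?thesis using uM[OF z(1)] True z(2) by (auto simp: barrier_def past_def \<sigma>_def min_def)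
  qed
  show ?thesis
  proof (cases "0 < snd z")
    case False
    then show ?thesis using past z by simp
  next
    case True
    define G where "G = \<Theta> \<inter> {z. 0 < snd z}"
    have G: "open G" "bounded G" "G \<subseteq> \<Theta>"
      unfolding G_def using \<Theta> by (auto intro!: open_Int open_Collect_less continuous_intros intro: bounded_subset)
    have zG: "z \<in> G" using z True by (simp add: G_def)
    have "ereal (c - Hp z) \<le> u z"
    proof (rule exact_solution_le_superparabolic[OF p super exact_solution_diff[OF Hp] G _ zG order_refl])
      fix \<xi> assume \<xi>: "\<xi> \<in> frontier G"
      have "closure G \<subseteq> closure \<Theta> \<inter> {z. 0 \<le> snd z}"
        by (rule closure_minimal)
          (use closure_subset[of \<Theta>] in \<open>auto simp: G_def intro!: closed_Int closed_Collect_le continuous_intros\<close>)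
      then have \<xi>c: "\<xi> \<in> closure \<Theta>" "0 \<le> snd \<xi>"
        using \<xi> by (auto simp: frontier_def)
      have nG: "\<xi> \<notin> G" using \<xi> G(1) by (simp add: frontier_def interior_open)
      show "ereal (c - Hp \<xi>) \<le> Liminf (at \<xi> within G) u"
      proof (cases "\<delta> \<le> \<bar>fst \<xi>\<bar> \<or> \<delta> \<le> snd \<xi>")
        case True
        then have "M \<le> Hp \<xi>" by (rule Hp_large[OF \<xi>c(2)])
        then show ?thesis by (intro uM' G) simp
      next
        case False
        show ?thesis
        proof (cases "\<xi> \<in> \<Theta>")
          case True
          \<comment> \<open>At such a point lower semicontinuity of \<open>u\<close> carries the
            bound already proved at time \<open>0\<close> to the limit inferior, and the upward jump
            of the barrier replaces \<open>barrier\<close> by \<open>Hp\<close>.\<close>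
          then have s: "snd \<xi> = 0" using nG \<xi>c by (auto simp: G_def)
          have "ereal (c - Hp \<xi>) \<le> ereal (c - barrier \<xi>)" using barrier_initial[OF s] by simp
          also have "\<dots> \<le> u \<xi>" using past[OF True] s by simp
          also have "\<dots> \<le> Liminf (at \<xi> within \<Theta>) u" using super True by (simp add: p_superparabolic_def)
          also have "\<dots> \<le> Liminf (at \<xi> within G) u" by (rule Liminf_antimono_filter[OF at_le[OF G(3)]])
          finally show ?thesis .
        next
          case out: False
          then have fr: "\<xi> \<in> frontier \<Theta>" using \<xi>c(1) \<Theta>(1) by (simp add: frontier_def interior_open)
          have "c \<le> f \<xi>" using \<xi>c(2) False \<delta> by (intro near fr) auto
          then show ?thesis using Hp_nonneg[OF \<xi>c(2)] by (intro bdry' fr G) simp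
        qed
      qed
    qed
    then show ?thesis using uM[OF z] True by (auto simp: barrier_def min_def)
  qed
qed

lemma upper_perron_ge:
  assumes "\<And>\<xi>. \<xi> \<in> frontier \<Theta> \<Longrightarrow> \<bar>fst \<xi>\<bar> < 2 * \<delta> \<Longrightarrow> \<bar>snd \<xi>\<bar> < 2 * \<delta> \<Longrightarrow> c \<le> f \<xi>"
    and "\<And>\<xi>. \<xi> \<in> frontier \<Theta> \<Longrightarrow> c - M \<le> f \<xi>" and "z \<in> \<Theta>"
  shows "ereal (c - barrier z) \<le> upper_perron p \<Theta> f z"
  unfolding upper_perron_def by (rule INF_greatest, rule upper_class_ge) (use assms in auto)

end

section \<open>Construction of the barrier functions\<close>

lemma derivative_lower_bound:
  fixes f :: "real \<Rightarrow> real"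
  assumes "\<And>x. (f has_real_derivative f' x) (at x)" "a \<le> b" "\<And>x. a < x \<Longrightarrow> x < b \<Longrightarrow> m \<le> f' x"
  shows "m * (b - a) \<le> f b - f a"
proof (cases "a = b")
  case False
  then have "a < b" using assms(2) by simp
  then obtain z where z: "a < z" "z < b" "f b - f a = (b - a) * f' z"
    using MVT2[of a b f f'] assms(1) by blast
  then show ?thesis using mult_left_mono[OF assms(3)[OF z(1,2)], of "b - a"] \<open>a < b\<close> by (simp add: mult.commute)
qed simp

lemma derivative_upper_bound:
  fixes f :: "real \<Rightarrow> real"
  assumes "\<And>x. (f has_real_derivative f' x) (at x)" "a \<le> b" "\<And>x. a < x \<Longrightarrow> x < b \<Longrightarrow> f' x \<le> m"
  shows "f b - f a \<le> m * (b - a)"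
proof (cases "a = b")
  case False
  then have "a < b" using assms(2) by simp
  then obtain z where z: "a < z" "z < b" "f b - f a = (b - a) * f' z"
    using MVT2[of a b f f'] assms(1) by blast
  then show ?thesis using mult_left_mono[OF assms(3)[OF z(1,2)], of "b - a"] \<open>a < b\<close> by (simp add: mult.commute)
qed simp

lemma sgn_root_nonneg: "0 \<le> y \<Longrightarrow> sgn_root p y = y powr (1 / (p - 1))"
  by (cases "y = 0") (auto simp: sgn_root_def)

lemma powr_root_ge:
  fixes b y :: real
  assumes "1 < p" "0 \<le> y" "y powr (p - 1) \<le> b"
  shows "y \<le> b powr (1 / (p - 1))"
proof -
  have "y = (y powr (p - 1)) powr (1 / (p - 1))"
    using assms by (simp add: powr_powr)
  also have "\<dots> \<le> b powr (1 / (p - 1))"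
    using assms by (intro powr_mono2) auto
  finally show ?thesis .
qed

text \<open>The barrier is \<open>- \<alpha> t + \<psi> x\<close> with flux \<open>b - \<alpha> x\<close>. For \<open>\<bar>x\<bar> \<le> \<rho>\<close> the flux stays in
  \<open>[b / 2, 3 b / 2]\<close>, so \<open>\<psi>\<close> has slope comparable to \<open>b powr (1 / (p - 1))\<close>; \<open>\<alpha>\<close> is a multiple of
  this slope, large enough to beat \<open>\<psi>\<close> on the part \<open>x < 0\<close> of the sector, and \<open>b\<close> is large.\<close>

lemma sector_barrier_exists:
  assumes p: "1 < p" and \<delta>: "0 < \<delta>" and M: "0 < M" and K: "0 < K"
  obtains H \<rho> where "exact_solution p H" "0 < \<rho>" "\<rho> \<le> \<delta>" "H (0, 0) = 0"
    "\<And>x t. t \<le> 0 \<Longrightarrow> K * t \<le> x \<Longrightarrow> \<bar>x\<bar> \<le> \<rho> \<Longrightarrow> 0 \<le> H (x, t)"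
    "\<And>x t. t \<le> 0 \<Longrightarrow> K * t \<le> x \<Longrightarrow> \<bar>x\<bar> \<le> \<rho> \<Longrightarrow> \<bar>x\<bar> = \<rho> \<or> t \<le> - \<delta> \<Longrightarrow> M \<le> H (x, t)"
proof -
  define q where "q = 1 / (p - 1)"
  have q: "0 < q" using p by (simp add: q_def)
  define l1 where "l1 = (1/2 :: real) powr q"
  define l2 where "l2 = (3/2 :: real) powr q"
  have l: "0 < l1" "0 < l2" by (auto simp: l1_def l2_def)
  \<comment> \<open>\<gamma> is going to be \<open>\<beta> * \<rho>\<close>. The first entry gives
    \<open>H \<ge> M\<close> at \<open>x = \<rho>\<close>, the second at
    \<open>x = - \<rho>\<close>, where the sector forces
    \<open>\<bar>t\<bar> \<ge> \<rho> / K\<close>.\<close>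
  define \<gamma> where "\<gamma> = max (M / l1) (M * K / l2)"
  have \<gamma>: "M \<le> l1 * \<gamma>" "M * K \<le> l2 * \<gamma>" "0 < \<gamma>"
  proof -
    have "M / l1 \<le> \<gamma>" "M * K / l2 \<le> \<gamma>" by (auto simp: \<gamma>_def)
    then show "M \<le> l1 * \<gamma>" "M * K \<le> l2 * \<gamma>" using l by (auto simp: pos_divide_le_eq mult.commute)
    have "0 < M / l1" using M l by simp
    then show "0 < \<gamma>" using \<open>M / l1 \<le> \<gamma>\<close> by linarith
  qed
  \<comment> \<open>The three entries ensure, in this order,
    \<open>\<alpha> * \<rho> \<le> b / 2\<close>, \<open>\<rho> \<le> \<delta>\<close>, and
    \<open>M \<le> l2 * \<beta> * \<delta>\<close>, the last for the points with
    \<open>t \<le> - \<delta>\<close>.\<close>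
  define b where "b = max (2 * l2 * (K + 1) * \<gamma>) (max ((\<gamma> / \<delta>) powr (p - 1)) ((M / (l2 * \<delta>)) powr (p - 1)))"
  have b1: "2 * l2 * (K + 1) * \<gamma> \<le> b" by (simp add: b_def)
  have "0 < 2 * l2 * (K + 1) * \<gamma>" using l K \<gamma> by simp
  then have b0: "0 < b" using b1 by linarith
  define \<beta> where "\<beta> = b powr q"
  have \<beta>: "0 < \<beta>" "\<gamma> / \<delta> \<le> \<beta>" "M / (l2 * \<delta>) \<le> \<beta>"
    using b0 \<gamma> \<delta> M l p by (auto simp: \<beta>_def q_def b_def intro!: powr_root_ge)
  define \<rho> where "\<rho> = \<gamma> / \<beta>"
  have \<rho>: "0 < \<rho>" "\<rho> \<le> \<delta>" "\<beta> * \<rho> = \<gamma>"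
    using \<beta> \<gamma> \<delta> by (auto simp: \<rho>_def field_simps)
  \<comment> \<open>Of the factor \<open>K + 1\<close>, the part \<open>K\<close> makes up for
    \<open>\<psi> x \<ge> l2 * \<beta> * K * t\<close> when \<open>x < 0\<close>, and the part
    \<open>1\<close> leaves \<open>H \<ge> l2 * \<beta> * \<bar>t\<bar>\<close>.\<close>
  define \<alpha> where "\<alpha> = l2 * (K + 1) * \<beta>"
  have \<alpha>0: "0 < \<alpha>" using l K \<beta> by (simp add: \<alpha>_def)
  have \<alpha>\<rho>: "\<alpha> * \<rho> \<le> b / 2"
  proof -
    have "\<alpha> * \<rho> = l2 * (K + 1) * \<gamma>" using \<rho>(3) by (simp add: \<alpha>_def mult.assoc)
    then show ?thesis using b1 by simp
  qed
  obtain \<psi> where \<psi>: "\<And>x. (\<psi> has_real_derivative sgn_root p (- \<alpha> * x + b)) (at x)" "\<psi> 0 = 0"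
    by (rule exact_solution_exists[OF p, of "- \<alpha>" b 0]) (rule that)
  have slope: "l1 * \<beta> \<le> sgn_root p (- \<alpha> * x + b) \<and> sgn_root p (- \<alpha> * x + b) \<le> l2 * \<beta>" if "\<bar>x\<bar> \<le> \<rho>" for x
  proof -
    have "\<bar>\<alpha> * x\<bar> \<le> \<alpha> * \<rho>" using that \<alpha>0 by (simp add: abs_mult)
    then have bd: "1/2 * b \<le> - \<alpha> * x + b" "- \<alpha> * x + b \<le> 3/2 * b" using \<alpha>\<rho> by (simp_all add: abs_le_iff)
    have "l1 * \<beta> = (1/2 * b) powr q" "l2 * \<beta> = (3/2 * b) powr q"
      unfolding l1_def l2_def \<beta>_def using b0 by (simp_all add: powr_mult[symmetric])
    moreover have "sgn_root p (- \<alpha> * x + b) = (- \<alpha> * x + b) powr q"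
      unfolding q_def using bd(1) b0 by (intro sgn_root_nonneg) linarith
    ultimately show ?thesis using bd b0 q by (auto intro!: powr_mono2)
  qed
  define H where "H z = - \<alpha> * snd z + \<psi> (fst z)" for z
  have pos: "l1 * \<beta> * x \<le> \<psi> x" if "0 \<le> x" "x \<le> \<rho>" for x
    using derivative_lower_bound[OF \<psi>(1) that(1), of "l1 * \<beta>"] slope that \<psi>(2) by auto
  have neg: "l2 * \<beta> * x \<le> \<psi> x" if "x \<le> 0" "- \<rho> \<le> x" for x
    using derivative_upper_bound[OF \<psi>(1) that(1), of "l2 * \<beta>"] slope that \<psi>(2) by auto
  have main: "l2 * \<beta> * \<bar>t\<bar> \<le> H (x, t) \<and> (0 \<le> x \<longrightarrow> l1 * \<beta> * x \<le> H (x, t))"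
    if t: "t \<le> 0" and x: "K * t \<le> x" "\<bar>x\<bar> \<le> \<rho>" for x t
  proof -
    have lb: "0 < l2 * \<beta>" "0 < l1 * \<beta>" using l \<beta> by auto
    have Ht: "H (x, t) = (l2 * \<beta>) * (K + 1) * \<bar>t\<bar> + \<psi> x" using t by (simp add: H_def \<alpha>_def algebra_simps)
    show ?thesis
    proof (cases "0 \<le> x")
      case True
      have "0 \<le> (l2 * \<beta>) * (K * \<bar>t\<bar>)" "0 \<le> l2 * \<beta> * \<bar>t\<bar>" "0 \<le> l1 * \<beta> * x" using lb K True by auto
      then show ?thesis using pos[of x] x True unfolding Ht by (simp add: algebra_simps)
    next
      case False
      have "(l2 * \<beta>) * (K * t) \<le> (l2 * \<beta>) * x" using x lb by (intro mult_left_mono) auto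
      also have "\<dots> \<le> \<psi> x" using neg[of x] False x by (simp add: abs_le_iff)
      finally show ?thesis using t False unfolding Ht by (simp add: algebra_simps)
    qed
  qed
  show ?thesis
  proof (rule that[of H \<rho>])
    show "exact_solution p H"
      unfolding exact_solution_def H_def using \<psi>(1) by blast
    show "H (0, 0) = 0" by (simp add: H_def \<psi>(2))
    show "0 \<le> H (x, t)" if "t \<le> 0" "K * t \<le> x" "\<bar>x\<bar> \<le> \<rho>" for x t
    proof -
      have "0 \<le> l2 * \<beta> * \<bar>t\<bar>" using l \<beta> by simp
      then show ?thesis using main[OF that] by linarith
    qed
    show "M \<le> H (x, t)" if t: "t \<le> 0" and x: "K * t \<le> x" "\<bar>x\<bar> \<le> \<rho>" and d: "\<bar>x\<bar> = \<rho> \<or> t \<le> - \<delta>" for x t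
    proof -
      note m = main[OF t x]
      consider "x = \<rho>" | "x = - \<rho>" | "t \<le> - \<delta>" using d by linarith
      then show ?thesis
      proof cases
        case 1
        then have "l1 * \<beta> * \<rho> \<le> H (x, t)" using m \<rho> by auto
        moreover have "l1 * \<beta> * \<rho> = l1 * \<gamma>" using \<rho>(3) by (simp add: mult.assoc)
        ultimately show ?thesis using \<gamma> by simp
      next
        case 2
        have "M * K \<le> l2 * \<beta> * \<rho>" using \<gamma>(2) \<rho>(3) by (simp add: mult.assoc)
        also have "\<dots> \<le> l2 * \<beta> * (K * \<bar>t\<bar>)"
          using x 2 t l \<beta> by (intro mult_left_mono) auto
        finally have "M * K \<le> (l2 * \<beta> * \<bar>t\<bar>) * K" by (simp add: mult_ac)
        then have "M \<le> l2 * \<beta> * \<bar>t\<bar>" using K by (rule mult_right_le_imp_le)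
        then show ?thesis using m by linarith
      next
        case 3
        have "M \<le> l2 * \<beta> * \<delta>" using \<beta>(3) l \<delta> by (simp add: pos_divide_le_eq mult_ac)
        also have "\<dots> \<le> l2 * \<beta> * \<bar>t\<bar>" using 3 l \<beta> by (intro mult_left_mono) auto
        finally show ?thesis using m by linarith
      qed
    qed
  qed (use \<rho> in auto)
qed

text \<open>From \<open>r / 2\<close> on the slope is at least its value at \<open>r / 2\<close>,
  and at least the length \<open>r / 2\<close> remains up to \<open>x\<close>.\<close>

lemma exact_profile_growth:
  assumes p: "1 < p" and A: "0 < A" and \<psi>: "\<And>x. (\<psi> has_real_derivative sgn_root p (A * x)) (at x)" "\<psi> 0 = 0"
    and r: "0 < r" and x: "0 \<le> x"
  shows "0 \<le> \<psi> x" "r \<le> x \<Longrightarrow> r / 2 * (A * (r / 2)) powr (1 / (p - 1)) \<le> \<psi> x"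
proof -
  have nn: "0 \<le> \<psi> y" if "0 \<le> y" for y
    using derivative_lower_bound[OF \<psi>(1) that, of 0] \<psi>(2) A by (auto simp: sgn_root_nonneg)
  then show "0 \<le> \<psi> x" using x .
  define m where "m = (A * (r / 2)) powr (1 / (p - 1))"
  assume "r \<le> x"
  have "m * (x - r / 2) \<le> \<psi> x - \<psi> (r / 2)"
  proof (rule derivative_lower_bound[OF \<psi>(1)])
    show "r / 2 \<le> x" using \<open>r \<le> x\<close> r by simp
    fix y assume "r / 2 < y"
    then have "A * (r / 2) \<le> A * y" "0 \<le> A * (r / 2)" using A r by auto
    then show "m \<le> sgn_root p (A * y)"
      unfolding m_def using p by (subst sgn_root_nonneg) (auto intro!: powr_mono2)
  qed
  moreover have "m * (r / 2) \<le> m * (x - r / 2)"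
    using \<open>r \<le> x\<close> by (intro mult_left_mono) (auto simp: m_def)
  ultimately show "r / 2 * (A * (r / 2)) powr (1 / (p - 1)) \<le> \<psi> x"
    using nn[of "r / 2"] r by (simp add: m_def mult.commute)
qed

text \<open>Take \<open>\<epsilon> + A * t + \<psi> x\<close> with flux \<open>A * x\<close>. The
  first entry of \<open>A\<close> lets the time term reach \<open>M\<close> at time \<delta>, the
  second lets the profile reach \<open>M\<close> at distance \<open>r\<close>, while the value at
  the origin stays \<epsilon>.\<close>

lemma future_barrier_exists:
  assumes p: "1 < p" and r: "0 < r" "r \<le> \<delta>" and M: "0 < M" and \<epsilon>: "0 < \<epsilon>"
  obtains Hp where "exact_solution p Hp" "Hp (0, 0) = \<epsilon>"
    "\<And>x t. 0 \<le> t \<Longrightarrow> \<epsilon> \<le> Hp (x, t)"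
    "\<And>x t. 0 \<le> t \<Longrightarrow> r \<le> \<bar>x\<bar> \<or> \<delta> \<le> t \<Longrightarrow> M \<le> Hp (x, t)"
proof -
  define A where "A = max (M / \<delta>) ((2 * M / r) powr (p - 1) / (r / 2))"
  have \<delta>: "0 < \<delta>" using r by simp
  have "0 < M / \<delta>" using M \<delta> by simp
  moreover have "M / \<delta> \<le> A" by (simp add: A_def)
  ultimately have A0: "0 < A" by linarith
  have A1: "M \<le> A * \<delta>" using \<open>M / \<delta> \<le> A\<close> \<delta> by (simp add: pos_divide_le_eq)
  have "(2 * M / r) powr (p - 1) / (r / 2) \<le> A" by (simp add: A_def)
  then have "(2 * M / r) powr (p - 1) \<le> A * (r / 2)" using r(1) by (subst (asm) pos_divide_le_eq) auto
  then have "2 * M / r \<le> (A * (r / 2)) powr (1 / (p - 1))"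
    using p M r(1) by (intro powr_root_ge) auto
  then have A2: "M \<le> r / 2 * (A * (r / 2)) powr (1 / (p - 1))"
    using r(1) by (simp add: pos_divide_le_eq mult.commute)
  obtain \<psi> where \<psi>: "\<And>x. (\<psi> has_real_derivative sgn_root p (A * x + 0)) (at x)" "\<psi> 0 = 0"
    by (rule exact_solution_exists[OF p, of A 0 0]) (rule that)
  have \<psi>': "((\<lambda>x. \<psi> (- x)) has_real_derivative sgn_root p (A * x)) (at x)" for x
  proof -
    have "((\<lambda>x. \<psi> (- x)) has_real_derivative sgn_root p (A * (- x) + 0) * - 1) (at x)"
      by (rule DERIV_chain2[OF \<psi>(1)]) (auto intro!: derivative_eq_intros)
    then show ?thesis using sgn_root_minus[of p "A * x"] by simp
  qed
  have \<psi>0: "(\<psi> has_real_derivative sgn_root p (A * x)) (at x)" for x using \<psi>(1)[of x] by simp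
  have nn: "0 \<le> \<psi> x" for x
    using exact_profile_growth(1)[OF p A0 \<psi>0 \<psi>(2) r(1), of x] exact_profile_growth(1)[OF p A0 \<psi>' _ r(1), of "- x"] \<psi>(2)
    by (cases "0 \<le> x") auto
  have big: "M \<le> \<psi> x" if "r \<le> \<bar>x\<bar>" for x
    using exact_profile_growth(2)[OF p A0 \<psi>0 \<psi>(2) r(1), of x] exact_profile_growth(2)[OF p A0 \<psi>' _ r(1), of "- x"] \<psi>(2) A2 that
    by (cases "0 \<le> x") auto
  define Hp where "Hp z = A * snd z + (\<epsilon> + \<psi> (fst z))" for z
  show ?thesis
  proof (rule that[of Hp])
    have "((\<lambda>x. \<epsilon> + \<psi> x) has_real_derivative sgn_root p (A * x + 0)) (at x)" for x
      by (auto intro!: derivative_eq_intros \<psi>0)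
    then show "exact_solution p Hp" unfolding exact_solution_def Hp_def by blast
    show "Hp (0, 0) = \<epsilon>" by (simp add: Hp_def \<psi>(2))
    show "\<epsilon> \<le> Hp (x, t)" if "0 \<le> t" for x t
      using nn[of x] mult_nonneg_nonneg[of A t] A0 that by (simp add: Hp_def)
    show "M \<le> Hp (x, t)" if t: "0 \<le> t" and far: "r \<le> \<bar>x\<bar> \<or> \<delta> \<le> t" for x t
    proof (cases "r \<le> \<bar>x\<bar>")
      case True
      have "0 \<le> A * t" using A0 t by simp
      then show ?thesis using big[OF True] \<epsilon> by (simp add: Hp_def)
    next
      case False
      then have "A * \<delta> \<le> A * t" using far A0 by (intro mult_left_mono) auto
      then show ?thesis using A1 nn[of x] \<epsilon> by (simp add: Hp_def)
    qed
  qed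
qed

text \<open>A single function \<open>H\<close> serves both sides of the ray, after reflection in
  \<open>x\<close> for \<sigma> = -1.\<close>

lemma ray_barrier_exists:
  assumes p: "1 < p" and pos: "0 < \<epsilon>" "0 < \<delta>" "0 < M"
    and \<Theta>: "open \<Theta>" "bounded \<Theta>"
    and ray: "\<And>z. z \<in> \<Theta> \<Longrightarrow> snd z \<le> 0 \<Longrightarrow> fst z + k * snd z \<noteq> 0"
  obtains H \<rho> Hp where "ray_barrier p k \<epsilon> \<delta> M \<Theta> H \<rho> Hp"
proof -
  \<comment> \<open>Both sides of the ray, one of them reflected, are contained in the sector
    \<open>K * t \<le> x\<close>, \<open>t \<le> 0\<close>.\<close>
  define K where "K = \<bar>k\<bar> + 1"
  have K: "0 < K" by (simp add: K_def)
  obtain H \<rho> where H: "exact_solution p H" and \<rho>: "0 < \<rho>" "\<rho> \<le> \<delta>" and H0: "H (0, 0) = 0"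
    and Hn: "\<And>x t. t \<le> 0 \<Longrightarrow> K * t \<le> x \<Longrightarrow> \<bar>x\<bar> \<le> \<rho> \<Longrightarrow> 0 \<le> H (x, t)"
    and Hl: "\<And>x t. t \<le> 0 \<Longrightarrow> K * t \<le> x \<Longrightarrow> \<bar>x\<bar> \<le> \<rho> \<Longrightarrow> \<bar>x\<bar> = \<rho> \<or> t \<le> - \<delta> \<Longrightarrow> M \<le> H (x, t)"
    by (rule sector_barrier_exists[OF p pos(2,3) K]) (rule that)
  define H2 where "H2 \<sigma> z = H (\<sigma> * fst z, snd z)" for \<sigma> :: real and z
  have sg: "\<sigma> = 1 \<or> \<sigma> = - 1" if "\<bar>\<sigma>\<bar> = 1" for \<sigma> :: real using that by linarith
  have sector: "K * snd z \<le> \<sigma> * fst z \<and> snd z \<le> 0" if "\<bar>\<sigma>\<bar> = 1" "z \<in> past_side k \<sigma>" for \<sigma> z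
  proof -
    have z: "snd z \<le> 0" "0 \<le> \<sigma> * fst z + \<sigma> * k * snd z" using that(2) by (auto simp: past_side_def algebra_simps)
    have "\<sigma> * k \<ge> - K" using sg[OF that(1)] by (auto simp: K_def)
    then have "\<sigma> * k * snd z \<le> - K * snd z" using z(1) by (rule mult_right_mono_neg)
    then show ?thesis using z by simp
  qed
  have "((\<lambda>x. H (x, 0)) \<longlongrightarrow> H (0, 0)) (at 0)"
  proof -
    have "continuous_on UNIV (\<lambda>x. H (x, 0))"
      by (rule continuous_on_compose2[OF exact_solution_continuous[OF H, of UNIV]]) (auto intro!: continuous_intros)
    then show ?thesis by (simp add: continuous_on_def)
  qed
  then have "eventually (\<lambda>x. H (x, 0) < \<epsilon>) (at 0)"
    using order_tendstoD(2) H0 pos(1) by metis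
  then obtain r0 where r0: "r0 > 0" "\<And>x. x \<noteq> 0 \<Longrightarrow> \<bar>x\<bar> < r0 \<Longrightarrow> H (x, 0) < \<epsilon>"
    unfolding eventually_at by (auto simp: dist_real_def)
  \<comment> \<open>For \<open>\<bar>x\<bar> < r\<close> the past barrier at time \<open>0\<close>
    is at most \<epsilon>, hence below \<open>Hp\<close>; for larger \<open>\<bar>x\<bar>\<close>
    the function \<open>Hp\<close> is at least \<open>M\<close>. So \<open>r\<close> has to be fixed
    before \<open>Hp\<close>.\<close>
  define r where "r = min r0 \<rho>"
  have r: "0 < r" "r \<le> \<delta>" "r \<le> \<rho>" using r0 \<rho> by (auto simp: r_def)
  have small: "H (x, 0) \<le> \<epsilon>" if "\<bar>x\<bar> < r" for x
    using r0(2)[of x] H0 pos(1) that by (cases "x = 0") (auto simp: r_def)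
  obtain Hp where Hp: "exact_solution p Hp" "Hp (0, 0) = \<epsilon>"
    "\<And>x t. 0 \<le> t \<Longrightarrow> \<epsilon> \<le> Hp (x, t)"
    "\<And>x t. 0 \<le> t \<Longrightarrow> r \<le> \<bar>x\<bar> \<or> \<delta> \<le> t \<Longrightarrow> M \<le> Hp (x, t)"
    by (rule future_barrier_exists[OF p r(1,2) pos(3,1)]) (rule that)
  have "ray_barrier p k \<epsilon> \<delta> M \<Theta> H2 (\<lambda>_. \<rho>) Hp"
  proof
    fix \<sigma> :: real assume s: "\<bar>\<sigma>\<bar> = 1"
    show "exact_solution p (H2 \<sigma>)"
      using sg[OF s] H exact_solution_reflect[OF H] by (auto simp: H2_def[abs_def])
    show "0 < \<rho> \<and> \<rho> \<le> \<delta>" using \<rho> by simp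
    show "H2 \<sigma> (0, 0) \<le> \<epsilon>" using H0 pos(1) by (simp add: H2_def)
    show "0 \<le> H2 \<sigma> z" if "z \<in> past_side k \<sigma>" "\<bar>fst z\<bar> \<le> \<rho>" for z
      unfolding H2_def using sector[OF s that(1)] that(2) s by (intro Hn) (auto simp: abs_mult)
    show "M \<le> H2 \<sigma> z" if "z \<in> past_side k \<sigma>" "\<bar>fst z\<bar> \<le> \<rho>" "\<bar>fst z\<bar> = \<rho> \<or> snd z \<le> - \<delta>" for z
      unfolding H2_def using sector[OF s that(1)] that(2,3) s by (intro Hl) (auto simp: abs_mult)
    show "(if \<bar>x\<bar> < \<rho> then min (H2 \<sigma> (x, 0)) M else M) \<le> Hp (x, 0)" for x
    proof (cases "r \<le> \<bar>x\<bar>")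
      case True
      then have "M \<le> Hp (x, 0)" using Hp(4)[of 0 x] by simp
      then show ?thesis by auto
    next
      case False
      then have "H2 \<sigma> (x, 0) \<le> \<epsilon>" using small[of "\<sigma> * x"] s by (simp add: H2_def abs_mult)
      then show ?thesis using Hp(3)[of 0 x] False r(3) by auto
    qed
  next
    show "0 \<le> Hp z" if "0 \<le> snd z" for z using Hp(3)[of "snd z" "fst z"] that pos(1) by simp
    show "M \<le> Hp z" if "0 \<le> snd z" "\<delta> \<le> \<bar>fst z\<bar> \<or> \<delta> \<le> snd z" for z
      using Hp(4)[of "snd z" "fst z"] that r(2) by auto
  qed (use p pos \<Theta> ray Hp(1,2) in auto)
  then show ?thesis by (rule that)
qed

section \<open>The ray in the past, and regularity of the vertex\<close>

text \<open>Openness allows moving the given point to a negative time \<open>s\<close>, and the cone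
  contains the whole ray through the new point. At time \<open>0\<close> the claim says that the
  vertex is not in \<Theta>.\<close>

lemma open_cone_past_ray:
  fixes C :: "(real \<times> real) set"
  assumes C: "open_cone C" "C \<subseteq> - \<Theta>" and xt: "(x\<^sub>C, t\<^sub>C) \<in> C" "t\<^sub>C \<le> 0" and origin: "(0, 0) \<notin> \<Theta>"
  obtains k where "\<And>z. z \<in> \<Theta> \<Longrightarrow> snd z \<le> 0 \<Longrightarrow> fst z + k * snd z \<noteq> 0"
proof -
  obtain e where e: "e > 0" "ball (x\<^sub>C, t\<^sub>C) e \<subseteq> C" using C(1) xt(1) openE unfolding open_cone_def by blast
  define s where "s = t\<^sub>C - e / 2"
  have s: "s < 0" using e(1) xt(2) by (simp add: s_def)
  have "(x\<^sub>C, s) \<in> ball (x\<^sub>C, t\<^sub>C) e" using e(1) by (simp add: s_def dist_Pair_Pair dist_real_def)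
  then have "(x\<^sub>C, s) \<in> C" using e(2) by blast
  show ?thesis
  proof (rule that[of "- x\<^sub>C / s"])
    fix z assume z: "z \<in> \<Theta>" "snd z \<le> 0"
    show "fst z + - x\<^sub>C / s * snd z \<noteq> 0"
    proof
      assume eq: "fst z + - x\<^sub>C / s * snd z = 0"
      show False
      proof (cases "snd z = 0")
        case True
        then have "z = (0, 0)" using eq by (simp add: prod_eq_iff)
        then show False using z origin by simp
      next
        case False
        define c where "c = snd z / s"
        have "c > 0" using False z(2) s by (auto simp: c_def divide_neg_neg)
        moreover have "z = c *\<^sub>R (x\<^sub>C, s)" using eq s by (auto simp: c_def prod_eq_iff field_simps)
        ultimately have "z \<in> C" using C(1) \<open>(x\<^sub>C, s) \<in> C\<close> by (auto simp: open_cone_def)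
        then show False using z C(2) by blast
      qed
    qed
  qed
qed

theorem proposition5p1:
  fixes p :: real and \<Theta> C :: "(real \<times> real) set" and x\<^sub>C t\<^sub>C :: real
  assumes "1 < p"
    and "open \<Theta>" and "bounded \<Theta>" and "\<Theta> \<noteq> {}"
    and "(0, 0) \<in> frontier \<Theta>"
    and "open_cone C" and "C \<subseteq> - \<Theta>"
    and "(x\<^sub>C, t\<^sub>C) \<in> C" and "t\<^sub>C \<le> 0"
  shows "regular_point p \<Theta> (0, 0)"
  unfolding regular_point_def
proof (intro conjI allI impI)
  show "(0, 0) \<in> frontier \<Theta>" by fact
  fix f :: "real \<times> real \<Rightarrow> real" assume f: "continuous_on (frontier \<Theta>) f"
  have "(0, 0) \<notin> \<Theta>" using assms(2,5) by (simp add: frontier_def interior_open)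
  then obtain k where k: "\<And>z. z \<in> \<Theta> \<Longrightarrow> snd z \<le> 0 \<Longrightarrow> fst z + k * snd z \<noteq> 0"
    by (rule open_cone_past_ray[OF assms(6-9)]) (rule that)
  have "compact (frontier \<Theta>)" using assms(3) by (rule compact_frontier_bounded)
  then have "bounded (f ` frontier \<Theta>)" by (intro compact_imp_bounded compact_continuous_image f)
  then obtain B where B: "\<And>\<xi>. \<xi> \<in> frontier \<Theta> \<Longrightarrow> \<bar>f \<xi>\<bar> \<le> B" unfolding bounded_iff real_norm_def by blast
  have "0 \<le> B" using B[OF assms(5)] by linarith
  have close: "eventually (\<lambda>z. ereal (f (0, 0) - e) < upper_perron p \<Theta> f z \<and>
      upper_perron p \<Theta> f z < ereal (f (0, 0) + e)) (at (0, 0) within \<Theta>)" if e: "0 < e" for e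
  proof -
    obtain d where d: "d > 0" "\<And>\<xi>. \<xi> \<in> frontier \<Theta> \<Longrightarrow> dist \<xi> (0, 0) < d \<Longrightarrow> \<bar>f \<xi> - f (0, 0)\<bar> < e / 3"
      using f assms(5) e unfolding continuous_on_iff dist_real_def by (metis divide_pos_pos zero_less_numeral)
    \<comment> \<open>Two coordinates below \<open>2 * \<delta>\<close> give a distance below
      \<open>4 * \<delta> = d\<close>.\<close>
    define \<delta> where "\<delta> = d / 4"
    have near: "\<bar>f \<xi> - f (0, 0)\<bar> < e / 3" if "\<xi> \<in> frontier \<Theta>" "\<bar>fst \<xi>\<bar> < 2 * \<delta>" "\<bar>snd \<xi>\<bar> < 2 * \<delta>" for \<xi>
    proof (rule d(2)[OF that(1)])
      have "dist \<xi> (0, 0) \<le> \<bar>fst \<xi>\<bar> + \<bar>snd \<xi>\<bar>"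
        using norm_Pair_le[of "fst \<xi>" "snd \<xi>"] by (simp add: dist_norm minus_prod_def)
      then show "dist \<xi> (0, 0) < d" using that by (simp add: \<delta>_def)
    qed
    have \<delta>: "0 < \<delta>" using d(1) by (simp add: \<delta>_def)
    have M: "0 < 2 * B + 1" and e3: "0 < e / 3" using \<open>0 \<le> B\<close> e by auto
    \<comment> \<open>One third of \<open>e\<close> pays for the oscillation of \<open>f\<close>
      near the vertex, one for the value of the barrier at the vertex and one for its variation
      nearby. \<open>2 * B + 1\<close> exceeds every difference of values of
      \<open>f\<close>.\<close>
    obtain H \<rho> Hp where "ray_barrier p k (e / 3) \<delta> (2 * B + 1) \<Theta> H \<rho> Hp"
      by (rule ray_barrier_exists[OF assms(1) e3 \<delta> M assms(2,3) k]) (assumption, assumption, rule that)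
    then interpret ray_barrier p k "e / 3" \<delta> "2 * B + 1" \<Theta> H \<rho> Hp .
    have up: "upper_perron p \<Theta> f z \<le> ereal (f (0, 0) + e / 3 + barrier z)" for z
    proof (rule upper_perron_le)
      fix \<xi> assume "\<xi> \<in> frontier \<Theta>"
      from B[OF this] B[OF assms(5)] show "f \<xi> \<le> f (0, 0) + e / 3 + (2 * B + 1)" using e by linarith
      show "f \<xi> \<le> f (0, 0) + e / 3" if "\<xi> \<in> frontier \<Theta>" "\<bar>fst \<xi>\<bar> < 2 * \<delta>" "\<bar>snd \<xi>\<bar> < 2 * \<delta>" for \<xi>
        using near[OF that] by linarith
    qed
    have low: "ereal (f (0, 0) - e / 3 - barrier z) \<le> upper_perron p \<Theta> f z" if "z \<in> \<Theta>" for z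
    proof (rule upper_perron_ge[OF _ _ that])
      fix \<xi> assume "\<xi> \<in> frontier \<Theta>"
      from B[OF this] B[OF assms(5)] show "f (0, 0) - e / 3 - (2 * B + 1) \<le> f \<xi>" using e by linarith
      show "f (0, 0) - e / 3 \<le> f \<xi>" if "\<xi> \<in> frontier \<Theta>" "\<bar>fst \<xi>\<bar> < 2 * \<delta>" "\<bar>snd \<xi>\<bar> < 2 * \<delta>" for \<xi>
        using near[OF that] by linarith
    qed
    have "eventually (\<lambda>z. z \<in> \<Theta>) (at (0, 0) within \<Theta>)"
      unfolding eventually_at_filter by (intro always_eventually allI impI)
    with barrier_small_at_origin[OF e3, of \<Theta>] show ?thesis
    proof eventually_elim
      case (elim z)
      have "ereal (f (0, 0) - e) < ereal (f (0, 0) - e / 3 - barrier z)" using elim(1) by simp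
      moreover have "ereal (f (0, 0) + e / 3 + barrier z) < ereal (f (0, 0) + e)" using elim(1) by simp
      ultimately show ?case using low[OF elim(2)] up[of z] by (meson le_less_trans less_le_trans)
    qed
  qed
  show "(upper_perron p \<Theta> f \<longlongrightarrow> ereal (f (0, 0))) (at (0, 0) within \<Theta>)"
  proof (rule order_tendstoI)
    fix a assume "a < ereal (f (0, 0))"
    then obtain a' where a': "a < ereal a'" "ereal a' < ereal (f (0, 0))" using ereal_dense2 by blast
    have "eventually (\<lambda>z. ereal a' < upper_perron p \<Theta> f z) (at (0, 0) within \<Theta>)"
      using close[of "f (0, 0) - a'"] a'(2) by (auto elim: eventually_mono)
    then show "eventually (\<lambda>z. a < upper_perron p \<Theta> f z) (at (0, 0) within \<Theta>)"
      by eventually_elim (rule less_trans[OF a'(1)])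
  next
    fix a assume "ereal (f (0, 0)) < a"
    then obtain a' where a': "ereal (f (0, 0)) < ereal a'" "ereal a' < a" using ereal_dense2 by blast
    have "eventually (\<lambda>z. upper_perron p \<Theta> f z < ereal a') (at (0, 0) within \<Theta>)"
      using close[of "a' - f (0, 0)"] a'(1) by (auto elim: eventually_mono)
    then show "eventually (\<lambda>z. upper_perron p \<Theta> f z < a) (at (0, 0) within \<Theta>)"
      by eventually_elim (rule less_trans[OF _ a'(2)])
  qed
qed

end
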